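(* Let $\eta,\kappa \in \mathbb{Z}_+ \sqcup \{\infty\}$ with $\eta \geqslant 2$. Let $S_{\boldsymbol\lambda}$ be a subnormal weighted shift on the directed tree $\mathscr{T}_{\eta,\kappa}$ with nonzero weights $\boldsymbol\lambda = \{\lambda_v\}_{v \in V_{\eta,\kappa}^\circ}$. Consider the following conditions on a sequence $\{\mu_i\}_{i=1}^\eta$ of Borel probability measures on $\mathbb{R}_+$ (and, in (F) and (G), on a Borel probability measure $\nu$ on $\mathbb{R}_+$): (A) $\int_0^\infty s^n \, d \mu_i(s) = \big|\prod_{j=2}^{n+1}\lambda_{i,j}\big|^2$ for all $n \in \mathbb{N}$ and $i \in J_\eta$; (B) $\sum_{i=1}^\eta |\lambda_{i,1}|^2 \int_0^\infty \frac 1 s\, d \mu_i(s) \leqslant 1$; (C) $\sum_{i=1}^\eta |\lambda_{i,1}|^2 \int_0^\infty \frac 1 s\, d \mu_i(s) = 1$; (D) $\big|\prod_{j=0}^{l-1} \lambda_{-j}\big|^2 \sum_{i=1}^\eta|\lambda_{i,1}|^2 \int_0^\infty \frac 1 {s^{l+1}}\, d \mu_i(s) = 1$ for all $l \in J_{\kappa-1}$ (where $J_{\kappa-1}=\mathbb{N}$ if $\kappa=\infty$); (E) $\big|\prod_{j=0}^{\kappa-1} \lambda_{-j}\big|^2\sum_{i=1}^\eta|\lambda_{i,1}|^2 \int_0^\infty \frac 1 {s^{\kappa+1}}\, d \mu_i(s) \leqslant 1$; (F) $\int_0^\infty s^n \, d \nu(s) = \big|\prod_{j=\kappa-n}^{\kappa-1}\lambda_{-j}\big|^2$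 for all $n \in J_\kappa$; (G) $\int_\sigma s^\kappa \, d \nu(s) = \big|\prod_{j=0}^{\kappa-1} \lambda_{-j}\big|^2 \sum_{i=1}^\eta |\lambda_{i,1}|^2 \int_\sigma \frac{1}{s} \, d \mu_i(s)$ for all $\sigma \in \mathfrak{B}(\mathbb{R}_+)$. If $e_0 \in \mathcal{D}^\infty(S_{\boldsymbol\lambda})$ and $$( * )\qquad \Big\{\sum_{i=1}^\eta \Big|\prod_{j=1}^{n+1} \lambda_{i,j}\Big|^2\Big\}_{n=0}^\infty \text{ is a determinate Stieltjes moment sequence},$$ then the following four assertions hold: (i) if $\kappa = 0$, then there exists a sequence $\{\mu_i\}_{i=1}^\eta$ of Borel probability measures on $\mathbb{R}_+$ that satisfies (A) and (B); (ii) if $0 < \kappa < \infty$, then there exists a sequence $\{\mu_i\}_{i=1}^\eta$ of Borel probability measures on $\mathbb{R}_+$ that satisfies (A), (C), (D) and (E); (iii) if $0 < \kappa < \infty$, then there exist a sequence $\{\mu_i\}_{i=1}^\eta$ of Borel probability measures on $\mathbb{R}_+$ and a Borel probability measure $\nu$ on $\mathbb{R}_+$ that satisfy (A), (F) and (G); (iv) if $\kappa=\infty$, then there exists a sequence $\{\mu_i\}_{i=1}^\eta$ of Borel probability measures on $\mathbb{R}_+$ that satisfies (A), (C) and (D). Moreover (with $S_{\boldsymbol\lambda}$ subnormal with nonzero weights and $e_0 \in \mathcal{D}^\infty(S_{\boldsymbol\lambda})$), if $\sum_{n=1}^\infty \big(\sum_{i=1}^\eta \big|\prod_{j=1}^{n}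 \lambda_{i,j}\big|^2\big)^{-\frac{1}{2n}} = \infty$, then $( * )$ is satisfied.
   Context: Notation: $\mathbb{Z}_+=\{0,1,2,\ldots\}$, $\mathbb{N}=\{1,2,\ldots\}$, $\mathbb{R}_+=[0,\infty)$, $\mathfrak{B}(\mathbb{R}_+)$ is the Borel $\sigma$-algebra of $\mathbb{R}_+$, and $\int_0^\infty$ means the integral over $\mathbb{R}_+$ (including the point $0$). Conventions: $1/0=\infty$, $0\cdot\infty=0$. For $\iota\in\mathbb{Z}_+\sqcup\{\infty\}$, $J_\iota=\{k\in\mathbb{N}\colon k\leqslant\iota\}$ (so $J_0=\varnothing$, $J_\infty=\mathbb{N}$). A sequence $\{t_n\}_{n=0}^\infty\subseteq\mathbb{R}_+$ is a Stieltjes moment sequence if there is a positive Borel measure $\mu$ on $\mathbb{R}_+$ (a representing measure) with $t_n=\int_0^\infty s^n\,d\mu(s)$ for all $n\in\mathbb{Z}_+$; it is determinate if it has only one representing measure. The directed tree $\mathscr{T}_{\eta,\kappa}=(V_{\eta,\kappa},E_{\eta,\kappa})$ has vertex set $$V_{\eta,\kappa}=\{-k\colon k\in J_\kappa\}\sqcup\{0\}\sqcup\{(i,j)\colon i\in J_\eta,\ j\in\mathbb{N}\}$$ and edge set $$E_{\eta,\kappa}=\{(-k,-k+1)\colon k\in J_\kappa\}\sqcup\{(0,(i,1))\colon i\in J_\eta\}\sqcup\{((i,j),(i,j+1))\colon i\in J_\eta,\ j\in\mathbb{N}\},$$ where $(u,v)\in E_{\eta,\kappa}$ means that $u$ is the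 parent of $v$, written $u=\mathrm{par}(v)$. If $\kappa<\infty$ the tree has the root $-\kappa$ (the unique vertex without parent) and $V_{\eta,\kappa}^\circ=V_{\eta,\kappa}\setminus\{-\kappa\}$; if $\kappa=\infty$ the tree is rootless and $V_{\eta,\kappa}^\circ=V_{\eta,\kappa}$. Write $\lambda_{i,j}$ for $\lambda_{(i,j)}$. With $V=V_{\eta,\kappa}$, $\ell^2(V)$ is the Hilbert space of square summable complex functions on $V$, and $e_u\in\ell^2(V)$ is the characteristic function of $\{u\}$. The weighted shift with weights $\boldsymbol\lambda=\{\lambda_v\}_{v\in V^\circ}\subseteq\mathbb{C}$ is the operator $S_{\boldsymbol\lambda}$ in $\ell^2(V)$ with domain $\mathcal{D}(S_{\boldsymbol\lambda})=\{f\in\ell^2(V)\colon \Lambda f\in\ell^2(V)\}$ and $S_{\boldsymbol\lambda}f=\Lambda f$, where $(\Lambda f)(v)=\lambda_v f(\mathrm{par}(v))$ for $v\in V^\circ$ and $(\Lambda f)(v)=0$ if $v$ is the root. For an operator $A$, $\mathcal{D}^\infty(A)=\bigcap_{n=0}^\infty\mathcal{D}(A^n)$. A densely defined (possibly unbounded) operator $S$ in a complex Hilbert space $\mathcal{H}$ is subnormal if there exist a complex Hilbert space $\mathcal{K}\supseteq\mathcal{H}$ (isometric embedding) and a (possibly unbounded) normal operator $N$ in $\mathcal{K}$ such that $\mathcal{D}(S)\subseteq\mathcal{D}(N)$ and $Sh=Nh$ for all $h\in\mathcal{D}(S)$. *)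

theory Defs
  imports "HOL-Probability.Probability" "HOL-Library.Extended_Nat"
begin

section \<open>Complex Hilbert spaces and unbounded operators\<close>

text \<open>The norm and the topology are those of \<^class>\<open>real_inner\<close>, tied to the complex
  inner product by the requirement that its real part is the real inner product.
  The inner product is linear in its first argument.\<close>

class complex_hilbert_space = real_inner + complete_space +
  fixes scaleC :: "complex \<Rightarrow> 'a \<Rightarrow> 'a"
    and cinner :: "'a \<Rightarrow> 'a \<Rightarrow> complex"
  assumes scaleC_add_right: "scaleC a (x + y) = scaleC a x + scaleC a y"
    and scaleC_add_left: "scaleC (a + b) x = scaleC a x + scaleC b x"
    and scaleC_scaleC: "scaleC a (scaleC b x) = scaleC (a * b) x"
    and scaleC_of_real: "scaleC (complex_of_real r) x = scaleR r x"
    and cinner_commute: "cinner x y = cnj (cinner y x)"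
    and cinner_add_left: "cinner (x + y) z = cinner x z + cinner y z"
    and cinner_scaleC_left: "cinner (scaleC a x) y = a * cinner x y"
    and Re_cinner: "Re (cinner x y) = inner x y"

text \<open>An operator is identified with its graph, so that equality of operators includes
  equality of domains, \<open>A O B\<close> is the graph of the composition of first \<open>A\<close> and then \<open>B\<close>
  (with its natural domain), and \<open>A ^^ n\<close> is the graph of the \<open>n\<close>-th power.\<close>

definition is_operator :: "('k::complex_hilbert_space \<times> 'k) set \<Rightarrow> bool" where
  "is_operator N \<longleftrightarrow> single_valued N \<and> (0, 0) \<in> N \<and>
     (\<forall>x x' y y'. (x, x') \<in> N \<longrightarrow> (y, y') \<in> N \<longrightarrow> (x + y, x' + y') \<in> N) \<and>
     (\<forall>c x x'. (x, x') \<in> N \<longrightarrow> (scaleC c x, scaleC c x') \<in> N)"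

definition adjoint_op :: "('k::complex_hilbert_space \<times> 'k) set \<Rightarrow> ('k \<times> 'k) set" where
  "adjoint_op N = {(g, h). \<forall>(f, f') \<in> N. cinner f' g = cinner f h}"

definition normal_op :: "('k::complex_hilbert_space \<times> 'k) set \<Rightarrow> bool" where
  "normal_op N \<longleftrightarrow> is_operator N \<and> closure (Domain N) = UNIV \<and> closed N \<and>
     N O adjoint_op N = adjoint_op N O N"

text \<open>For \<open>n = 0\<close> the power \<open>A ^^ 0\<close> is the identity relation on the whole type, whose domain
  may be larger than the underlying Hilbert space; the factor \<open>n = 1\<close> makes this immaterial.\<close>

definition smooth_domain :: "('h \<times> 'h) set \<Rightarrow> 'h set" where
  "smooth_domain A = (\<Inter>n. Domain (A ^^ n))"

text \<open>Square summable functions on the set \<open>X\<close> are represented by functions on the whole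
  type that vanish outside \<open>X\<close>.\<close>

definition ell2 :: "'v set \<Rightarrow> ('v \<Rightarrow> complex) set" where
  "ell2 X = {f. (\<forall>v. v \<notin> X \<longrightarrow> f v = 0) \<and> (\<lambda>v. (cmod (f v))\<^sup>2) summable_on X}"

definition ell2_norm :: "'v set \<Rightarrow> ('v \<Rightarrow> complex) \<Rightarrow> real" where
  "ell2_norm X f = sqrt (\<Sum>\<^sub>\<infinity>v\<in>X. (cmod (f v))\<^sup>2)"

definition isometric_embedding ::
  "'v set \<Rightarrow> (('v \<Rightarrow> complex) \<Rightarrow> 'k::complex_hilbert_space) \<Rightarrow> bool" where
  "isometric_embedding X U \<longleftrightarrow>
     (\<forall>f\<in>ell2 X. \<forall>g\<in>ell2 X. U (\<lambda>v. f v + g v) = U f + U g) \<and>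
     (\<forall>c. \<forall>f\<in>ell2 X. U (\<lambda>v. c * f v) = scaleC c (U f)) \<and>
     (\<forall>f\<in>ell2 X. norm (U f) = ell2_norm X f)"

text \<open>Subnormality of (the graph \<open>S\<close> of) an operator in \<open>ell2 X\<close>. HOL cannot quantify over the
  type carrying the larger Hilbert space inside a formula, so that type is a parameter.  As a
  premise with a free type variable, \<open>subnormal TYPE('k) X S\<close> amounts to the existence of a
  normal extension in some complex Hilbert space.\<close>

definition subnormal ::
  "'k::complex_hilbert_space itself \<Rightarrow> 'v set \<Rightarrow> (('v \<Rightarrow> complex) \<times> ('v \<Rightarrow> complex)) set \<Rightarrow> bool"
where
  "subnormal _ X S \<longleftrightarrow>
     (\<forall>f\<in>ell2 X. \<forall>\<epsilon>>0. \<exists>g\<in>Domain S. ell2_norm X (\<lambda>v. f v - g v) < \<epsilon>) \<and>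
     (\<exists>(U :: ('v \<Rightarrow> complex) \<Rightarrow> 'k) N. isometric_embedding X U \<and> normal_op N \<and>
        (\<forall>(f, g) \<in> S. (U f, U g) \<in> N))"

section \<open>Weighted shifts on directed trees with one branching vertex\<close>

definition J :: "enat \<Rightarrow> nat set" where
  "J \<iota> = {k. 1 \<le> k \<and> enat k \<le> \<iota>}"

text \<open>\<open>Trunk k\<close> is the vertex \<open>-k\<close> (in particular \<open>Trunk 0\<close> is the vertex \<open>0\<close>), and
  \<open>Branch i j\<close> is the vertex \<open>(i, j)\<close>.\<close>

datatype vertex = Trunk nat | Branch nat nat

definition verts :: "enat \<Rightarrow> enat \<Rightarrow> vertex set" where
  "verts \<eta> \<kappa> = {Trunk k | k. k \<in> J \<kappa>} \<union> {Trunk 0} \<union> {Branch i j | i j. i \<in> J \<eta> \<and> 1 \<le> j}"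

definition edges :: "enat \<Rightarrow> enat \<Rightarrow> (vertex \<times> vertex) set" where
  "edges \<eta> \<kappa> = {(Trunk k, Trunk (k - 1)) | k. k \<in> J \<kappa>}
     \<union> {(Trunk 0, Branch i 1) | i. i \<in> J \<eta>}
     \<union> {(Branch i j, Branch i (j + 1)) | i j. i \<in> J \<eta> \<and> 1 \<le> j}"

definition par :: "enat \<Rightarrow> enat \<Rightarrow> vertex \<Rightarrow> vertex" where
  "par \<eta> \<kappa> v = (THE u. (u, v) \<in> edges \<eta> \<kappa>)"

definition verts_nonroot :: "enat \<Rightarrow> enat \<Rightarrow> vertex set" where
  "verts_nonroot \<eta> \<kappa> =
     (case \<kappa> of enat k \<Rightarrow> verts \<eta> \<kappa> - {Trunk k} | \<infinity> \<Rightarrow> verts \<eta> \<kappa>)"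

definition shift_map ::
  "enat \<Rightarrow> enat \<Rightarrow> (vertex \<Rightarrow> complex) \<Rightarrow> (vertex \<Rightarrow> complex) \<Rightarrow> vertex \<Rightarrow> complex" where
  "shift_map \<eta> \<kappa> w f v = (if v \<in> verts_nonroot \<eta> \<kappa> then w v * f (par \<eta> \<kappa> v) else 0)"

definition weighted_shift ::
  "enat \<Rightarrow> enat \<Rightarrow> (vertex \<Rightarrow> complex) \<Rightarrow> ((vertex \<Rightarrow> complex) \<times> (vertex \<Rightarrow> complex)) set" where
  "weighted_shift \<eta> \<kappa> w =
     {(f, shift_map \<eta> \<kappa> w f) | f.
        f \<in> ell2 (verts \<eta> \<kappa>) \<and> shift_map \<eta> \<kappa> w f \<in> ell2 (verts \<eta> \<kappa>)}"

definition basis_fun :: "'v \<Rightarrow> 'v \<Rightarrow> complex" where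
  "basis_fun u v = (if v = u then 1 else 0)"

section \<open>Stieltjes moment sequences\<close>

definition borel_Rplus :: "real measure" where
  "borel_Rplus = restrict_space borel {0..}"

definition stieltjes_representing :: "real measure \<Rightarrow> (nat \<Rightarrow> real) \<Rightarrow> bool" where
  "stieltjes_representing \<mu> t \<longleftrightarrow> sets \<mu> = sets borel_Rplus \<and>
     (\<forall>n. (\<integral>\<^sup>+ s. ennreal s ^ n \<partial>\<mu>) = ennreal (t n))"

definition stieltjes_moment_seq :: "(nat \<Rightarrow> real) \<Rightarrow> bool" where
  "stieltjes_moment_seq t \<longleftrightarrow> (\<forall>n. 0 \<le> t n) \<and> (\<exists>\<mu>. stieltjes_representing \<mu> t)"

definition determinate_stieltjes_moment_seq :: "(nat \<Rightarrow> real) \<Rightarrow> bool" where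
  "determinate_stieltjes_moment_seq t \<longleftrightarrow> stieltjes_moment_seq t \<and>
     (\<forall>\<mu> \<nu>. stieltjes_representing \<mu> t \<longrightarrow> stieltjes_representing \<nu> t \<longrightarrow> \<mu> = \<nu>)"

text \<open>If \<open>basis_fun (Trunk 0)\<close> is in the domain of the \<open>n\<close>-th power of the weighted shift, then
  for \<open>n \<ge> 1\<close> the sum below converges, to the squared norm of the image of that vector under
  the power.  Without this hypothesis and for infinite \<open>\<eta>\<close> the sum may diverge, in which case
  \<^const>\<open>infsum\<close> returns 0.\<close>

definition branch_sum :: "enat \<Rightarrow> (vertex \<Rightarrow> complex) \<Rightarrow> nat \<Rightarrow> real" where
  "branch_sum \<eta> w n = (\<Sum>\<^sub>\<infinity>i\<in>J \<eta>. (cmod (\<Prod>j=1..n. w (Branch i j)))\<^sup>2)"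

section \<open>Conditions on representing measures\<close>

text \<open>All integrals and sums below take values in \<^typ>\<open>ennreal\<close>, where \<open>1 / 0 = \<infinity>\<close> and
  \<open>0 * \<infinity> = 0\<close>, and where every family is summable.\<close>

definition prob_Rplus :: "real measure \<Rightarrow> bool" where
  "prob_Rplus \<mu> \<longleftrightarrow> sets \<mu> = sets borel_Rplus \<and> prob_space \<mu>"

definition cond_A :: "enat \<Rightarrow> (vertex \<Rightarrow> complex) \<Rightarrow> (nat \<Rightarrow> real measure) \<Rightarrow> bool" where
  "cond_A \<eta> w \<mu> \<longleftrightarrow> (\<forall>n\<ge>1. \<forall>i\<in>J \<eta>.
     (\<integral>\<^sup>+ s. ennreal s ^ n \<partial>\<mu> i) = ennreal ((cmod (\<Prod>j=2..n+1. w (Branch i j)))\<^sup>2))"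

definition cond_B :: "enat \<Rightarrow> (vertex \<Rightarrow> complex) \<Rightarrow> (nat \<Rightarrow> real measure) \<Rightarrow> bool" where
  "cond_B \<eta> w \<mu> \<longleftrightarrow>
     (\<Sum>\<^sub>\<infinity>i\<in>J \<eta>. ennreal ((cmod (w (Branch i 1)))\<^sup>2) * (\<integral>\<^sup>+ s. 1 / ennreal s \<partial>\<mu> i)) \<le> 1"

definition cond_C :: "enat \<Rightarrow> (vertex \<Rightarrow> complex) \<Rightarrow> (nat \<Rightarrow> real measure) \<Rightarrow> bool" where
  "cond_C \<eta> w \<mu> \<longleftrightarrow>
     (\<Sum>\<^sub>\<infinity>i\<in>J \<eta>. ennreal ((cmod (w (Branch i 1)))\<^sup>2) * (\<integral>\<^sup>+ s. 1 / ennreal s \<partial>\<mu> i)) = 1"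

definition cond_D :: "enat \<Rightarrow> enat \<Rightarrow> (vertex \<Rightarrow> complex) \<Rightarrow> (nat \<Rightarrow> real measure) \<Rightarrow> bool" where
  "cond_D \<eta> \<kappa> w \<mu> \<longleftrightarrow> (\<forall>l\<in>J (\<kappa> - 1).
     ennreal ((cmod (\<Prod>j<l. w (Trunk j)))\<^sup>2) *
     (\<Sum>\<^sub>\<infinity>i\<in>J \<eta>. ennreal ((cmod (w (Branch i 1)))\<^sup>2) *
        (\<integral>\<^sup>+ s. 1 / ennreal s ^ (l + 1) \<partial>\<mu> i)) = 1)"

text \<open>The remaining conditions only concern finite \<open>\<kappa>\<close>, which is the natural number \<open>k\<close> below.\<close>

definition cond_E :: "enat \<Rightarrow> nat \<Rightarrow> (vertex \<Rightarrow> complex) \<Rightarrow> (nat \<Rightarrow> real measure) \<Rightarrow> bool" where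
  "cond_E \<eta> k w \<mu> \<longleftrightarrow>
     ennreal ((cmod (\<Prod>j<k. w (Trunk j)))\<^sup>2) *
     (\<Sum>\<^sub>\<infinity>i\<in>J \<eta>. ennreal ((cmod (w (Branch i 1)))\<^sup>2) *
        (\<integral>\<^sup>+ s. 1 / ennreal s ^ (k + 1) \<partial>\<mu> i)) \<le> 1"

definition cond_F :: "nat \<Rightarrow> (vertex \<Rightarrow> complex) \<Rightarrow> real measure \<Rightarrow> bool" where
  "cond_F k w \<nu> \<longleftrightarrow> (\<forall>n\<in>J (enat k).
     (\<integral>\<^sup>+ s. ennreal s ^ n \<partial>\<nu>) = ennreal ((cmod (\<Prod>j\<in>{k - n..<k}. w (Trunk j)))\<^sup>2))"

definition cond_G ::
  "enat \<Rightarrow> nat \<Rightarrow> (vertex \<Rightarrow> complex) \<Rightarrow> (nat \<Rightarrow> real measure) \<Rightarrow> real measure \<Rightarrow> bool" where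
  "cond_G \<eta> k w \<mu> \<nu> \<longleftrightarrow> (\<forall>\<sigma>\<in>sets borel_Rplus.
     (\<integral>\<^sup>+ s\<in>\<sigma>. ennreal s ^ k \<partial>\<nu>) =
     ennreal ((cmod (\<Prod>j<k. w (Trunk j)))\<^sup>2) *
     (\<Sum>\<^sub>\<infinity>i\<in>J \<eta>. ennreal ((cmod (w (Branch i 1)))\<^sup>2) *
        (\<integral>\<^sup>+ s\<in>\<sigma>. 1 / ennreal s \<partial>\<mu> i)))"

end

theory Submission
  imports Defs "HOL-Computational_Algebra.Fundamental_Theorem_Algebra"
begin

text \<open>The link between subnormality and moments is that \<open>\<parallel>N\<^sup>n f\<parallel>\<^sup>2\<close> is a Stieltjes moment sequence
whenever \<open>N\<close> is normal and \<open>f\<close> lies in the domain of every power of \<open>N\<close>.  The reason is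
commutation.  A normal operator satisfies \<open>D(N) \<subseteq> D(N\<^sup>*)\<close> (\<open>normal_op_Domain_adjoint\<close>), and
therefore \<open>N\<close> and \<open>N\<^sup>*\<close> act on such vectors as commuting, formally adjoint maps.  Consequently
\<open>\<parallel>N\<^sup>i\<^sup>+\<^sup>j f\<parallel>\<^sup>2 = \<langle>(N\<^sup>*N)\<^sup>i f, (N\<^sup>*N)\<^sup>j f\<rangle>\<close> and
\<open>\<parallel>N\<^sup>i\<^sup>+\<^sup>j\<^sup>+\<^sup>1 f\<parallel>\<^sup>2 = \<langle>N (N\<^sup>*N)\<^sup>i f, N (N\<^sup>*N)\<^sup>j f\<rangle>\<close>, so that both Hankel forms of the sequence are
Gram forms (\<open>normal_op_chain_Hankel\<close>), and Stieltjes' theorem (\<open>stieltjes_moment_theorem\<close>) provides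
a representing measure.  The latter is obtained from Gauss quadrature (\<open>quadrature\<close>) and Helly's
selection theorem.

Applied to the basis vectors of the tree this gives measures \<open>\<mu>\<^sub>i\<close> for \<open>e\<^sub>i\<^sub>,\<^sub>1\<close>, which satisfy (A), and
\<open>\<rho>\<^sub>k\<close> for \<open>e\<^sub>-\<^sub>k\<close>.  Let \<open>c\<^sub>k\<close> be the product of \<open>|\<lambda>\<^sub>-\<^sub>j|\<^sup>2\<close> over \<open>j < k\<close>.  The mixture
\<open>\<Sum>\<^sub>i |\<lambda>\<^sub>i\<^sub>,\<^sub>1|\<^sup>2 \<mu>\<^sub>i\<close> and each of the measures \<open>s\<^sup>k\<^sup>+\<^sup>1 d\<rho>\<^sub>k(s) / c\<^sub>k\<close> represent the sequence
\<open>\<parallel>S\<^sup>n\<^sup>+\<^sup>1 e\<^sub>0\<parallel>\<^sup>2\<close>; if it is determinate they coincide.  Integrating \<open>s\<^sup>-\<^sup>k\<^sup>-\<^sup>1\<close> against this identity gives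
\<open>c\<^sub>k \<Sum>\<^sub>i |\<lambda>\<^sub>i\<^sub>,\<^sub>1|\<^sup>2 \<integral> s\<^sup>-\<^sup>k\<^sup>-\<^sup>1 d\<mu>\<^sub>i = \<rho>\<^sub>k((0,\<infinity>)) \<le> 1\<close>, which is (B) for \<open>k = 0\<close> and (E) for \<open>k = \<kappa>\<close>.  For
\<open>k < \<kappa>\<close> the measure \<open>\<rho>\<^sub>k\<close> may be taken to be \<open>s d\<rho>\<^sub>k\<^sub>+\<^sub>1(s)\<close> up to a factor; it then has no atom at 0 and
equality holds, which is (C) and (D).  With \<open>\<nu> = \<rho>\<^sub>\<kappa>\<close>, condition (F) lists the first moments of \<open>\<nu>\<close>,
and (G) is the identity restricted to \<open>\<sigma>\<close> and divided by \<open>s\<close>.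

The last assertion is Carleman's criterion (\<open>Carleman_Stieltjes\<close>).  Passing from \<open>s\<close> to \<open>\<plusminus>\<surd>s\<close> with a fair
sign turns two representing measures into symmetric laws with the same moments.  The difference of
their characteristic functions is flat at 0, and its derivatives are bounded by the absolute moments,
so it vanishes by the Denjoy--Carleman theorem (\<open>Denjoy_Carleman\<close>).\<close>

section \<open>Complex Hilbert spaces\<close>

text \<open>The projection theorem: a minimising sequence for the distance is Cauchy by the parallelogram law.\<close>

lemma closest_point_in_subspace:
  fixes S :: "'a::{real_inner, complete_space} set"
  assumes "closed S" "subspace S"
  shows "\<exists>p\<in>S. \<forall>s\<in>S. inner (x - p) s = 0"
proof -
  define d where "d = (INF s\<in>S. norm (x - s))"
  have ne: "S \<noteq> {}" using assms(2) subspace_0 by blast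
  have bdd: "bdd_below ((\<lambda>s. norm (x - s)) ` S)" by (rule bdd_belowI2[of _ 0]) simp
  have d_le: "d \<le> norm (x - s)" if "s \<in> S" for s
    unfolding d_def by (rule cINF_lower[OF bdd that])
  have d0: "0 \<le> d" unfolding d_def by (rule cINF_greatest[OF ne]) simp
  have "\<exists>s\<in>S. norm (x - s) < d + 1 / real (Suc n)" for n
  proof -
    have "d < d + 1 / real (Suc n)" by simp
    then show ?thesis unfolding d_def using cINF_less_iff[OF ne bdd] by blast
  qed
  then obtain s where s: "\<And>n. s n \<in> S" "\<And>n. norm (x - s n) < d + 1 / real (Suc n)" by metis
  have lim: "(\<lambda>n. norm (x - s n)) \<longlonglongrightarrow> d"
  proof (rule real_tendsto_sandwich[of "\<lambda>_. d" _ _ "\<lambda>n. d + 1 / real (Suc n)"])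
    show "(\<lambda>n. d + 1 / real (Suc n)) \<longlonglongrightarrow> d"
      using tendsto_add[OF tendsto_const[of d] LIMSEQ_inverse_real_of_nat] by (simp add: inverse_eq_divide)
  qed (use d_le s in \<open>auto intro!: always_eventually less_imp_le simp del: of_nat_Suc\<close>)
  have par: "(norm (s m - s n))\<^sup>2 \<le> 2 * (norm (x - s m))\<^sup>2 + 2 * (norm (x - s n))\<^sup>2 - 4 * d\<^sup>2" for m n
  proof -
    have mid: "(1/2) *\<^sub>R (s m + s n) \<in> S" using s(1) assms(2) by (intro subspace_scale subspace_add)
    have "d\<^sup>2 \<le> (norm (x - (1/2) *\<^sub>R (s m + s n)))\<^sup>2" by (intro power_mono d_le mid d0)
    moreover have "(norm (a - b))\<^sup>2 + (norm (a + b))\<^sup>2 = 2 * (norm a)\<^sup>2 + 2 * (norm b)\<^sup>2" for a b :: 'a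
      by (simp add: power2_norm_eq_inner inner_add_left inner_add_right inner_diff_left inner_diff_right)
    from this[of "x - s n" "x - s m"]
    have "(norm (s m - s n))\<^sup>2 + (norm (2 *\<^sub>R (x - (1/2) *\<^sub>R (s m + s n))))\<^sup>2
        = 2 * (norm (x - s m))\<^sup>2 + 2 * (norm (x - s n))\<^sup>2"
      by (simp add: algebra_simps scaleR_2)
    ultimately show ?thesis by (simp add: power_mult_distrib)
  qed
  have "Cauchy s"
  proof (rule metric_CauchyI)
    fix e :: real assume e: "0 < e"
    have "(\<lambda>n. 4 * (norm (x - s n))\<^sup>2 - 4 * d\<^sup>2) \<longlonglongrightarrow> 4 * d\<^sup>2 - 4 * d\<^sup>2"
      by (intro tendsto_intros lim)
    then have "\<forall>\<^sub>F n in sequentially. 4 * (norm (x - s n))\<^sup>2 - 4 * d\<^sup>2 < e\<^sup>2"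
      by (rule order_tendstoD(2)) (use e in simp)
    then obtain M where M: "\<And>n. n \<ge> M \<Longrightarrow> 4 * (norm (x - s n))\<^sup>2 - 4 * d\<^sup>2 < e\<^sup>2"
      by (auto simp: eventually_sequentially)
    have "dist (s m) (s n) < e" if "m \<ge> M" "n \<ge> M" for m n
    proof -
      have "(norm (s m - s n))\<^sup>2 < e\<^sup>2" using par[of m n] M[OF that(1)] M[OF that(2)] by linarith
      then show ?thesis using e by (simp add: dist_norm power2_less_imp_less)
    qed
    then show "\<exists>M. \<forall>m\<ge>M. \<forall>n\<ge>M. dist (s m) (s n) < e" by blast
  qed
  then obtain p where p: "s \<longlonglongrightarrow> p" using Cauchy_convergent_iff convergent_def by blast
  have pS: "p \<in> S" using closed_sequentially[OF assms(1) s(1) p] .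
  have "norm (x - p) = d"
    using LIMSEQ_unique[OF lim tendsto_norm[OF tendsto_diff[OF tendsto_const p]]] by simp
  have "inner (x - p) t = 0" if t: "t \<in> S" for t
  proof (rule ccontr)
    assume neq: "inner (x - p) t \<noteq> 0"
    then have t0: "inner t t > 0" by auto
    define c where "c = inner (x - p) t / inner t t"
    have "p + c *\<^sub>R t \<in> S" using pS t assms(2) by (intro subspace_add subspace_scale)
    then have "d\<^sup>2 \<le> (norm (x - (p + c *\<^sub>R t)))\<^sup>2" by (intro power_mono d_le d0)
    also have "\<dots> = (norm (x - p))\<^sup>2 - 2 * c * inner (x - p) t + c * c * inner t t"
      by (simp add: power2_norm_eq_inner inner_add_left inner_add_right inner_diff_left inner_diff_right
          inner_commute[of t x] inner_commute[of t p] algebra_simps)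
    also have "\<dots> = d\<^sup>2 - (inner (x - p) t)\<^sup>2 / inner t t"
      using t0 \<open>norm (x - p) = d\<close> by (simp add: c_def field_simps power2_eq_square)
    finally have "(inner (x - p) t)\<^sup>2 / inner t t \<le> 0" by simp
    then show False using neq t0 by (simp add: divide_le_0_iff)
  qed
  then show ?thesis using pS by blast
qed

lemma subspace_closure:
  fixes S :: "'a::real_normed_vector set"
  assumes "subspace S"
  shows "subspace (closure S)"
proof (rule subspaceI)
  show "0 \<in> closure S" using subspace_0[OF assms] closure_subset by blast
next
  fix x y assume "x \<in> closure S" "y \<in> closure S"
  then obtain a b where ab: "\<And>n. a n \<in> S" "a \<longlonglongrightarrow> x" "\<And>n. b n \<in> S" "b \<longlonglongrightarrow> y"
    unfolding closure_sequential by blast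
  have "(\<lambda>n. a n + b n) \<longlonglongrightarrow> x + y" by (intro tendsto_add ab)
  moreover have "a n + b n \<in> S" for n by (intro subspace_add[OF assms] ab)
  ultimately show "x + y \<in> closure S" unfolding closure_sequential by (intro exI[of _ "\<lambda>n. a n + b n"]) simp
next
  fix c x assume "x \<in> closure S"
  then obtain a where ab: "\<And>n. a n \<in> S" "a \<longlonglongrightarrow> x" unfolding closure_sequential by blast
  have "(\<lambda>n. c *\<^sub>R a n) \<longlonglongrightarrow> c *\<^sub>R x" by (intro tendsto_scaleR tendsto_const ab)
  moreover have "c *\<^sub>R a n \<in> S" for n by (intro subspace_scale[OF assms] ab)
  ultimately show "c *\<^sub>R x \<in> closure S" unfolding closure_sequential by (intro exI[of _ "\<lambda>n. c *\<^sub>R a n"]) simp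
qed

lemma cinner_add_right: "cinner x (y + z) = cinner x y + cinner (x::'a::complex_hilbert_space) z"
  using arg_cong[OF cinner_add_left[of y z x], of cnj] by (simp flip: cinner_commute)

lemma cinner_scaleC_right: "cinner x (scaleC a y) = cnj a * cinner (x::'a::complex_hilbert_space) y"
  using arg_cong[OF cinner_scaleC_left[of a y x], of cnj] by (simp flip: cinner_commute)

lemma scaleC_minus1: "scaleC (-1) (x::'a::complex_hilbert_space) = - x"
  using scaleC_of_real[of "-1" x] by simp

lemma cinner_minus_left: "cinner (- x) y = - cinner (x::'a::complex_hilbert_space) y"
  using cinner_scaleC_left[of "-1" x y] by (simp add: scaleC_minus1)

lemma cinner_diff_left: "cinner (x - y) z = cinner x z - cinner (y::'a::complex_hilbert_space) z"
  using cinner_add_left[of x "- y" z] by (simp add: cinner_minus_left)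

lemma cinner_diff_right: "cinner x (y - z) = cinner x y - cinner (x::'a::complex_hilbert_space) z"
  using arg_cong[OF cinner_diff_left[of y z x], of cnj] by (simp flip: cinner_commute)

lemma Im_cinner: "Im (cinner x y) = Re (cinner (x::'a::complex_hilbert_space) (scaleC \<i> y))"
  by (simp add: cinner_scaleC_right)

text \<open>The imaginary part of the complex inner product is also a real inner product, so continuity and
density arguments can be carried out in the underlying real inner product space.\<close>

lemma cinner_eq_inner: "cinner x y = Complex (inner x y) (inner (x::'a::complex_hilbert_space) (scaleC \<i> y))"
  by (simp add: complex_eq_iff Im_cinner Re_cinner)

lemma cinner_0 [simp]: "cinner 0 x = 0" "cinner x 0 = 0" for x :: "'a::complex_hilbert_space"
  using cinner_diff_left[of x x x] cinner_diff_right[of x x x] by simp_all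

lemma cinner_self: "cinner x x = of_real ((norm (x::'a::complex_hilbert_space))\<^sup>2)"
proof -
  have "Im (cinner x x) = 0" using arg_cong[OF cinner_commute[of x x], of Im] by simp
  then show ?thesis using Re_cinner[of x x] by (simp add: complex_eq_iff power2_norm_eq_inner)
qed

lemma isCont_scaleC: "continuous_on UNIV (scaleC c :: 'a::complex_hilbert_space \<Rightarrow> 'a)"
proof -
  have n: "norm (scaleC c x) = cmod c * norm x" for x :: 'a
  proof -
    have "complex_of_real ((norm (scaleC c x))\<^sup>2) = of_real ((cmod c * norm x)\<^sup>2)"
      unfolding cinner_self[symmetric] cinner_scaleC_left cinner_scaleC_right
      unfolding cinner_self of_real_power of_real_mult power_mult_distrib
      using complex_norm_square[of c] by (simp add: mult.assoc)
    then show ?thesis unfolding of_real_eq_iff by (rule power2_eq_imp_eq) simp_all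
  qed
  have d: "scaleC c x - scaleC c y = scaleC c (x - y)" for x y :: 'a
    using scaleC_add_right[of c "x - y" y] by simp
  show ?thesis
    by (rule lipschitz_on_continuous_on[of "cmod c"]) (auto intro!: lipschitz_onI simp: dist_norm n d)
qed

lemma orthogonal_dense_imp_zero:
  fixes x :: "'a::real_inner"
  assumes "closure D = UNIV" "\<And>y. y \<in> D \<Longrightarrow> inner x y = 0"
  shows "x = 0"
proof -
  have "closed {y. inner x y = 0}" by (intro closed_Collect_eq continuous_intros)
  then have "closure D \<subseteq> {y. inner x y = 0}" using assms(2) by (intro closure_minimal) auto
  then have "x \<in> {y. inner x y = 0}" unfolding assms(1) by (rule subsetD) simp
  then show ?thesis by simp
qed

section \<open>Normal operators and their adjoints\<close>

lemma is_operatorD: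
  assumes "is_operator N"
  shows "(0, 0) \<in> N"
    "(x, x') \<in> N \<Longrightarrow> (y, y') \<in> N \<Longrightarrow> (x + y, x' + y') \<in> N"
    "(x, x') \<in> N \<Longrightarrow> (scaleC c x, scaleC c x') \<in> N"
    "(x, x') \<in> N \<Longrightarrow> (x, x'') \<in> N \<Longrightarrow> x' = x''"
  using assms unfolding is_operator_def by (auto dest: single_valuedD)

lemma is_operator_subspace: "is_operator N \<Longrightarrow> subspace N"
  using is_operatorD(1,2)[of N] is_operatorD(3)[of N _ _ "of_real _"]
  by (auto simp: subspace_def zero_prod_def scaleC_of_real)

lemma is_operator_diff: "is_operator N \<Longrightarrow> (x, x') \<in> N \<Longrightarrow> (y, y') \<in> N \<Longrightarrow> (x - y, x' - y') \<in> N"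
  using subspace_diff[OF is_operator_subspace, of N "(x, x')" "(y, y')"] by simp

lemma adjoint_opD: "(f, f') \<in> N \<Longrightarrow> (g, h) \<in> adjoint_op N \<Longrightarrow> cinner f' g = cinner f h"
  unfolding adjoint_op_def by auto

lemma adjoint_opI: "(\<And>f f'. (f, f') \<in> N \<Longrightarrow> cinner f' g = cinner f h) \<Longrightarrow> (g, h) \<in> adjoint_op N"
  unfolding adjoint_op_def by auto

text \<open>Density of the domain makes the adjoint an operator.\<close>

lemma adjoint_op_functional:
  assumes "closure (Domain N) = UNIV" "(g, h) \<in> adjoint_op N" "(g, h') \<in> adjoint_op N"
  shows "h = h'"
proof -
  have "inner (h - h') f = 0" if "f \<in> Domain N" for f
  proof -
    from that obtain f' where f: "(f, f') \<in> N" by auto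
    have "cinner f (h - h') = 0" using adjoint_opD[OF f assms(2)] adjoint_opD[OF f assms(3)] by (simp add: cinner_diff_right)
    then show ?thesis using Re_cinner[of f "h - h'"] by (simp add: inner_commute)
  qed
  then show ?thesis using orthogonal_dense_imp_zero[OF assms(1), of "h - h'"] by simp
qed

lemma adjoint_op_diff:
  "(g, h) \<in> adjoint_op N \<Longrightarrow> (g', h') \<in> adjoint_op N \<Longrightarrow> (g - g', h - h') \<in> adjoint_op N"
  by (rule adjoint_opI) (simp add: cinner_diff_right adjoint_opD)

lemma adjoint_op_closed: "closed (adjoint_op N)"
proof -
  have "adjoint_op N = (\<Inter>(f, f')\<in>N. {p. cinner f' (fst p) = cinner f (snd p)})"
    unfolding adjoint_op_def by auto
  moreover have "closed {p. cinner f' (fst p) = cinner f (snd p)}" for f f' :: 'a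
    unfolding cinner_eq_inner complex.inject
    by (intro closed_Collect_conj closed_Collect_eq continuous_intros continuous_on_compose2[OF isCont_scaleC]) auto
  ultimately show ?thesis by (auto intro!: closed_INT)
qed

text \<open>Von Neumann's argument for the surjectivity of \<open>1 + N\<^sup>*N\<close>: project \<open>(h, 0)\<close> orthogonally onto the
graph of \<open>N\<close>.  Orthogonality of the residual \<open>(h - g, - N g)\<close> to the graph says precisely that
\<open>N g\<close> lies in the domain of \<open>N\<^sup>*\<close> with \<open>N\<^sup>*N g = h - g\<close>.\<close>

lemma one_plus_adjoint_comp_onto:
  fixes N :: "('k::complex_hilbert_space \<times> 'k) set"
  assumes "is_operator N" "closed N"
  obtains g g' where "(g, g') \<in> N" "(g', h - g) \<in> adjoint_op N"
proof -
  obtain g g' where g: "(g, g') \<in> N" and orth: "\<And>s s'. (s, s') \<in> N \<Longrightarrow> inner ((h, 0) - (g, g')) (s, s') = 0"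
    using closest_point_in_subspace[OF assms(2) is_operator_subspace[OF assms(1)], of "(h, 0)"] by force
  have "(g', h - g) \<in> adjoint_op N"
  proof (rule adjoint_opI)
    fix f f' assume f: "(f, f') \<in> N"
    have i: "inner (h - g) (scaleC c f) = inner g' (scaleC c f')" for c
      using orth[OF is_operatorD(3)[OF assms(1) f, of c]] by simp
    have "cinner (h - g) f = cinner g' f'"
      using i[of 1] i[of \<i>] scaleC_of_real[of 1 f] scaleC_of_real[of 1 f'] by (simp add: cinner_eq_inner)
    then show "cinner f' g' = cinner f (h - g)" using cinner_commute[of f' g'] cinner_commute[of f "h - g"] by simp
  qed
  then show ?thesis using g that by blast
qed

text \<open>The domain of \<open>N\<^sup>*N\<close> is a core for \<open>N\<close>.  A vector of the graph that is orthogonal to the graph of this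
restriction has a first component orthogonal to the range of \<open>1 + N\<^sup>*N\<close>, which is everything.\<close>

lemma adjoint_comp_core:
  fixes N :: "('k::complex_hilbert_space \<times> 'k) set"
  assumes N: "is_operator N" "closed N" and f: "(f, f') \<in> N"
  shows "(f, f') \<in> closure {(g, g'). (g, g') \<in> N \<and> g' \<in> Domain (adjoint_op N)}"
    (is "_ \<in> closure ?C")
proof -
  define C where "C = ?C"
  have C: "(x, y) \<in> C \<longleftrightarrow> (x, y) \<in> N \<and> (\<exists>z. (y, z) \<in> adjoint_op N)" for x y
    by (auto simp: C_def)
  have sub: "subspace C"
  proof (rule subspaceI)
    have "(0, 0) \<in> adjoint_op N" by (rule adjoint_opI) simp
    then have "(0, 0) \<in> C" using is_operatorD(1)[OF N(1)] unfolding C by blast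
    then show "0 \<in> C" unfolding zero_prod_def .
  next
    fix u v assume uv: "u \<in> C" "v \<in> C"
    obtain x x' y y' where eq: "u = (x, x')" "v = (y, y')" by (metis surj_pair)
    from uv obtain a b where "(x', a) \<in> adjoint_op N" "(y', b) \<in> adjoint_op N" unfolding eq C by blast
    then have "(x' + y', a + b) \<in> adjoint_op N"
      by (intro adjoint_opI) (simp add: cinner_add_right adjoint_opD)
    moreover have "(x + y, x' + y') \<in> N" using uv is_operatorD(2)[OF N(1)] unfolding eq C by blast
    ultimately show "u + v \<in> C" unfolding eq add_Pair C by blast
  next
    fix r u assume u: "u \<in> C"
    obtain x x' where eq: "u = (x, x')" by (metis surj_pair)
    from u obtain a where "(x', a) \<in> adjoint_op N" unfolding eq C by blast
    then have "(scaleC (of_real r) x', scaleC (of_real r) a) \<in> adjoint_op N"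
      by (intro adjoint_opI) (simp add: cinner_scaleC_right adjoint_opD)
    moreover have "(scaleC (of_real r) x, scaleC (of_real r) x') \<in> N"
      using u is_operatorD(3)[OF N(1)] unfolding eq C by blast
    ultimately show "r *\<^sub>R u \<in> C" unfolding eq scaleR_Pair C scaleC_of_real by blast
  qed
  obtain p p' where p: "(p, p') \<in> closure C"
    and orth: "\<And>s. s \<in> closure C \<Longrightarrow> inner ((f, f') - (p, p')) s = 0"
    using closest_point_in_subspace[OF closed_closure subspace_closure[OF sub], of "(f, f')"]
    by (metis prod.collapse)
  have "closure C \<subseteq> N" by (rule closure_minimal) (use N(2) in \<open>auto simp: C_def\<close>)
  then have q: "(f - p, f' - p') \<in> N" using is_operator_diff[OF N(1) f] p by blast
  \<comment> \<open>The defect \<open>f - p\<close> is itself in the range of \<open>1 + N\<^sup>*N\<close>.\<close>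
  obtain g g' where g: "(g, g') \<in> N" "(g', (f - p) - g) \<in> adjoint_op N"
    using one_plus_adjoint_comp_onto[OF N] .
  have gC: "(g, g') \<in> closure C" by (rule subsetD[OF closure_subset]) (use g in \<open>unfold C, blast\<close>)
  have "inner (f - p) (f - p) = inner (f - p) g + Re (cinner (f - p) (f - p - g))"
    by (simp add: Re_cinner inner_diff_right)
  also have "\<dots> = inner (f - p) g + inner (f' - p') g'"
    using adjoint_opD[OF q g(2)] Re_cinner[of "f' - p'" g'] by simp
  also have "\<dots> = 0" using orth[OF gC] by (simp add: inner_Pair)
  finally have "f = p" by simp
  moreover have "(0, f' - p') \<in> N" using q \<open>f = p\<close> by simp
  then have "f' = p'" using is_operatorD(4)[OF N(1), of 0 "f' - p'" 0] is_operatorD(1)[OF N(1)] by simp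
  ultimately show ?thesis using p unfolding C_def by simp
qed

lemma normal_opD:
  assumes "normal_op N"
  shows "is_operator N" "closure (Domain N) = UNIV" "closed N" "N O adjoint_op N = adjoint_op N O N"
  using assms unfolding normal_op_def by blast+

text \<open>On the core, \<open>N\<^sup>*N = N N\<^sup>*\<close> gives \<open>\<parallel>N f\<parallel> = \<parallel>N\<^sup>* f\<parallel>\<close>.  Along a sequence that converges in the graph
norm of \<open>N\<close> the values of \<open>N\<^sup>*\<close> are therefore Cauchy, and \<open>N\<^sup>*\<close> is closed.\<close>

lemma normal_op_Domain_adjoint:
  fixes N :: "('k::complex_hilbert_space \<times> 'k) set"
  assumes "normal_op N" and f: "(f, f') \<in> N"
  obtains h where "(f, h) \<in> adjoint_op N"
proof -
  have N: "is_operator N" "closure (Domain N) = UNIV" "closed N" "N O adjoint_op N = adjoint_op N O N"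
    by (rule normal_opD[OF assms(1)])+
  obtain s where s: "\<And>n. s n \<in> {(g, g'). (g, g') \<in> N \<and> g' \<in> Domain (adjoint_op N)}"
    and lim: "s \<longlonglongrightarrow> (f, f')"
    using adjoint_comp_core[OF N(1,3) f, unfolded closure_sequential] by (elim exE conjE) (rule that, simp_all only:)
  have sN: "(fst (s n), snd (s n)) \<in> N" and sD: "\<exists>b. (snd (s n), b) \<in> adjoint_op N" for n
    using s[of n] unfolding case_prod_unfold mem_Collect_eq Domain_iff by simp_all
  have "\<exists>a b. (snd (s n), b) \<in> adjoint_op N \<and> (fst (s n), a) \<in> adjoint_op N \<and> (a, b) \<in> N" for n
  proof -
    obtain b where b: "(snd (s n), b) \<in> adjoint_op N" using sD[of n] by blast
    have "(fst (s n), b) \<in> adjoint_op N O N" unfolding N(4)[symmetric] using sN b by (rule relcompI)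
    then show ?thesis using b by blast
  qed
  then obtain a b where ab: "\<And>n. (snd (s n), b n) \<in> adjoint_op N"
      "\<And>n. (fst (s n), a n) \<in> adjoint_op N" "\<And>n. (a n, b n) \<in> N" by metis
  have eq: "norm (a m - a n) = norm (snd (s m) - snd (s n))" for m n
  proof -
    let ?x = "fst (s m) - fst (s n)" and ?y = "snd (s m) - snd (s n)" and ?a = "a m - a n" and ?b = "b m - b n"
    have 1: "(?x, ?y) \<in> N" "(?a, ?b) \<in> N"
      by (rule is_operator_diff[OF N(1) sN sN], rule is_operator_diff[OF N(1) ab(3) ab(3)])
    have 2: "(?y, ?b) \<in> adjoint_op N" "(?x, ?a) \<in> adjoint_op N"
      by (rule adjoint_op_diff[OF ab(1) ab(1)], rule adjoint_op_diff[OF ab(2) ab(2)])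
    have "cinner ?y ?y = cinner ?x ?b" using adjoint_opD[OF 1(1) 2(1)] .
    also have "\<dots> = cnj (cinner ?b ?x)" by (rule cinner_commute)
    also have "cinner ?b ?x = cinner ?a ?a" using adjoint_opD[OF 1(2) 2(2)] .
    finally have "cinner ?y ?y = cnj (cinner ?a ?a)" .
    then have "(norm ?y)\<^sup>2 = (norm ?a)\<^sup>2" unfolding cinner_self complex_cnj_complex_of_real of_real_eq_iff .
    then show ?thesis using power2_eq_imp_eq[OF _ norm_ge_zero norm_ge_zero] by metis
  qed
  have "(\<lambda>n. snd (s n)) \<longlonglongrightarrow> f'" using tendsto_snd[OF lim] unfolding snd_conv .
  then have "Cauchy (\<lambda>n. snd (s n))" by (rule LIMSEQ_imp_Cauchy)
  then have "Cauchy a" unfolding Cauchy_def dist_norm eq .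
  then obtain h where h: "a \<longlonglongrightarrow> h" using Cauchy_convergent_iff convergent_def by blast
  have "(\<lambda>n. (fst (s n), a n)) \<longlonglongrightarrow> (f, h)" using tendsto_Pair[OF tendsto_fst[OF lim] h] unfolding fst_conv .
  then have "(f, h) \<in> adjoint_op N" by (rule closed_sequentially[OF adjoint_op_closed, rotated]) (rule ab(2))
  then show ?thesis by (rule that)
qed

text \<open>A sequence \<open>s\<close> with \<open>s (n + 1) = N (s n)\<close> encodes a vector \<open>s 0\<close> in the domain of every power of \<open>N\<close>
together with its orbit.  Such vectors are invariant under \<open>N\<^sup>*\<close>, because
\<open>N\<^sup>* (N (s n)) = N (N\<^sup>* (s n))\<close>.\<close>

lemma normal_op_adjoint_chain:
  fixes N :: "('k::complex_hilbert_space \<times> 'k) set"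
  assumes "normal_op N" "\<And>n. (s n, s (Suc n)) \<in> N"
  shows "\<exists>s'. (\<forall>n. (s n, s' n) \<in> adjoint_op N) \<and> (\<forall>n. (s' n, s' (Suc n)) \<in> N)"
proof -
  have "\<forall>n. \<exists>h. (s n, h) \<in> adjoint_op N"
    using normal_op_Domain_adjoint[OF assms] by blast
  then obtain s' where s': "\<And>n. (s n, s' n) \<in> adjoint_op N" by metis
  have "(s' n, s' (Suc n)) \<in> N" for n
  proof -
    have "(s n, s' (Suc n)) \<in> adjoint_op N O N"
      unfolding normal_opD(4)[OF assms(1), symmetric] using assms(2) s' by (rule relcompI)
    then obtain y where y: "(s n, y) \<in> adjoint_op N" "(y, s' (Suc n)) \<in> N" by blast
    show ?thesis using adjoint_op_functional[OF normal_opD(2)[OF assms(1)] y(1) s'] y(2) by simp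
  qed
  then show ?thesis using s' by blast
qed

text \<open>Iterating \<open>N\<^sup>*\<close> on the orbit produces the array \<open>X m n = N\<^sup>*\<^sup>m N\<^sup>n (x 0)\<close>.  In an inner product of two of its
entries a power of \<open>N\<close> on one side can be traded for the same power of \<open>N\<^sup>*\<close> on the other side.\<close>

lemma normal_op_chain_Hankel:
  fixes N :: "('k::complex_hilbert_space \<times> 'k) set"
  assumes "normal_op N" and x: "\<And>n. (x n, x (Suc n)) \<in> N"
  obtains y z :: "nat \<Rightarrow> 'k" where "\<And>i j. inner (y i) (y j) = (norm (x (i + j)))\<^sup>2"
    "\<And>i j. inner (z i) (z j) = (norm (x (i + j + 1)))\<^sup>2"
proof -
  define Q where "Q s \<longleftrightarrow> (\<forall>n. (s n, s (Suc n)) \<in> N)" for s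
  \<comment> \<open>The chain of values of \<open>N\<^sup>*\<close> along a chain of \<open>N\<close>.\<close>
  define next_s where "next_s s = (SOME s'. (\<forall>n. (s n, s' n) \<in> adjoint_op N) \<and> Q s')" for s
  have nx: "(\<forall>n. (s n, next_s s n) \<in> adjoint_op N) \<and> Q (next_s s)" if "Q s" for s
    unfolding next_s_def
    using someI_ex[OF normal_op_adjoint_chain[OF assms(1), of s]] that unfolding Q_def by blast
  define X where "X m = (next_s ^^ m) x" for m
  have Q: "Q (X m)" for m
    by (induction m) (use x nx in \<open>auto simp: X_def Q_def\<close>)
  have X1: "(X m n, X m (Suc n)) \<in> N" for m n using Q[of m] by (simp add: Q_def)
  have X2: "(X m n, X (Suc m) n) \<in> adjoint_op N" for m n using nx[OF Q[of m]] by (simp add: X_def)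
  have move: "cinner (X m (Suc n)) (X p q) = cinner (X m n) (X (Suc p) q)" for m n p q
    using adjoint_opD[OF X1 X2] .
  have move': "cinner (X (Suc m) n) (X p q) = cinner (X m n) (X p (Suc q))" for m n p q
    using arg_cong[OF move[of p q m n], of cnj] unfolding cinner_commute[of "X (Suc m) n"] cinner_commute[of "X m n"] by simp
  have a: "cinner (X m (n + k)) (X p q) = cinner (X m n) (X (p + k) q)" for m n p q k
    by (induction k arbitrary: p) (auto simp: move)
  have b: "cinner (X (m + k) n) (X p q) = cinner (X m n) (X p (q + k))" for m n p q k
    by (induction k arbitrary: q) (auto simp: move')
  have X0: "X 0 = x" by (simp add: X_def)
  have 1: "inner (X i i) (X j j) = (norm (x (i + j)))\<^sup>2" for i j
  proof -
    have "cinner (X i i) (X j j) = cinner (X 0 i) (X j (j + i))" using b[of 0 i i j j] by simp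
    also have "\<dots> = cinner (X 0 (i + j)) (X 0 (j + i))" using a[of 0 i j 0 "j + i"] by simp
    finally show ?thesis by (simp add: X0 add.commute[of j i] cinner_self flip: Re_cinner)
  qed
  have 2: "inner (X i (Suc i)) (X j (Suc j)) = (norm (x (i + j + 1)))\<^sup>2" for i j
  proof -
    have "cinner (X i (Suc i)) (X j (Suc j)) = cinner (X 0 (Suc i)) (X j (Suc j + i))" using b[of 0 i "Suc i" j "Suc j"] by simp
    also have "\<dots> = cinner (X 0 (Suc i + j)) (X 0 (Suc j + i))" using a[of 0 "Suc i" j 0 "Suc j + i"] by simp
    finally show ?thesis by (simp add: X0 add.commute[of j i] cinner_self flip: Re_cinner)
  qed
  show ?thesis by (rule that[of "\<lambda>i. X i i" "\<lambda>i. X i (Suc i)"]) (rule 1, rule 2)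
qed

section \<open>Measures on the half-line\<close>

lemma borel_Rplus_measurableI:
  "f \<in> borel_measurable borel \<Longrightarrow> f \<in> borel_measurable borel_Rplus"
  unfolding borel_Rplus_def by (rule measurable_restrict_space1)

lemma space_borel_Rplus: "space borel_Rplus = {0..}"
  by (simp add: borel_Rplus_def space_restrict_space)

lemma measurable_borel_Rplus_sets:
  "sets \<mu> = sets borel_Rplus \<Longrightarrow> f \<in> borel_measurable borel_Rplus \<Longrightarrow> f \<in> borel_measurable \<mu>"
  using measurable_cong_sets[of \<mu> borel_Rplus borel borel] by blast

lemma stieltjes_representing_scale:
  assumes "stieltjes_representing \<mu> t" "0 \<le> c" "\<And>n. 0 \<le> t n"
  shows "stieltjes_representing (scale_measure (ennreal c) \<mu>) (\<lambda>n. c * t n)"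
  unfolding stieltjes_representing_def
proof (intro conjI allI)
  have sets: "sets \<mu> = sets borel_Rplus" using assms(1) by (simp add: stieltjes_representing_def)
  then show "sets (scale_measure (ennreal c) \<mu>) = sets borel_Rplus" by simp
  fix n
  have "(\<lambda>s. ennreal s ^ n) \<in> borel_measurable \<mu>"
    by (intro measurable_borel_Rplus_sets[OF sets] borel_Rplus_measurableI) measurable
  then show "(\<integral>\<^sup>+s. ennreal s ^ n \<partial>scale_measure (ennreal c) \<mu>) = ennreal (c * t n)"
    using assms by (simp add: nn_integral_scale_measure stieltjes_representing_def ennreal_mult)
qed

section \<open>Gauss quadrature for positive functionals on polynomials\<close>

lemma map_poly_of_real_add:
  "map_poly of_real (p + q) = (map_poly of_real p + map_poly of_real q :: complex poly)"
  by (rule poly_eqI) (simp add: coeff_map_poly)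

lemma poly_map_of_real_mult:
  fixes p q :: "real poly" and z :: complex
  shows "poly (map_poly of_real (p * q)) z = poly (map_poly of_real p) z * poly (map_poly of_real q) z"
proof (induction p)
  case (pCons a p)
  then show ?case by (simp add: map_poly_of_real_add map_poly_smult map_poly_pCons distrib_right mult.assoc)
qed simp

lemma degree_le1_pCons: "degree p \<le> 1 \<Longrightarrow> p = [:coeff p 0, coeff p 1:]"
  by (rule poly_eqI) (auto simp: coeff_pCons coeff_eq_0 split: nat.split)

lemma real_poly_quadratic_factor:
  fixes p :: "real poly"
  assumes "degree p > 0" "\<And>x. poly p x \<noteq> 0"
  obtains a b where "b \<noteq> 0" "[:a\<^sup>2 + b\<^sup>2, - 2 * a, 1:] dvd p"
proof -
  define E where "E q z = poly (map_poly of_real q) z" for q :: "real poly" and z :: complex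
  have "\<not> constant (poly (map_poly of_real p :: complex poly))"
    using assms(1) by (simp add: constant_degree degree_map_poly)
  then obtain z where z: "E p z = 0" unfolding E_def using fundamental_theorem_of_algebra by blast
  define a b where "a = Re z" and "b = Im z"
  have b: "b \<noteq> 0"
  proof
    assume "b = 0"
    then have "z = of_real a" by (simp add: a_def b_def complex_eq_iff)
    then have "E p z = of_real (poly p a)" unfolding E_def
      by (induction p) (simp_all add: map_poly_pCons)
    then show False using z assms(2) by simp
  qed
  define Q where "Q = [:a\<^sup>2 + b\<^sup>2, - 2 * a, 1:]"
  have Q: "E Q z = 0"
    by (simp add: E_def Q_def map_poly_pCons a_def b_def complex_eq_iff power2_eq_square algebra_simps)
  have add: "E (p + q) z = E p z + E q z" for p q by (simp add: E_def map_poly_of_real_add)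
  have "E (p mod Q) z = 0"
  proof -
    have "E (p div Q * Q + p mod Q) z = 0" using z by simp
    then show ?thesis using Q unfolding add by (simp add: E_def poly_map_of_real_mult)
  qed
  moreover have "degree (p mod Q) \<le> 1"
    using degree_mod_less[of Q p] by (auto simp: Q_def)
  then obtain c d where cd: "p mod Q = [:c, d:]"
    by (metis degree_le1_pCons)
  ultimately have "complex_of_real c + z * of_real d = 0" by (simp add: E_def map_poly_pCons)
  then have "d * b = 0" "c + a * d = 0" by (auto simp: complex_eq_iff a_def b_def)
  then have "p mod Q = 0" using b cd by simp
  then have "Q dvd p" by (simp add: dvd_eq_mod_eq_0)
  then show ?thesis using that[OF b] unfolding Q_def by blast
qed

lemma prod_root_factors_dvd:
  fixes p :: "real poly"
  assumes "finite X" "\<And>x. x \<in> X \<Longrightarrow> poly p x = 0"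
  shows "(\<Prod>x\<in>X. [:- x, 1:]) dvd p"
  using assms
proof (induction X arbitrary: p rule: finite_induct)
  case (insert x F)
  then obtain r where r: "p = (\<Prod>x\<in>F. [:- x, 1:]) * r" by (metis dvdE insertCI)
  have "poly (\<Prod>x\<in>F. [:- x, 1:]) x \<noteq> 0" using insert.hyps by (auto simp: poly_prod)
  moreover have "poly p x = 0" using insert.prems by simp
  ultimately have "poly r x = 0" by (simp add: r)
  then have "[:- x, 1:] dvd r" by (simp add: poly_eq_0_iff_dvd)
  then show ?case using insert.hyps by (simp add: r mult.commute[of _ r] mult_dvd_mono del: mult_pCons_left)
qed simp

text \<open>These are the functionals \<open>p \<mapsto> \<integral> p d\<mu>\<close> with \<open>\<mu>\<close> on the half-line, as far as this can be seen from
squares.\<close>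

locale stieltjes_functional =
  fixes L :: "real poly \<Rightarrow> real"
  assumes add: "L (p + q) = L p + L q"
    and smult: "L (smult c p) = c * L p"
    and square: "0 \<le> L (p * p)"
    and X_square: "0 \<le> L ([:0, 1:] * (p * p))"
begin

lemma zero [simp]: "L 0 = 0" using smult[of 0 0] by simp

lemma diff: "L (p - q) = L p - L q" using add[of "p - q" q] by simp

lemma sum: "L (sum f A) = (\<Sum>x\<in>A. L (f x))" by (induction A rule: infinite_finite_induct) (simp_all add: add)

text \<open>The Cauchy--Schwarz inequality in the degenerate case.\<close>

lemma null_square:
  assumes "L (p * p) = 0"
  shows "L (p * q) = 0"
proof (rule ccontr)
  assume neq: "L (p * q) \<noteq> 0"
  \<comment> \<open>With this coefficient \<open>L ((q + c p)\<^sup>2)\<close> would equal \<open>- 1\<close>.\<close>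
  define c where "c = - (L (q * q) + 1) / (2 * L (p * q))"
  have "L ((q + smult c p) * (q + smult c p)) = L (q * q) + 2 * c * L (p * q)"
    by (simp add: distrib_left distrib_right add smult assms mult.commute[of q p])
  then have "0 \<le> L (q * q) + 2 * c * L (p * q)" using square[of "q + smult c p"] by simp
  also have "\<dots> = - 1" using neq by (simp add: c_def field_simps)
  finally show False by simp
qed

definition definite_below :: "nat \<Rightarrow> bool" where
  "definite_below n \<longleftrightarrow> (\<forall>q. q \<noteq> 0 \<longrightarrow> degree q < n \<longrightarrow> 0 < L (q * q))"

text \<open>Gram--Schmidt: \<open>e\<close> below is the monic orthogonal polynomial of degree \<open>n\<close>.\<close>

lemma orthogonal_projection:
  assumes "definite_below n"
  shows "\<exists>r. (r = 0 \<or> degree r < n) \<and> (\<forall>q. degree q < n \<longrightarrow> L ((f - r) * q) = 0)"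
  using assms
proof (induction n arbitrary: f)
  case 0
  show ?case by (intro exI[of _ 0]) simp
next
  case (Suc n)
  have db: "definite_below n" using Suc.prems by (simp add: definite_below_def)
  obtain s where s: "s = 0 \<or> degree s < n" "\<And>q. degree q < n \<Longrightarrow> L ((monom 1 n - s) * q) = 0"
    using Suc.IH[OF db] by blast
  define e where "e = monom 1 n - s"
  have ce: "coeff e n = 1" using s(1) by (auto simp: e_def coeff_eq_0)
  have de: "degree e \<le> n" using s(1) unfolding e_def by (intro degree_diff_le) (auto simp: degree_monom_le)
  have e0: "e \<noteq> 0" using ce by auto
  have Le: "0 < L (e * e)" using Suc.prems de e0 by (simp add: definite_below_def)
  obtain r where r: "r = 0 \<or> degree r < n" "\<And>q. degree q < n \<Longrightarrow> L ((f - r) * q) = 0"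
    using Suc.IH[OF db] by blast
  define c where "c = L ((f - r) * e) / L (e * e)"
  have "degree (r + smult c e) \<le> n" using r(1) de by (intro degree_add_le) auto
  moreover have "L ((f - (r + smult c e)) * q) = 0" if q: "degree q < Suc n" for q
  proof -
    \<comment> \<open>Splitting off the leading term leaves a polynomial to which the induction hypothesis applies.\<close>
    define q' where "q' = q - smult (coeff q n) e"
    have "coeff q' n = 0" by (simp add: q'_def ce)
    moreover have "degree q' \<le> n" unfolding q'_def using q de by (intro degree_diff_le) auto
    ultimately have q': "q' = 0 \<or> degree q' < n"
      by (metis leading_coeff_0_iff le_neq_implies_less)
    have 1: "L ((f - r) * q') = 0" "L (e * q') = 0" using q' r(2) s(2) by (auto simp: e_def)
    have "L ((f - (r + smult c e)) * q') = 0"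
      using 1 by (simp add: left_diff_distrib distrib_right diff add smult)
    moreover have "L ((f - (r + smult c e)) * e) = 0"
    proof -
      have "L ((f - r) * e) = c * L (e * e)" using Le by (simp add: c_def)
      then show ?thesis by (simp add: left_diff_distrib distrib_right diff add smult)
    qed
    moreover have "q = smult (coeff q n) e + q'" by (simp add: q'_def)
    then have "L ((f - (r + smult c e)) * q) =
        coeff q n * L ((f - (r + smult c e)) * e) + L ((f - (r + smult c e)) * q')"
      by (metis add distrib_left mult_smult_right smult)
    ultimately show ?thesis by simp
  qed
  ultimately show ?case by (intro exI[of _ "r + smult c e"]) auto
qed

text \<open>The polynomial whose roots serve as nodes.  If the functional is definite up to degree \<open>m\<close>, this is the
orthogonal polynomial of degree \<open>m + 1\<close>.  Otherwise it is a nonzero polynomial \<open>P\<close> of least degree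
with \<open>L (P\<^sup>2) = 0\<close>; then \<open>P\<close> is orthogonal to all polynomials, so that the quadrature is exact
in every degree.\<close>

lemma node_polynomial_exists:
  obtains P where "P \<noteq> 0" "definite_below (degree P)" "\<And>q. degree q < degree P \<Longrightarrow> L (P * q) = 0"
    "\<And>f :: real poly. degree f \<le> m \<Longrightarrow> L (P * (f div P)) = 0"
proof (cases "definite_below (Suc m)")
  case True
  obtain r where r: "r = 0 \<or> degree r < Suc m" "\<And>q. degree q < Suc m \<Longrightarrow> L ((monom 1 (Suc m) - r) * q) = 0"
    using orthogonal_projection[OF True] by blast
  define P where "P = monom 1 (Suc m) - r"
  have cP: "coeff P (Suc m) = 1" using r(1) by (auto simp: P_def coeff_eq_0)
  have "degree P \<le> Suc m" unfolding P_def using r(1) by (intro degree_diff_le) (auto simp: degree_monom_le)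
  then have dP: "degree P = Suc m" using le_degree[of P "Suc m"] cP by simp
  show ?thesis
  proof (rule that[of P])
    fix f :: "real poly" assume "degree f \<le> m"
    then show "L (P * (f div P)) = 0" by (simp add: div_poly_less dP)
  qed (use cP True dP r(2) in \<open>auto simp: P_def[symmetric]\<close>)
next
  case False
  define A where "A n \<longleftrightarrow> (\<exists>q. q \<noteq> 0 \<and> degree q = n \<and> L (q * q) = 0)" for n
  have "\<exists>n. A n" using False square by (force simp: A_def definite_below_def not_less intro: antisym)
  then have "A (LEAST n. A n)" by (rule LeastI_ex)
  then obtain P where P: "P \<noteq> 0" "degree P = (LEAST n. A n)" "L (P * P) = 0" unfolding A_def by auto
  show ?thesis
  proof (rule that[of P])
    show "definite_below (degree P)"
      unfolding definite_below_def P(2) using not_less_Least[of _ A] square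
      by (metis A_def less_le)
  qed (use P null_square in auto)
qed

text \<open>All information about the roots of \<open>P\<close> comes from the identity \<open>0 = L (P R) = L (Q R\<^sup>2)\<close>, which holds for
every factorisation \<open>P = Q R\<close> with nonconstant \<open>Q\<close>.\<close>

lemma no_positive_factor:
  assumes "P \<noteq> 0" "definite_below (degree P)" "\<And>q. degree q < degree P \<Longrightarrow> L (P * q) = 0"
    and "P = Q * R" "degree Q > 0" "L (R * R) > 0 \<Longrightarrow> L (Q * (R * R)) > 0"
  shows False
proof -
  have "Q \<noteq> 0" "R \<noteq> 0" using assms(1,4) by auto
  then have "degree R < degree P" using assms(4,5) by (simp add: degree_mult_eq)
  then have "L (P * R) = 0" "0 < L (R * R)" using assms(2,3) \<open>R \<noteq> 0\<close> by (auto simp: definite_below_def)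
  then show False using assms(6) assms(4) by (simp add: mult.assoc)
qed

text \<open>The roots are real, simple and nonnegative: a negative root \<open>x\<close>, a double root \<open>x\<close> or a nonreal root
\<open>a + i b\<close> would give \<open>P\<close> the factor \<open>X - x\<close>, \<open>(X - x)\<^sup>2\<close> or \<open>(X - a)\<^sup>2 + b\<^sup>2\<close>, each of which is
positive in the sense of \<open>no_positive_factor\<close>.\<close>

lemma node_polynomial_roots:
  assumes P: "P \<noteq> 0" "definite_below (degree P)" "\<And>q. degree q < degree P \<Longrightarrow> L (P * q) = 0"
  shows "card {x. poly P x = 0} = degree P" "poly P x = 0 \<Longrightarrow> 0 \<le> x"
proof -
  show "0 \<le> x" if root: "poly P x = 0"
  proof (rule ccontr)
    assume "\<not> 0 \<le> x"
    obtain R where R: "P = [:- x, 1:] * R" using root by (auto simp: poly_eq_0_iff_dvd elim: dvdE)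
    have "L ([:- x, 1:] * (R * R)) > 0" if "L (R * R) > 0"
    proof -
      have "[:- x, 1:] * (R * R) = [:0, 1:] * (R * R) + smult (- x) (R * R)" by (simp add: algebra_simps)
      moreover have "0 < - x * L (R * R)" using that \<open>\<not> 0 \<le> x\<close> by (intro mult_pos_pos) auto
      ultimately show ?thesis using X_square[of R] by (simp only: add smult)
    qed
    then show False using no_positive_factor[OF P R] by simp
  qed
  define X where "X = {x. poly P x = 0}"
  have fin: "finite X" unfolding X_def by (rule poly_roots_finite[OF P(1)])
  obtain R where R: "P = (\<Prod>x\<in>X. [:- x, 1:]) * R"
    using prod_root_factors_dvd[OF fin, of P] by (auto simp: X_def elim: dvdE)
  have R0: "R \<noteq> 0" using R P(1) by auto
  have dX: "degree (\<Prod>x\<in>X. [:- x, 1:]) = card X"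
    by (subst degree_prod_eq_sum_degree) auto
  have noroot: "poly R x \<noteq> 0" for x
  proof
    assume x: "poly R x = 0"
    have "poly P x = 0" by (subst R) (simp add: x)
    then have "x \<in> X" by (simp add: X_def)
    obtain S where S: "R = [:- x, 1:] * S" using x by (auto simp: poly_eq_0_iff_dvd elim: dvdE)
    have "P = ([:- x, 1:] * [:- x, 1:]) * ((\<Prod>x\<in>X - {x}. [:- x, 1:]) * S)"
      unfolding R S prod.remove[OF fin \<open>x \<in> X\<close>, of "\<lambda>x. [:- x, 1:]"] by (simp only: mult_ac)
    then obtain T where T: "P = ([:- x, 1:] * [:- x, 1:]) * T" by blast
    then have "T \<noteq> 0" using P(1) by auto
    then have "degree ([:- x, 1:] * T) < degree P" unfolding T by (simp add: degree_mult_eq del: mult_pCons_left)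
    then have "0 < L (([:- x, 1:] * T) * ([:- x, 1:] * T))"
      using P(2) \<open>T \<noteq> 0\<close> unfolding definite_below_def by (metis mult_eq_0_iff one_neq_zero pCons_eq_0_iff)
    also have "([:- x, 1:] * T) * ([:- x, 1:] * T) = ([:- x, 1:] * [:- x, 1:]) * (T * T)"
      by (simp only: mult_ac)
    finally show False using no_positive_factor[OF P T] by (simp add: degree_mult_eq del: mult_pCons_left)
  qed
  have "degree R = 0"
  proof (rule ccontr)
    assume "degree R \<noteq> 0"
    then obtain a b where ab: "b \<noteq> 0" "[:a\<^sup>2 + b\<^sup>2, - 2 * a, 1:] dvd R"
      using real_poly_quadratic_factor[of R thesis] noroot by blast
    let ?Q = "[:a\<^sup>2 + b\<^sup>2, - 2 * a, 1:]"
    obtain S where "R = ?Q * S" using ab(2) by (auto elim: dvdE)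
    then obtain g where g: "P = ?Q * g" unfolding R by (metis mult.left_commute)
    have "L (?Q * (g * g)) > 0" if "L (g * g) > 0"
    proof -
      have "?Q * (g * g) = ([:- a, 1:] * g) * ([:- a, 1:] * g) + smult (b\<^sup>2) (g * g)"
      proof -
        have "?Q = [:- a, 1:] * [:- a, 1:] + [:b\<^sup>2:]" by (simp add: power2_eq_square)
        moreover have "smult (b\<^sup>2) (g * g) = [:b\<^sup>2:] * (g * g)" by simp
        ultimately show ?thesis by (simp only: distrib_right distrib_left mult_ac)
      qed
      moreover have "0 < b\<^sup>2 * L (g * g)" using ab(1) that by simp
      ultimately show ?thesis using square[of "[:- a, 1:] * g"] by (simp only: add smult)
    qed
    then show False using no_positive_factor[OF P g] by simp
  qed
  then show "card {x. poly P x = 0} = degree P"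
    using R0 dX P(1) R X_def by (metis add_0_right degree_mult_eq mult_eq_0_iff)
qed

text \<open>Division by the node polynomial \<open>P\<close> with remainder reduces \<open>f\<close> to a polynomial of degree less than the
number of nodes, and Lagrange interpolation evaluates the functional there.  The weights are nonnegative
because the square of a Lagrange polynomial \<open>l x\<close> takes the same values at the nodes as \<open>l x\<close>, so that
\<open>w x = L ((l x)\<^sup>2)\<close>.\<close>

lemma quadrature:
  obtains X w where "finite X" "X \<subseteq> {0..}" "\<And>x. x \<in> X \<Longrightarrow> 0 \<le> w x"
    "\<And>f. degree f \<le> m \<Longrightarrow> L f = (\<Sum>x\<in>X. w x * poly f x)"
proof -
  obtain P where P: "P \<noteq> 0" "definite_below (degree P)" "\<And>q. degree q < degree P \<Longrightarrow> L (P * q) = 0"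
    and exact: "\<And>f :: real poly. degree f \<le> m \<Longrightarrow> L (P * (f div P)) = 0"
    by (rule node_polynomial_exists[of m]) blast
  define X where "X = {x. poly P x = 0}"
  have fin: "finite X" unfolding X_def by (rule poly_roots_finite[OF P(1)])
  have card: "card X = degree P" using node_polynomial_roots(1)[OF P] by (simp add: X_def)
  define l where "l x = smult (1 / (\<Prod>y\<in>X - {x}. x - y)) (\<Prod>y\<in>X - {x}. [:- y, 1:])" for x
  have deg_l: "degree (l x) < degree P" if "x \<in> X" for x
  proof -
    have "degree (l x) \<le> degree (\<Prod>y\<in>X - {x}. [:- y, 1:])" unfolding l_def by (rule degree_smult_le)
    also have "\<dots> = card (X - {x})" by (subst degree_prod_eq_sum_degree) auto
    also have "\<dots> < card X" using that fin by (meson card_Diff1_less)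
    finally show ?thesis using card by simp
  qed
  have val_l: "poly (l x) y = (if x = y then 1 else 0)" if "x \<in> X" "y \<in> X" for x y
  proof (cases "x = y")
    case True
    then show ?thesis using fin by (simp add: l_def poly_prod)
  next
    case False
    then have "(\<Prod>z\<in>X - {x}. y - z) = 0" using fin that by (intro prod_zero bexI[of _ y]) auto
    then show ?thesis using False by (simp add: l_def poly_prod)
  qed
  define w where "w x = L (l x)" for x
  have repr: "L f = (\<Sum>x\<in>X. w x * poly f x)" if f: "L (P * (f div P)) = 0" for f
  proof -
    define g where "g = f mod P"
    have g: "g = 0 \<or> degree g < degree P" unfolding g_def by (rule degree_mod_less[OF P(1)])
    have "poly f x = poly g x" if "x \<in> X" for x
    proof -
      have "poly (P * (f div P) + g) x = poly g x" using that by (simp add: X_def)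
      then show ?thesis by (simp add: g_def)
    qed
    moreover have "g = (\<Sum>x\<in>X. smult (poly g x) (l x))" (is "_ = ?s")
    proof (rule ccontr)
      assume neq: "g \<noteq> ?s"
      have "poly (g - ?s) y = 0" if "y \<in> X" for y
      proof -
        have "(\<Sum>x\<in>X. poly g x * poly (l x) y) = (\<Sum>x\<in>X. if x = y then poly g x else 0)"
          using that by (intro sum.cong refl) (simp add: val_l)
        then show ?thesis using that fin by (simp add: poly_sum)
      qed
      then have "X \<subseteq> {x. poly (g - ?s) x = 0}" by auto
      then have "card X \<le> card {x. poly (g - ?s) x = 0}"
        using neq by (intro card_mono poly_roots_finite) auto
      also have "\<dots> \<le> degree (g - ?s)" using neq by (intro card_poly_roots_bound) auto
      finally have deg: "degree P \<le> degree (g - ?s)" using card by simp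
      show False
      proof (cases "degree P = 0")
        case True
        then have "X = {}" using card fin by auto
        then show False using neq g True by simp
      next
        case False
        have "degree (smult (poly g x) (l x)) \<le> degree P - 1" if "x \<in> X" for x
          using deg_l[OF that] degree_smult_le[of "poly g x" "l x"] by linarith
        then have "degree ?s \<le> degree P - 1" by (intro degree_sum_le[OF fin])
        moreover have "degree g \<le> degree P - 1" using g False by auto
        ultimately have "degree (g - ?s) \<le> degree P - 1" by (rule degree_diff_le[rotated])
        then show False using deg False by simp
      qed
    qed
    then have "L g = L (\<Sum>x\<in>X. smult (poly g x) (l x))" by (rule arg_cong)
    then have "L g = (\<Sum>x\<in>X. poly g x * L (l x))" by (simp only: sum smult)
    moreover have "L f = L g"
    proof -
      have "L (P * (f div P) + g) = L g" using f by (simp add: add)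
      then show ?thesis by (simp add: g_def)
    qed
    ultimately show ?thesis by (simp add: w_def mult.commute)
  qed
  have w: "0 \<le> w x" if x: "x \<in> X" for x
  proof -
    have "degree (l x * l x) \<le> degree (l x) + degree (l x)" by (rule degree_mult_le)
    also have "\<dots> < degree P + degree P" using deg_l[OF x] by simp
    finally have d: "degree (l x * l x) < degree P + degree P" .
    have "L (P * ((l x * l x) div P)) = 0"
    proof (cases "(l x * l x) div P = 0")
      case False
      have "degree (P * ((l x * l x) div P)) \<le> degree (l x * l x)"
      proof -
        have "degree P \<le> degree (l x * l x)" using False div_poly_less[of "l x * l x" P] by (metis not_less)
        moreover have "P * ((l x * l x) div P) = l x * l x - (l x * l x) mod P"
          by (simp add: minus_mod_eq_mult_div)
        moreover have "(l x * l x) mod P = 0 \<or> degree ((l x * l x) mod P) < degree P" by (rule degree_mod_less[OF P(1)])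
        ultimately show ?thesis by (metis degree_diff_le diff_zero le_refl le_trans less_imp_le)
      qed
      then have "degree P + degree ((l x * l x) div P) < degree P + degree P"
        using d False P(1) by (simp add: degree_mult_eq)
      then show ?thesis by (intro P(3)) simp
    qed simp
    then have "L (l x * l x) = (\<Sum>y\<in>X. w y * poly (l x * l x) y)" by (rule repr)
    also have "\<dots> = (\<Sum>y\<in>X. if y = x then w x else 0)" using x by (intro sum.cong refl) (auto simp: val_l)
    also have "\<dots> = w x" using fin x by simp
    finally show ?thesis using square[of "l x"] by simp
  qed
  show ?thesis
  proof (rule that[OF fin, of w])
    show "X \<subseteq> {0..}" using node_polynomial_roots(2)[OF P] by (auto simp: X_def)
    show "L f = (\<Sum>x\<in>X. w x * poly f x)" if "degree f \<le> m" for f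
      by (rule repr[OF exact[OF that]])
  qed (rule w)
qed

end

definition moment_functional :: "(nat \<Rightarrow> real) \<Rightarrow> real poly \<Rightarrow> real" where
  "moment_functional t p = (\<Sum>i\<le>degree p. coeff p i * t i)"

lemma moment_functional_eq: "degree p \<le> n \<Longrightarrow> moment_functional t p = (\<Sum>i\<le>n. coeff p i * t i)"
  unfolding moment_functional_def by (rule sum.mono_neutral_left) (auto simp: coeff_eq_0)

lemma moment_functional_add: "moment_functional t (p + q) = moment_functional t p + moment_functional t q"
proof -
  have "degree (p + q) \<le> max (degree p) (degree q)" by (rule degree_add_le_max)
  then show ?thesis
    using moment_functional_eq[of p "max (degree p) (degree q)" t] moment_functional_eq[of q "max (degree p) (degree q)" t]
      moment_functional_eq[of "p + q" "max (degree p) (degree q)" t]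
    by (simp add: distrib_right sum.distrib)
qed

lemma moment_functional_smult: "moment_functional t (smult c p) = c * moment_functional t p"
  using moment_functional_eq[OF degree_smult_le[of c p], of t]
  by (simp add: moment_functional_def[of t p] sum_distrib_left mult.assoc)

lemma moment_functional_sum: "moment_functional t (sum f A) = (\<Sum>x\<in>A. moment_functional t (f x))"
  by (induction A rule: infinite_finite_induct)
    (simp_all add: moment_functional_add, simp_all add: moment_functional_def)

lemma moment_functional_monom: "moment_functional t (monom c n) = c * t n"
proof -
  have "moment_functional t (monom c n) = (\<Sum>i\<le>n. if i = n then c * t n else 0)"
    unfolding moment_functional_eq[OF degree_monom_le] by (rule sum.cong) auto
  then show ?thesis by simp
qed

lemma moment_functional_mult:
  "moment_functional t (p * q) = (\<Sum>i\<le>degree p. \<Sum>j\<le>degree q. coeff p i * coeff q j * t (i + j))"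
proof -
  have "p * q = (\<Sum>i\<le>degree p. monom (coeff p i) i) * (\<Sum>j\<le>degree q. monom (coeff q j) j)"
    by (simp add: poly_as_sum_of_monoms)
  then show ?thesis
    by (simp add: sum_product mult_monom moment_functional_sum moment_functional_monom)
qed

lemma moment_functional_X_mult:
  "moment_functional t ([:0, 1:] * p) = moment_functional (\<lambda>n. t (n + 1)) p"
proof -
  have "[:0, 1:] * p = (\<Sum>i\<le>degree p. monom 1 1 * monom (coeff p i) i)"
    unfolding sum_distrib_left[symmetric] poly_as_sum_of_monoms by (simp add: monom_altdef)
  then show ?thesis
    by (simp only: mult_monom moment_functional_sum moment_functional_monom)
       (simp add: moment_functional_def)
qed

lemma stieltjes_quadrature:
  fixes t :: "nat \<Rightarrow> real"
  assumes "\<And>n a. 0 \<le> (\<Sum>i\<le>n. \<Sum>j\<le>n. a i * a j * t (i + j))"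
    and "\<And>n a. 0 \<le> (\<Sum>i\<le>n. \<Sum>j\<le>n. a i * a j * t (i + j + 1))"
  obtains X w where "finite X" "X \<subseteq> {0..}" "\<And>x. x \<in> X \<Longrightarrow> 0 \<le> w x"
    "\<And>k. k \<le> m \<Longrightarrow> t k = (\<Sum>x\<in>X. w x * x ^ k)"
proof -
  interpret stieltjes_functional "moment_functional t"
  proof
    show "0 \<le> moment_functional t (p * p)" for p
      unfolding moment_functional_mult by (rule assms(1))
    show "0 \<le> moment_functional t ([:0, 1:] * (p * p))" for p
      unfolding moment_functional_X_mult unfolding moment_functional_mult by (rule assms(2))
  qed (simp_all add: moment_functional_add moment_functional_smult)
  obtain X w where X: "finite X" "X \<subseteq> {0..}" "\<And>x. x \<in> X \<Longrightarrow> 0 \<le> w x"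
    "\<And>f. degree f \<le> m \<Longrightarrow> moment_functional t f = (\<Sum>x\<in>X. w x * poly f x)"
    using quadrature[of m] by blast
  have "t k = (\<Sum>x\<in>X. w x * x ^ k)" if "k \<le> m" for k
    using X(4)[of "monom 1 k"] that order.trans[OF degree_monom_le that, of 1]
    by (simp add: moment_functional_monom poly_monom degree_monom_eq)
  then show ?thesis using that X(1-3) by blast
qed

section \<open>Stieltjes' moment theorem\<close>

definition finite_atomic :: "real set \<Rightarrow> (real \<Rightarrow> real) \<Rightarrow> real measure" where
  "finite_atomic X w = distr (point_measure X (\<lambda>x. ennreal (w x))) borel (\<lambda>x. x)"

lemma finite_atomic_real_distribution:
  assumes "finite X" "\<And>x. x \<in> X \<Longrightarrow> 0 \<le> w x" "(\<Sum>x\<in>X. w x) = 1"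
  shows "real_distribution (finite_atomic X w)"
proof -
  have "prob_space (point_measure X (\<lambda>x. ennreal (w x)))"
    by (rule prob_spaceI) (use assms in \<open>simp add: space_point_measure emeasure_point_measure_finite sum_ennreal\<close>)
  then show ?thesis unfolding finite_atomic_def by (rule prob_space.real_distribution_distr) simp
qed

lemma integral_finite_atomic:
  fixes f :: "real \<Rightarrow> real"
  assumes "finite X" "\<And>x. x \<in> X \<Longrightarrow> 0 \<le> w x" "f \<in> borel_measurable borel"
  shows "integral\<^sup>L (finite_atomic X w) f = (\<Sum>x\<in>X. w x * f x)"
  unfolding finite_atomic_def
  by (subst integral_distr) (use assms in \<open>simp_all add: lebesgue_integral_point_measure_finite\<close>)

text \<open>The discrete measures from the quadrature are tight, since their first moments are constant, and Helly's
theorem yields a weak limit.  Moments pass to the limit although powers are unbounded: truncating at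
\<open>R\<close> changes the \<open>k\<close>-th moment by at most \<open>t (k + 1) / R\<close>, uniformly in the sequence.\<close>

theorem stieltjes_moment_theorem_normalized:
  fixes t :: "nat \<Rightarrow> real"
  assumes pos: "\<And>n a. 0 \<le> (\<Sum>i\<le>n. \<Sum>j\<le>n. a i * a j * t (i + j))"
    and pos': "\<And>n a. 0 \<le> (\<Sum>i\<le>n. \<Sum>j\<le>n. a i * a j * t (i + j + 1))"
    and t0: "t 0 = 1"
  obtains \<mu> where "stieltjes_representing \<mu> t"
proof -
  have "\<exists>X w. finite X \<and> X \<subseteq> {0..} \<and> (\<forall>x\<in>X. 0 \<le> w x) \<and> (\<forall>k\<le>Suc m. t k = (\<Sum>x\<in>X. w x * x ^ k))" for m
    by (rule stieltjes_quadrature[OF pos pos', of "Suc m"]) blast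
  then obtain X w where X: "\<And>m. finite (X m)" "\<And>m x. x \<in> X m \<Longrightarrow> 0 \<le> x" "\<And>m x. x \<in> X m \<Longrightarrow> 0 \<le> w m x"
    "\<And>m k. k \<le> Suc m \<Longrightarrow> t k = (\<Sum>x\<in>X m. w m x * x ^ k)"
    by (metis atLeast_iff subsetD)
  define M where "M m = finite_atomic (X m) (w m)" for m
  have one: "(\<Sum>x\<in>X m. w m x) = 1" for m using X(4)[of 0 m] t0 by simp
  have rd: "real_distribution (M m)" for m
    unfolding M_def by (rule finite_atomic_real_distribution[OF X(1) X(3) one])
  have int: "integral\<^sup>L (M m) f = (\<Sum>x\<in>X m. w m x * f x)" if "f \<in> borel_measurable borel" for m and f :: "real \<Rightarrow> real"
    unfolding M_def by (rule integral_finite_atomic[OF X(1) X(3) that])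
  have tn: "0 \<le> t k" for k
    using X(4)[of k k] X(2,3) by (simp add: sum_nonneg)
  have tight: "tight M"
    unfolding tight_def
  proof (intro conjI allI impI rd)
    fix \<epsilon> :: real assume \<epsilon>: "0 < \<epsilon>"
    \<comment> \<open>Markov's inequality with the first moment \<open>t 1\<close>; adding 1 makes the estimate strict.\<close>
    define b where "b = (t 1 + 1) / \<epsilon>"
    have b: "0 < b" using tn[of 1] \<epsilon> by (simp add: b_def)
    have "1 - \<epsilon> < measure (M m) {-1<..b}" for m
    proof -
      interpret real_distribution "M m" by (rule rd)
      have "measure (M m) {-1<..b} = integral\<^sup>L (M m) (indicator {-1<..b})" by simp
      also have "\<dots> = (\<Sum>x\<in>X m. w m x * indicator {-1<..b} x)" by (rule int) simp
      also have "\<dots> \<ge> (\<Sum>x\<in>X m. w m x * (1 - x / b))"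
      proof (intro sum_mono mult_left_mono X(3))
        fix x assume "x \<in> X m"
        then show "1 - x / b \<le> indicator {-1<..b} x"
          using X(2)[of x m] b by (auto simp: indicator_def field_simps)
      qed
      finally have "measure (M m) {-1<..b} \<ge> (\<Sum>x\<in>X m. w m x) - (\<Sum>x\<in>X m. w m x * x) / b"
        by (simp add: right_diff_distrib sum_subtractf sum_divide_distrib)
      also have "(\<Sum>x\<in>X m. w m x) - (\<Sum>x\<in>X m. w m x * x) / b = 1 - t 1 / b"
        using one[of m] X(4)[of 1 m] by simp
      finally have "1 - t 1 / b \<le> measure (M m) {-1<..b}" .
      moreover have "t 1 / b < \<epsilon>" using tn[of 1] \<epsilon> by (simp add: b_def field_simps)
      ultimately show ?thesis by simp
    qed
    then show "\<exists>a b. a < b \<and> (\<forall>n. 1 - \<epsilon> < measure (M n) {a<..b})"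
      using b by (intro exI[of _ "-1"] exI[of _ b]) auto
  qed
  obtain r N where r: "strict_mono r" and N: "real_distribution N" and conv: "weak_conv_m (M \<circ> id \<circ> r) N"
    using tight_imp_convergent_subsubsequence[OF tight strict_mono_id] by blast
  have rd': "real_distribution ((M \<circ> id \<circ> r) n)" for n by (simp add: rd)
  interpret N: real_distribution N by (rule N)
  have lim: "(\<lambda>n. \<Sum>x\<in>X (r n). w (r n) x * f x) \<longlonglongrightarrow> integral\<^sup>L N f"
    if "\<And>x. isCont f x" "\<And>x. norm (f x) \<le> B" for f :: "real \<Rightarrow> real" and B
  proof -
    have "(\<lambda>n. integral\<^sup>L ((M \<circ> id \<circ> r) n) f) \<longlonglongrightarrow> integral\<^sup>L N f"
      by (rule weak_conv_imp_integral_bdd_continuous_conv[OF rd' N conv that])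
    moreover have "f \<in> borel_measurable borel"
      using that(1) by (intro borel_measurable_continuous_onI continuous_at_imp_continuous_on) auto
    ultimately show ?thesis by (simp add: int)
  qed
  have AE: "AE x in N. 0 \<le> x"
  proof -
    \<comment> \<open>A bounded continuous function that vanishes on the half-line and detects mass to the left of it.\<close>
    define f :: "real \<Rightarrow> real" where "f x = min 1 (max 0 (- x))" for x
    have cont: "isCont f x" for x unfolding f_def by (intro continuous_intros)
    have f: "f \<in> borel_measurable borel"
      using cont by (intro borel_measurable_continuous_onI continuous_at_imp_continuous_on) auto
    have "(\<Sum>x\<in>X (r n). w (r n) x * f x) = 0" for n
      using X(2) by (intro sum.neutral) (auto simp: f_def)
    then have "integral\<^sup>L N f = 0"
      using lim[of f 1, OF cont] LIMSEQ_unique[OF tendsto_const] by (force simp: f_def)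
    then have "AE x in N. f x = 0"
      using f by (subst (asm) integral_nonneg_eq_0_iff_AE)
        (auto simp: f_def intro!: N.integrable_const_bound[where B = 1])
    then show ?thesis by eventually_elim (auto simp: f_def min_def max_def split: if_splits)
  qed
  have moment: "(\<integral>\<^sup>+x. ennreal (x ^ k) \<partial>N) = ennreal (t k)" for k
  proof -
    define g :: "nat \<Rightarrow> real \<Rightarrow> real" where "g R x = (min (real R) (max 0 x)) ^ k" for R x
    have cont: "isCont (g R) x" for R x unfolding g_def by (intro continuous_intros)
    have g_bd: "norm (g R x) \<le> real R ^ k" for R x unfolding g_def by (auto simp: power_abs intro!: power_mono)
    have gm[measurable]: "g R \<in> borel_measurable borel" for R
      using cont by (intro borel_measurable_continuous_onI continuous_at_imp_continuous_on) auto
    have g0: "0 \<le> g R x" for R x by (simp add: g_def)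
    have up: "integral\<^sup>L N (g R) \<le> t k" for R
    proof (rule LIMSEQ_le_const2[OF lim[OF cont g_bd]], intro exI[of _ k] allI impI)
      fix n assume "k \<le> n"
      then have "k \<le> Suc (r n)" using strict_mono_imp_increasing[OF r, of n] by simp
      have "(\<Sum>x\<in>X (r n). w (r n) x * g R x) \<le> (\<Sum>x\<in>X (r n). w (r n) x * x ^ k)"
        using X(2,3) by (intro sum_mono mult_left_mono) (auto simp: g_def intro!: power_mono)
      also have "\<dots> = t k" using X(4)[OF \<open>k \<le> Suc (r n)\<close>] by simp
      finally show "(\<Sum>x\<in>X (r n). w (r n) x * g R x) \<le> t k" .
    qed
    have low: "t k - t (Suc k) / real R \<le> integral\<^sup>L N (g R)" if R: "R > 0" for R
    proof (rule LIMSEQ_le_const[OF lim[OF cont g_bd]], intro exI[of _ k] allI impI)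
      fix n assume "k \<le> n"
      then have k: "k \<le> Suc (r n)" "Suc k \<le> Suc (r n)" using strict_mono_imp_increasing[OF r, of n] by simp_all
      have "t k - t (Suc k) / real R = (\<Sum>x\<in>X (r n). w (r n) x * (x ^ k - x ^ Suc k / real R))"
        unfolding X(4)[OF k(1)] X(4)[OF k(2)] by (simp add: right_diff_distrib sum_subtractf sum_divide_distrib)
      also have "\<dots> \<le> (\<Sum>x\<in>X (r n). w (r n) x * g R x)"
      proof (intro sum_mono mult_left_mono X(3))
        fix x assume "x \<in> X (r n)"
        then have x: "0 \<le> x" by (rule X(2))
        show "x ^ k - x ^ Suc k / real R \<le> g R x"
        proof (cases "x \<le> real R")
          case True
          then show ?thesis using x by (simp add: g_def min_def)
        next
          case False
          then have "x ^ k * 1 \<le> x ^ k * (x / real R)" using x R by (intro mult_left_mono) auto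
          then have "x ^ k - x ^ Suc k / real R \<le> 0" by (simp add: mult.commute)
          then show ?thesis using g0[of R x] by linarith
        qed
      qed
      finally show "t k - t (Suc k) / real R \<le> (\<Sum>x\<in>X (r n). w (r n) x * g R x)" .
    qed
    have "(\<lambda>R. integral\<^sup>L N (g R)) \<longlonglongrightarrow> t k"
    proof (rule tendsto_sandwich[of "\<lambda>R. t k - t (Suc k) / real R" _ _ "\<lambda>_. t k"])
      show "\<forall>\<^sub>F R in sequentially. t k - t (Suc k) / real R \<le> integral\<^sup>L N (g R)"
        using eventually_gt_at_top[of 0] by eventually_elim (rule low)
      show "(\<lambda>R. t k - t (Suc k) / real R) \<longlonglongrightarrow> t k"
        using tendsto_diff[OF tendsto_const[of "t k"] lim_const_over_n[of "t (Suc k)"]] by simp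
    qed (simp_all add: up)
    have 1: "(\<lambda>R. \<integral>\<^sup>+x. ennreal (g R x) \<partial>N) \<longlonglongrightarrow> ennreal (t k)"
    proof -
      have "integrable N (g R)" for R by (rule N.integrable_const_bound[where B = "real R ^ k"]) (use g_bd in auto)
      then have "(\<integral>\<^sup>+x. ennreal (g R x) \<partial>N) = ennreal (integral\<^sup>L N (g R))" for R
        by (intro nn_integral_eq_integral) (simp_all add: g0)
      then show ?thesis using \<open>(\<lambda>R. integral\<^sup>L N (g R)) \<longlonglongrightarrow> t k\<close> by (simp add: tendsto_ennrealI)
    qed
    have 2: "(\<lambda>R. \<integral>\<^sup>+x. ennreal (g R x) \<partial>N) \<longlonglongrightarrow> (\<integral>\<^sup>+x. ennreal (max 0 x ^ k) \<partial>N)"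
    proof (rule nn_integral_LIMSEQ)
      show "incseq (\<lambda>R x. ennreal (g R x))"
        by (auto simp: incseq_def le_fun_def g_def intro!: ennreal_leI power_mono)
      show "(\<lambda>R. ennreal (g R x)) \<longlonglongrightarrow> ennreal (max 0 x ^ k)" for x
      proof (rule tendsto_eventually)
        obtain R0 :: nat where "max 0 x \<le> real R0" using real_arch_simple by blast
        then show "\<forall>\<^sub>F R in sequentially. ennreal (g R x) = ennreal (max 0 x ^ k)"
          unfolding eventually_sequentially g_def 
          proof (intro exI[of _ R0] allI impI)
            fix n assume "R0 \<le> n"
            then have "max 0 x \<le> real n" using \<open>max 0 x \<le> real R0\<close> by linarith
            then show "ennreal (min (real n) (max 0 x) ^ k) = ennreal (max 0 x ^ k)" by (simp add: min_absorb2)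
          qed
      qed
    qed simp
    have "(\<integral>\<^sup>+x. ennreal (max 0 x ^ k) \<partial>N) = (\<integral>\<^sup>+x. ennreal (x ^ k) \<partial>N)"
      by (rule nn_integral_cong_AE) (use AE in eventually_elim, simp)
    then show ?thesis using LIMSEQ_unique[OF 1 2] by simp
  qed
  have "stieltjes_representing (restrict_space N {0..}) t"
    unfolding stieltjes_representing_def borel_Rplus_def
  proof (intro conjI allI)
    show "sets (restrict_space N {0..}) = sets (restrict_space borel {0..})"
      by (rule sets_restrict_space_cong) simp
    fix k
    have "(\<integral>\<^sup>+x. ennreal x ^ k \<partial>restrict_space N {0..}) = (\<integral>\<^sup>+x. ennreal x ^ k * indicator {0..} x \<partial>N)"
      by (rule nn_integral_restrict_space) simp
    also have "\<dots> = (\<integral>\<^sup>+x. ennreal (x ^ k) \<partial>N)"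
      by (rule nn_integral_cong_AE) (use AE in eventually_elim, simp add: ennreal_power)
    finally show "(\<integral>\<^sup>+x. ennreal x ^ k \<partial>restrict_space N {0..}) = ennreal (t k)" by (simp add: moment)
  qed
  then show ?thesis by (rule that)
qed

text \<open>Stieltjes' theorem.  The case of total mass 1 applies after scaling.\<close>

theorem stieltjes_moment_theorem:
  fixes t :: "nat \<Rightarrow> real"
  assumes pos: "\<And>n a. 0 \<le> (\<Sum>i\<le>n. \<Sum>j\<le>n. a i * a j * t (i + j))"
    and pos': "\<And>n a. 0 \<le> (\<Sum>i\<le>n. \<Sum>j\<le>n. a i * a j * t (i + j + 1))"
    and t0: "t 0 > 0"
  shows "stieltjes_moment_seq t"
proof -
  have scale: "(\<Sum>i\<le>n. \<Sum>j\<le>n. a i * a j * (t (f i j) / t 0)) = (\<Sum>i\<le>n. \<Sum>j\<le>n. a i * a j * t (f i j)) / t 0" for n a f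
    by (simp add: sum_divide_distrib)
  obtain \<mu> where \<mu>: "stieltjes_representing \<mu> (\<lambda>n. t n / t 0)"
  proof (rule stieltjes_moment_theorem_normalized[of "\<lambda>n. t n / t 0"])
    show "0 \<le> (\<Sum>i\<le>n. \<Sum>j\<le>n. a i * a j * (t (i + j) / t 0))" for n a
      unfolding scale using pos[where n = n and a = a] t0 by simp
    show "0 \<le> (\<Sum>i\<le>n. \<Sum>j\<le>n. a i * a j * (t (i + j + 1) / t 0))" for n a
      unfolding scale using pos'[where n = n and a = a] t0 by simp
  qed (use t0 in auto)
  have "0 \<le> t n" for n
  proof (cases "even n")
    case True
    then obtain m where m: "n = m + m" by (metis evenE mult_2)
    have "(\<Sum>i\<le>m. \<Sum>j\<le>m. of_bool (i = m) * of_bool (j = m) * t (i + j)) = t n"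
      by (simp add: m sum.If_cases of_bool_def if_distrib[of "\<lambda>x. x * _"] cong: if_cong)
    then show ?thesis using pos[where n = m and a = "\<lambda>i. of_bool (i = m)"] by simp
  next
    case False
    then obtain m where m: "n = m + m + 1" by (metis oddE mult_2)
    have "(\<Sum>i\<le>m. \<Sum>j\<le>m. of_bool (i = m) * of_bool (j = m) * t (i + j + 1)) = t n"
      by (simp add: m sum.If_cases of_bool_def if_distrib[of "\<lambda>x. x * _"] cong: if_cong)
    then show ?thesis using pos'[where n = m and a = "\<lambda>i. of_bool (i = m)"] by simp
  qed
  moreover have "stieltjes_representing (scale_measure (ennreal (t 0)) \<mu>) (\<lambda>n. t 0 * (t n / t 0))"
    by (rule stieltjes_representing_scale[OF \<mu>]) (use t0 calculation in simp_all)
  then have "stieltjes_representing (scale_measure (ennreal (t 0)) \<mu>) t" using t0 by simp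
  ultimately show ?thesis unfolding stieltjes_moment_seq_def by blast
qed

section \<open>Quasi-analyticity\<close>

lemma sum_power_fact_le_exp:
  fixes y :: real
  assumes "0 \<le> y"
  shows "(\<Sum>i\<le>m. y ^ i / fact i) \<le> exp y"
proof -
  have "(\<lambda>n. y ^ n / fact n) sums exp y" using exp_converges[of y] by (simp add: divide_inverse mult.commute)
  then show ?thesis
    using assms sum_le_suminf[of "\<lambda>n. y ^ n / fact n" "{..m}"] by (simp add: sums_iff)
qed

lemma log_convex_ratio_mono:
  fixes M :: "nat \<Rightarrow> real"
  assumes "\<And>n. 0 < M n" "\<And>n. (M (Suc n))\<^sup>2 \<le> M n * M (Suc (Suc n))" "i \<le> j"
  shows "M (Suc i) / M i \<le> M (Suc j) / M j"
  using assms(3)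
proof (induction rule: dec_induct)
  case (step n)
  have "M (Suc n) / M n \<le> M (Suc (Suc n)) / M (Suc n)"
    using assms(1)[of n] assms(1)[of "Suc n"] assms(2)[of n] by (simp add: field_simps power2_eq_square)
  with step.IH show ?case by simp
qed simp

text \<open>For a logarithmically convex sequence the quotients of consecutive terms increase, so the last quotient
bounds all earlier ones.\<close>

lemma log_convex_le_ratio_power:
  fixes M :: "nat \<Rightarrow> real"
  assumes "\<And>n. 0 < M n" "\<And>n. (M (Suc n))\<^sup>2 \<le> M n * M (Suc (Suc n))" "j + i \<le> Suc N"
  shows "M (j + i) \<le> M j * (M (Suc N) / M N) ^ i"
  using assms(3)
proof (induction i)
  case (Suc i)
  have "M (j + Suc i) = M (j + i) * (M (Suc (j + i)) / M (j + i))" using assms(1)[of "j + i"] by simp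
  also have "\<dots> \<le> (M j * (M (Suc N) / M N) ^ i) * (M (Suc N) / M N)"
    using Suc assms(1) less_imp_le[OF assms(1)]
    by (intro mult_mono log_convex_ratio_mono[of M, OF assms(1,2)]) auto
  finally show ?case by (simp add: mult_ac)
qed simp

text \<open>The step of Bang's proof of the Denjoy--Carleman theorem.  If at \<open>x\<close> every \<open>f j\<close> is smaller than
its bound \<open>M j\<close> by the factor \<open>e\<^sup>j\<^sup>-\<^sup>N\<^sup>-\<^sup>1\<close>, then a move by at most \<open>M N / (e M (N + 1))\<close> costs only one
factor \<open>e\<close>: the Taylor expansion at \<open>x\<close> is dominated by the exponential series at a point of \<open>[0, 1]\<close>.\<close>

lemma Bang_step:
  fixes f :: "nat \<Rightarrow> real \<Rightarrow> 'a::real_normed_vector" and M :: "nat \<Rightarrow> real"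
  assumes M: "\<And>n. 0 < M n" "\<And>n. (M (Suc n))\<^sup>2 \<le> M n * M (Suc (Suc n))"
    and bound: "\<And>n x. norm (f n x) \<le> M n"
    and taylor: "\<And>n m x h. norm (f n (x + h) - (\<Sum>i<m. (h ^ i / fact i) *\<^sub>R f (n + i) x))
        \<le> M (n + m) * \<bar>h\<bar> ^ m / fact m"
    and x: "\<And>j. norm (f j x) \<le> exp (real j - real (Suc N)) * M j"
    and h: "\<bar>h\<bar> \<le> M N / (exp 1 * M (Suc N))"
  shows "norm (f j (x + h)) \<le> exp (real j - real N) * M j"
proof (cases "j \<le> N")
  case False
  have "norm (f j (x + h)) \<le> 1 * M j" using bound by simp
  also have "\<dots> \<le> exp (real j - real N) * M j"
    using False less_imp_le[OF M(1)] by (intro mult_right_mono) auto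
  finally show ?thesis .
next
  case True
  define m where "m = Suc N - j"
  define r where "r = M (Suc N) / M N"
  have r: "0 < r" using M(1) by (simp add: r_def)
  have m: "j + m = Suc N" using True by (simp add: m_def)
  have y: "exp 1 * r * \<bar>h\<bar> \<le> 1"
    using h M(1)[of N] M(1)[of "Suc N"] by (simp add: r_def field_simps)
  have "norm (f j (x + h)) \<le> norm (f j (x + h) - (\<Sum>i<m. (h ^ i / fact i) *\<^sub>R f (j + i) x))
      + norm (\<Sum>i<m. (h ^ i / fact i) *\<^sub>R f (j + i) x)"
    using norm_triangle_ineq[of "f j (x + h) - (\<Sum>i<m. (h ^ i / fact i) *\<^sub>R f (j + i) x)"
        "\<Sum>i<m. (h ^ i / fact i) *\<^sub>R f (j + i) x"] by simp
  also have "\<dots> \<le> M (j + m) * \<bar>h\<bar> ^ m / fact m + (\<Sum>i<m. norm ((h ^ i / fact i) *\<^sub>R f (j + i) x))"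
    by (intro add_mono taylor norm_sum)
  also have "\<dots> \<le> \<bar>h\<bar> ^ m / fact m * (exp (real (j + m) - real (Suc N)) * M (j + m))
      + (\<Sum>i<m. \<bar>h\<bar> ^ i / fact i * (exp (real (j + i) - real (Suc N)) * M (j + i)))"
  proof (intro add_mono sum_mono)
    fix i
    have "norm ((h ^ i / fact i) *\<^sub>R f (j + i) x) = \<bar>h\<bar> ^ i / fact i * norm (f (j + i) x)"
      by (simp add: power_abs)
    also have "\<dots> \<le> \<bar>h\<bar> ^ i / fact i * (exp (real (j + i) - real (Suc N)) * M (j + i))"
      by (intro mult_left_mono x) auto
    finally show "norm ((h ^ i / fact i) *\<^sub>R f (j + i) x)
        \<le> \<bar>h\<bar> ^ i / fact i * (exp (real (j + i) - real (Suc N)) * M (j + i))" .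
  qed (simp add: m mult.commute)
  also have "\<dots> = (\<Sum>i\<le>m. \<bar>h\<bar> ^ i / fact i * (exp (real (j + i) - real (Suc N)) * M (j + i)))"
    by (simp add: lessThan_Suc_atMost[symmetric])
  also have "\<dots> \<le> (\<Sum>i\<le>m. exp (real j - real (Suc N)) * M j * ((exp 1 * r * \<bar>h\<bar>) ^ i / fact i))"
  proof (rule sum_mono)
    fix i assume "i \<in> {..m}"
    then have "M (j + i) \<le> M j * r ^ i"
      unfolding r_def using m by (intro log_convex_le_ratio_power[of M, OF M]) auto
    then have "\<bar>h\<bar> ^ i / fact i * (exp (real (j + i) - real (Suc N)) * M (j + i))
        \<le> \<bar>h\<bar> ^ i / fact i * (exp (real (j + i) - real (Suc N)) * (M j * r ^ i))"
      by (intro mult_left_mono) auto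
    also have "\<dots> = exp (real j - real (Suc N)) * M j * ((exp 1 * r * \<bar>h\<bar>) ^ i / fact i)"
    proof -
      have "exp (real (j + i) - real (Suc N)) = exp (real j - real (Suc N)) * exp 1 ^ i"
        by (simp add: exp_of_nat_mult[symmetric] mult_exp_exp algebra_simps)
      then show ?thesis by (simp only: power_mult_distrib times_divide_eq_left times_divide_eq_right mult_ac)
    qed
    finally show "\<bar>h\<bar> ^ i / fact i * (exp (real (j + i) - real (Suc N)) * M (j + i))
        \<le> exp (real j - real (Suc N)) * M j * ((exp 1 * r * \<bar>h\<bar>) ^ i / fact i)" .
  qed
  also have "\<dots> = exp (real j - real (Suc N)) * M j * (\<Sum>i\<le>m. (exp 1 * r * \<bar>h\<bar>) ^ i / fact i)"
    by (simp add: sum_distrib_left)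
  also have "\<dots> \<le> exp (real j - real (Suc N)) * M j * exp 1"
  proof (intro mult_left_mono)
    have "(\<Sum>i\<le>m. (exp 1 * r * \<bar>h\<bar>) ^ i / fact i) \<le> exp (exp 1 * r * \<bar>h\<bar>)"
      by (rule sum_power_fact_le_exp) (use r in simp)
    also have "\<dots> \<le> exp 1" using y by simp
    finally show "(\<Sum>i\<le>m. (exp 1 * r * \<bar>h\<bar>) ^ i / fact i) \<le> exp 1" .
  qed (use less_imp_le[OF M(1)] in simp)
  also have "\<dots> = exp (real j - real N) * M j" by (simp add: mult_exp_exp mult.commute mult.left_commute)
  finally show ?thesis .
qed

text \<open>The function \<open>f n\<close> plays the part of the \<open>n\<close>-th derivative of \<open>f 0\<close>.  The hypothesis is Taylor's estimate
for the remainder because for Fourier integrals it follows by integrating the estimate for the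
exponential function.  At 0 all bounds hold with every power of \<open>e\<close> to spare.  By \<open>Bang_step\<close> the reserve
lasts, down to the factor \<open>e\<^sup>-\<^sup>k\<close>, on an interval whose length is a partial sum of a divergent series
starting at \<open>k\<close>.  Hence \<open>|f 0 x| \<le> e\<^sup>-\<^sup>k M 0\<close> for every \<open>k\<close>.\<close>

theorem Denjoy_Carleman:
  fixes f :: "nat \<Rightarrow> real \<Rightarrow> 'a::real_normed_vector" and M :: "nat \<Rightarrow> real"
  assumes M: "\<And>n. 0 < M n" "\<And>n. (M (Suc n))\<^sup>2 \<le> M n * M (Suc (Suc n))"
    and bound: "\<And>n x. norm (f n x) \<le> M n"
    and taylor: "\<And>n m x h. norm (f n (x + h) - (\<Sum>i<m. (h ^ i / fact i) *\<^sub>R f (n + i) x))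
        \<le> M (n + m) * \<bar>h\<bar> ^ m / fact m"
    and flat: "\<And>n. f n 0 = 0"
    and div: "\<not> summable (\<lambda>n. M n / M (Suc n))"
  shows "f 0 x = 0"
proof -
  define \<delta> where "\<delta> n = M n / (exp 1 * M (Suc n))" for n
  have \<delta>0: "0 \<le> \<delta> n" for n using less_imp_le[OF M(1)] by (simp add: \<delta>_def)
  have P: "norm (f j y) \<le> exp (real j - real k) * M j"
    if "k \<le> N" "\<bar>y\<bar> \<le> (\<Sum>n=k..<N. \<delta> n)" for k N y j
    using that
  proof (induction arbitrary: y j rule: inc_induct)
    case base
    then have "y = 0" by simp
    then show ?case using flat less_imp_le[OF M(1)] by simp
  next
    case (step n)
    \<comment> \<open>The point at distance at most \<open>\<delta> n\<close> from \<open>y\<close> that is nearest to 0.\<close>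
    define z where "z = (if \<bar>y\<bar> \<le> \<delta> n then 0 else y - sgn y * \<delta> n)"
    have "\<bar>y\<bar> \<le> \<delta> n + (\<Sum>i=Suc n..<N. \<delta> i)"
      using step.prems step.hyps by (simp add: sum.atLeast_Suc_lessThan)
    moreover have "0 \<le> (\<Sum>i=Suc n..<N. \<delta> i)" by (intro sum_nonneg \<delta>0)
    ultimately have z: "\<bar>z\<bar> \<le> (\<Sum>i=Suc n..<N. \<delta> i)" "\<bar>y - z\<bar> \<le> \<delta> n"
      using \<delta>0[of n] by (auto simp: z_def sgn_if)
    have "norm (f j (z + (y - z))) \<le> exp (real j - real n) * M j"
      by (rule Bang_step[of M f, OF M bound taylor]) (use step.IH[OF z(1)] z(2) in \<open>auto simp: \<delta>_def\<close>)
    then show ?case by simp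
  qed
  have large: "\<exists>N\<ge>k. \<bar>x\<bar> \<le> (\<Sum>n=k..<N. \<delta> n)" for k
  proof (rule ccontr)
    assume "\<not> ?thesis"
    then have small: "(\<Sum>n=k..<N. \<delta> n) \<le> \<bar>x\<bar>" if "k \<le> N" for N using that by force
    have "summable (\<lambda>n. \<delta> (n + k))"
    proof (rule summableI_nonneg_bounded[where x = "\<bar>x\<bar>"])
      show "(\<Sum>i<n. \<delta> (i + k)) \<le> \<bar>x\<bar>" for n
        using small[of "n + k"] by (simp add: sum.shift_bounds_nat_ivl[of \<delta> 0 k n, simplified] lessThan_atLeast0)
    qed (rule \<delta>0)
    then have "summable (\<lambda>n. exp 1 * \<delta> n)" by (intro summable_mult) (simp add: summable_iff_shift)
    then show False using div by (simp add: \<delta>_def)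
  qed
  have le: "norm (f 0 x) \<le> exp (- real k) * M 0" for k
    using large[of k] P[of k _ x 0] by auto
  have "(\<lambda>k. exp (- real k) * M 0) \<longlonglongrightarrow> 0 * M 0"
    by (intro tendsto_mult tendsto_const filterlim_compose[OF exp_at_bot]
        filterlim_compose[OF filterlim_uminus_at_bot_at_top] filterlim_real_sequentially)
  then have "norm (f 0 x) \<le> 0 * M 0" by (rule LIMSEQ_le_const) (use le in auto)
  then show ?thesis by simp
qed

section \<open>Carleman's inequality\<close>

text \<open>Carleman's inequality, in the form of a summability statement.  The arithmetic-geometric mean inequality
is applied to the weighted terms \<open>c i * a i\<close>; the weights are chosen such that their geometric means are
\<open>n + 2\<close> and that summation by parts leaves coefficients \<open>c j / (j + 1) = (1 + 1/(j+1))\<^sup>j\<^sup>+\<^sup>1 \<le> e\<close>.\<close>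

lemma carleman_summable:
  fixes a :: "nat \<Rightarrow> real"
  assumes pos: "\<And>n. 0 < a n" and sum: "summable a"
  shows "summable (\<lambda>n. (\<Prod>i\<le>n. a i) powr (1 / real (n + 1)))"
proof -
  define c where "c i = (real i + 2) ^ (i + 1) / (real i + 1) ^ i" for i
  have c0: "0 < c i" for i by (simp add: c_def)
  have prod_c: "(\<Prod>i\<le>n. c i) = (real n + 2) ^ (n + 1)" for n
  proof (induction n)
    case (Suc n)
    then show ?case by (simp add: c_def add_ac)
  qed (simp add: c_def)
  define S where "S n = (\<Sum>i\<le>n. c i * a i)" for n
  have GM: "(\<Prod>i\<le>n. a i) powr (1 / real (n + 1)) \<le> S n / ((real n + 1) * (real n + 2))" for n
  proof -
    have "(\<Prod>i\<le>n. c i * a i) powr (1 / real (card {..n})) \<le> (\<Sum>i\<le>n. c i * a i / card {..n})"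
      by (rule arith_geom_mean) (use c0 pos in \<open>auto intro: less_imp_le\<close>)
    also have "\<dots> = S n / (real n + 1)" by (simp add: S_def sum_divide_distrib add.commute)
    also have "(\<Prod>i\<le>n. c i * a i) powr (1 / real (card {..n}))
        = (real n + 2) * (\<Prod>i\<le>n. a i) powr (1 / real (n + 1))"
    proof -
      have "((real n + 2) ^ (n + 1)) powr (1 / real (n + 1)) = real n + 2"
        by (subst powr_realpow[symmetric]) (simp_all add: powr_powr del: power_Suc)
      then show ?thesis
        by (simp add: prod.distrib prod_c powr_mult prod_nonneg less_imp_le[OF pos] del: power_Suc)
    qed
    finally have "(\<Prod>i\<le>n. a i) powr (1 / real (n + 1)) \<le> S n / (real n + 1) / (real n + 2)"
      by (simp add: pos_le_divide_eq mult.commute)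
    then show ?thesis by simp
  qed
  \<comment> \<open>Summation by parts, based on \<open>1 / ((n + 1) (n + 2)) = 1 / (n + 1) - 1 / (n + 2)\<close>.\<close>
  have tele: "(\<Sum>n\<le>N. S n / ((real n + 1) * (real n + 2))) + S N / (real N + 2)
      = (\<Sum>j\<le>N. c j * a j / (real j + 1))" for N
  proof (induction N)
    case (Suc N)
    have "S (Suc N) = S N + c (Suc N) * a (Suc N)" by (simp add: S_def)
    moreover have "S (Suc N) / ((real (Suc N) + 1) * (real (Suc N) + 2)) + S (Suc N) / (real (Suc N) + 2)
        = S (Suc N) / (real N + 2)"
      by (simp add: divide_simps) (simp add: algebra_simps)
    ultimately show ?case using Suc by (simp add: add_divide_distrib add_ac)
  qed (simp add: S_def)
  have cj: "c j / (real j + 1) \<le> exp 1" for j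
  proof -
    have "c j / (real j + 1) = (1 + 1 / real (Suc j)) ^ Suc j"
    proof -
      have "1 + 1 / real (Suc j) = (real j + 2) / (real j + 1)" by (simp add: field_simps)
      then show ?thesis by (simp add: c_def power_divide)
    qed
    also have "\<dots> \<le> exp (1 / real (Suc j)) ^ Suc j"
      by (intro power_mono exp_ge_add_one_self) auto
    also have "\<dots> = exp 1" by (simp add: exp_of_nat_mult[symmetric] del: of_nat_Suc power_Suc)
    finally show ?thesis .
  qed
  show ?thesis
  proof (rule bounded_imp_summable)
    fix N
    have "(\<Sum>n\<le>N. (\<Prod>i\<le>n. a i) powr (1 / real (n + 1))) \<le> (\<Sum>n\<le>N. S n / ((real n + 1) * (real n + 2)))"
      by (intro sum_mono GM)
    also have "\<dots> \<le> (\<Sum>j\<le>N. c j * a j / (real j + 1))"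
      unfolding tele[symmetric] using c0 pos by (simp add: S_def sum_nonneg less_imp_le)
    also have "\<dots> \<le> (\<Sum>j\<le>N. exp 1 * a j)"
    proof (rule sum_mono)
      show "c j * a j / (real j + 1) \<le> exp 1 * a j" for j
        using mult_right_mono[OF cj less_imp_le[OF pos], of j j] by simp
    qed
    also have "\<dots> = exp 1 * (\<Sum>j\<le>N. a j)" by (simp add: sum_distrib_left)
    also have "\<dots> \<le> exp 1 * suminf a"
      using sum pos by (intro mult_left_mono sum_le_suminf) (auto intro: less_imp_le)
    finally show "(\<Sum>n\<le>N. (\<Prod>i\<le>n. a i) powr (1 / real (n + 1))) \<le> exp 1 * suminf a" .
  qed simp
qed

text \<open>The geometric means of the quotients \<open>M n / M (n + 1)\<close> telescope.  Two leading terms \<open>c\<close> are prepended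
so that the exponent belonging to \<open>M (2 n)\<close> becomes \<open>1 / (2 (n + 1))\<close> instead of \<open>1 / (2 n)\<close>; this is how
the index shift between \<open>\<parallel>S\<^sup>n\<^sup>+\<^sup>1 e\<^sub>0\<parallel>\<^sup>2\<close> and its exponent is absorbed.\<close>

lemma carleman_ratio_summable:
  fixes M :: "nat \<Rightarrow> real"
  assumes M: "\<And>n. 0 < M n" and sum: "summable (\<lambda>n. M n / M (Suc n))" and C: "0 < C"
  shows "summable (\<lambda>n. (C / M (2 * n)) powr (1 / (2 * real (n + 1))))"
proof -
  define c where "c = sqrt (C / M 0)"
  have c: "0 < c" "c * c = C / M 0" using C M[of 0] by (auto simp: c_def)
  define a where "a k = (if k < 2 then c else M (k - 2) / M (k - 1))" for k
  have "a (n + 2) = M n / M (Suc n)" for n by (simp add: a_def)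
  then have "summable (\<lambda>n. a (n + 2))" using sum by simp
  then have "summable a" by (simp only: summable_iff_shift)
  moreover have "0 < a n" for n using M c by (simp add: a_def)
  ultimately have "summable (\<lambda>n. (\<Prod>i\<le>n. a i) powr (1 / real (n + 1)))" by (intro carleman_summable)
  then have "summable ((\<lambda>n. (\<Prod>i\<le>n. a i) powr (1 / real (n + 1))) \<circ> (\<lambda>n. 2 * n + 1))"
    by (rule summable_reindex) (auto simp: inj_def)
  moreover have "(\<Prod>i\<le>Suc n. a i) = C / M n" for n
  proof (induction n)
    case 0
    then show ?case using c by (simp add: a_def)
  next
    case (Suc n)
    then show ?case using M[of n] by (simp add: a_def[of "Suc (Suc n)"])
  qed
  then have "(\<Prod>i\<le>2 * n + 1. a i) = C / M (2 * n)" for n by simp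
  ultimately show ?thesis by (simp add: o_def algebra_simps)
qed

section \<open>Carleman's criterion for determinacy\<close>

lemma (in prob_space) abs_power_integrable:
  fixes X :: "'a \<Rightarrow> real"
  assumes [measurable]: "X \<in> borel_measurable M" and even: "\<And>k. integrable M (\<lambda>x. X x ^ (2 * k))"
  shows "integrable M (\<lambda>x. \<bar>X x\<bar> ^ k)"
proof (rule Bochner_Integration.integrable_bound)
  show "integrable M (\<lambda>x. 1 + X x ^ (2 * k))" using even by simp
  have "\<bar>u\<bar> ^ k \<le> 1 + u ^ (2 * k)" for u :: real
  proof (cases "\<bar>u\<bar> \<le> 1")
    case True
    then have "\<bar>u\<bar> ^ k \<le> 1" by (simp add: power_le_one)
    then show ?thesis by (simp add: add_increasing2)
  next
    case False
    then have "\<bar>u\<bar> ^ k \<le> \<bar>u\<bar> ^ (2 * k)" by (intro power_increasing) auto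
    then show ?thesis by (simp add: power_even_abs)
  qed
  then show "AE x in M. norm (\<bar>X x\<bar> ^ k) \<le> norm (1 + X x ^ (2 * k))"
    by (auto simp: abs_of_nonneg intro!: always_eventually)
qed simp

text \<open>Up to a factor \<open>i\<^sup>n\<close>, equality of moments says that the \<open>n\<close>-th derivative of the difference of the two
characteristic functions vanishes at 0, while the absolute moments bound this derivative everywhere.\<close>

theorem Carleman_Hamburger:
  fixes P Q :: "real measure"
  assumes P: "real_distribution P" and Q: "real_distribution Q"
    and intP: "\<And>k. integrable P (\<lambda>x. \<bar>x\<bar> ^ k)" and intQ: "\<And>k. integrable Q (\<lambda>x. \<bar>x\<bar> ^ k)"
    and moments: "\<And>k. (\<integral>x. x ^ k \<partial>P) = (\<integral>x. x ^ k \<partial>Q)"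
    and A_def: "\<And>k. A k = (\<integral>x. \<bar>x\<bar> ^ k \<partial>P) + (\<integral>x. \<bar>x\<bar> ^ k \<partial>Q)"
    and A_pos: "\<And>k. 0 < A k"
    and div: "\<not> summable (\<lambda>k. A k / A (Suc k))"
  shows "P = Q"
proof -
  interpret P: real_distribution P by (rule P)
  interpret Q: real_distribution Q by (rule Q)
  define F where "F n x u = (\<i> * of_real u) ^ n * iexp (x * u)" for n and x u :: real
  have F_m[measurable]: "F n x \<in> borel_measurable borel" for n x unfolding F_def by measurable
  have F_norm: "cmod (F n x u) = \<bar>u\<bar> ^ n" for n x u by (simp add: F_def norm_mult norm_power)
  have F_int: "integrable P (F n x)" "integrable Q (F n x)" for n x
    by (rule Bochner_Integration.integrable_bound[OF intP[of n]], simp, simp add: F_norm,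
        rule Bochner_Integration.integrable_bound[OF intQ[of n]], simp, simp add: F_norm)
  define f where "f n x = (\<integral>u. F n x u \<partial>P) - (\<integral>u. F n x u \<partial>Q)" for n x
  have bound: "norm (f n x) \<le> A n" for n x
  proof -
    have "norm (f n x) \<le> norm (\<integral>u. F n x u \<partial>P) + norm (\<integral>u. F n x u \<partial>Q)"
      unfolding f_def by (rule norm_triangle_ineq4)
    also have "\<dots> \<le> (\<integral>u. norm (F n x u) \<partial>P) + (\<integral>u. norm (F n x u) \<partial>Q)"
      by (intro add_mono integral_norm_bound)
    finally show ?thesis by (simp add: F_norm A_def)
  qed
  have taylor: "norm (f n (x + h) - (\<Sum>i<m. (h ^ i / fact i) *\<^sub>R f (n + i) x)) \<le> A (n + m) * \<bar>h\<bar> ^ m / fact m" for n m x h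
  proof -
    define G where "G u = F n (x + h) u - (\<Sum>i<m. (h ^ i / fact i) *\<^sub>R F (n + i) x u)" for u
    have G_int: "integrable P G" "integrable Q G" 
      unfolding G_def
      by (intro Bochner_Integration.integrable_diff Bochner_Integration.integrable_sum integrable_scaleR_right F_int)+
    have iexp: "cmod (iexp y - (\<Sum>i<m. (\<i> * of_real y) ^ i / fact i)) \<le> \<bar>y\<bar> ^ m / fact m" for y
    proof (cases m)
      case (Suc k)
      then show ?thesis using iexp_approx1[of y k] by (simp add: lessThan_Suc_atMost)
    qed simp
    have G_norm: "norm (G u) \<le> \<bar>h\<bar> ^ m / fact m * \<bar>u\<bar> ^ (n + m)" for u
    proof -
      have "iexp ((x + h) * u) = iexp (x * u) * iexp (h * u)"
        by (simp add: exp_add[symmetric] algebra_simps)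
      then have "G u = (\<i> * of_real u) ^ n * iexp (x * u) * (iexp (h * u) - (\<Sum>i<m. (\<i> * of_real (h * u)) ^ i / fact i))"
        by (simp add: G_def F_def right_diff_distrib sum_distrib_left scaleR_conv_of_real power_add power_mult_distrib mult_ac)
      then have "norm (G u) = \<bar>u\<bar> ^ n * cmod (iexp (h * u) - (\<Sum>i<m. (\<i> * of_real (h * u)) ^ i / fact i))"
        by (simp add: norm_mult norm_power)
      also have "\<dots> \<le> \<bar>u\<bar> ^ n * (\<bar>h * u\<bar> ^ m / fact m)" by (intro mult_left_mono iexp) auto
      finally show ?thesis by (simp add: abs_mult power_mult_distrib power_add mult_ac)
    qed
    have "f n (x + h) - (\<Sum>i<m. (h ^ i / fact i) *\<^sub>R f (n + i) x) = (\<integral>u. G u \<partial>P) - (\<integral>u. G u \<partial>Q)"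
      using F_int by (simp add: f_def G_def scaleR_diff_right sum_subtractf)
    also have "norm \<dots> \<le> norm (\<integral>u. G u \<partial>P) + norm (\<integral>u. G u \<partial>Q)" by (rule norm_triangle_ineq4)
    also have "\<dots> \<le> (\<integral>u. norm (G u) \<partial>P) + (\<integral>u. norm (G u) \<partial>Q)" by (intro add_mono integral_norm_bound)
    also have "\<dots> \<le> (\<integral>u. \<bar>h\<bar> ^ m / fact m * \<bar>u\<bar> ^ (n + m) \<partial>P) + (\<integral>u. \<bar>h\<bar> ^ m / fact m * \<bar>u\<bar> ^ (n + m) \<partial>Q)"
      by (intro add_mono integral_mono integrable_norm G_int G_norm integrable_mult_right intP intQ)
    also have "\<dots> = A (n + m) * \<bar>h\<bar> ^ m / fact m" by (simp add: A_def algebra_simps add_divide_distrib)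
    finally show ?thesis .
  qed
  have flat: "f n 0 = 0" for n
  proof -
    have "F n 0 = (\<lambda>u. \<i> ^ n * complex_of_real (u ^ n))" by (simp add: F_def fun_eq_iff power_mult_distrib)
    then have "f n 0 = \<i> ^ n * ((\<integral>u. complex_of_real (u ^ n) \<partial>P) - (\<integral>u. complex_of_real (u ^ n) \<partial>Q))"
      unfolding f_def by (simp only: integral_mult_right_zero right_diff_distrib)
    then show ?thesis unfolding integral_complex_of_real moments by simp
  qed
  have log_convex: "(A (Suc n))\<^sup>2 \<le> A n * A (Suc (Suc n))" for n
  proof -
    have quad: "0 \<le> a\<^sup>2 * (\<integral>u. \<bar>u\<bar> ^ n \<partial>N) + 2 * a * b * (\<integral>u. \<bar>u\<bar> ^ Suc n \<partial>N) + b\<^sup>2 * (\<integral>u. \<bar>u\<bar> ^ Suc (Suc n) \<partial>N)"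
      if int: "\<And>k. integrable N (\<lambda>u. \<bar>u\<bar> ^ k)" for N :: "real measure" and a b
    proof -
      have "0 \<le> (\<integral>u. \<bar>u\<bar> ^ n * (a + b * \<bar>u\<bar>)\<^sup>2 \<partial>N)" by (rule Bochner_Integration.integral_nonneg) simp
      also have "(\<lambda>u. \<bar>u\<bar> ^ n * (a + b * \<bar>u\<bar>)\<^sup>2) = (\<lambda>u. a\<^sup>2 * \<bar>u\<bar> ^ n + 2 * a * b * \<bar>u\<bar> ^ Suc n + b\<^sup>2 * \<bar>u\<bar> ^ Suc (Suc n))"
        by (simp add: fun_eq_iff power2_eq_square algebra_simps)
      finally show ?thesis using int[of n] int[of "Suc n"] int[of "Suc (Suc n)"] by simp
    qed
    \<comment> \<open>The quadratic form evaluated where it yields the discriminant.\<close>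
    define x y where "x = A (Suc n)" and "y = - A n"
    have "0 \<le> x\<^sup>2 * (\<integral>u. \<bar>u\<bar> ^ n \<partial>P) + 2 * x * y * (\<integral>u. \<bar>u\<bar> ^ Suc n \<partial>P) + y\<^sup>2 * (\<integral>u. \<bar>u\<bar> ^ Suc (Suc n) \<partial>P)"
      by (rule quad[OF intP])
    moreover have "0 \<le> x\<^sup>2 * (\<integral>u. \<bar>u\<bar> ^ n \<partial>Q) + 2 * x * y * (\<integral>u. \<bar>u\<bar> ^ Suc n \<partial>Q) + y\<^sup>2 * (\<integral>u. \<bar>u\<bar> ^ Suc (Suc n) \<partial>Q)"
      by (rule quad[OF intQ])
    ultimately have "0 \<le> x\<^sup>2 * A n + 2 * x * y * A (Suc n) + y\<^sup>2 * A (Suc (Suc n))"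
      unfolding A_def distrib_left by linarith
    then have "0 \<le> A n * (A n * A (Suc (Suc n)) - (A (Suc n))\<^sup>2)"
      by (simp add: x_def y_def power2_eq_square algebra_simps)
    then show ?thesis using A_pos[of n] by (simp add: zero_le_mult_iff)
  qed
  have "f 0 x = 0" for x
    by (rule Denjoy_Carleman[of A f, OF A_pos log_convex bound taylor flat div])
  then have "char P = char Q" by (simp add: fun_eq_iff char_def f_def F_def)
  then show "P = Q" by (rule Levy_uniqueness[OF P Q])
qed

text \<open>The law of \<open>\<epsilon> \<surd>s\<close>, where \<open>s\<close> has law \<open>\<mu>\<close> and \<open>\<epsilon>\<close> is an independent fair sign.  Its even moments are the
moments of \<open>\<mu>\<close> and its odd moments vanish.\<close>

definition symmetric_root :: "real measure \<Rightarrow> real measure" where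
  "symmetric_root \<mu> = distr (measure_pmf (bernoulli_pmf (1/2)) \<Otimes>\<^sub>M \<mu>) borel (\<lambda>(b, s). if b then sqrt s else - sqrt s)"

lemma symmetric_root_measurable:
  assumes "sets \<mu> = sets borel_Rplus"
  shows "(\<lambda>(b, s). if b then sqrt s else - sqrt s) \<in> borel_measurable (measure_pmf (bernoulli_pmf (1/2)) \<Otimes>\<^sub>M \<mu>)"
proof -
  have [measurable]: "(\<lambda>s. s) \<in> borel_measurable \<mu>"
    unfolding measurable_cong_sets[OF assms refl] borel_Rplus_def by (intro measurable_restrict_space1) simp
  show ?thesis by measurable
qed

lemma nn_integral_symmetric_root:
  assumes \<mu>: "sets \<mu> = sets borel_Rplus" "prob_space \<mu>" and [measurable]: "f \<in> borel_measurable borel"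
  shows "(\<integral>\<^sup>+u. f u \<partial>symmetric_root \<mu>)
    = ((\<integral>\<^sup>+s. f (sqrt s) \<partial>\<mu>) + (\<integral>\<^sup>+s. f (- sqrt s) \<partial>\<mu>)) / 2"
proof -
  interpret prob_space \<mu> by (rule \<mu>(2))
  note [measurable] = symmetric_root_measurable[OF \<mu>(1)]
  have "(\<integral>\<^sup>+u. f u \<partial>symmetric_root \<mu>)
      = (\<integral>\<^sup>+p. f (case p of (b, s) \<Rightarrow> if b then sqrt s else - sqrt s) \<partial>(measure_pmf (bernoulli_pmf (1/2)) \<Otimes>\<^sub>M \<mu>))"
    unfolding symmetric_root_def by (rule nn_integral_distr) measurable
  also have "\<dots> = (\<integral>\<^sup>+b. \<integral>\<^sup>+s. f (if b then sqrt s else - sqrt s) \<partial>\<mu> \<partial>measure_pmf (bernoulli_pmf (1/2)))"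
    by (subst nn_integral_fst[symmetric]) simp_all
  also have "\<dots> = (\<integral>\<^sup>+s. f (sqrt s) \<partial>\<mu>) * ennreal (1/2) + (\<integral>\<^sup>+s. f (- sqrt s) \<partial>\<mu>) * ennreal (1/2)"
    by (subst nn_integral_bernoulli_pmf) simp_all
  also have "\<dots> = ((\<integral>\<^sup>+s. f (sqrt s) \<partial>\<mu>) + (\<integral>\<^sup>+s. f (- sqrt s) \<partial>\<mu>)) / 2"
    by (simp add: distrib_right[symmetric] divide_ennreal_def ennreal_divide_numeral[symmetric])
  finally show ?thesis .
qed

lemma real_distribution_symmetric_root:
  assumes "sets \<mu> = sets borel_Rplus" "prob_space \<mu>"
  shows "real_distribution (symmetric_root \<mu>)"
proof -
  interpret pair_prob_space "measure_pmf (bernoulli_pmf (1/2))" \<mu>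
    using assms(2) by (simp add: pair_prob_space_def pair_sigma_finite_def prob_space_measure_pmf prob_space_imp_sigma_finite)
  show ?thesis unfolding symmetric_root_def
    by (intro real_distribution_distr symmetric_root_measurable assms)
qed

lemma symmetric_root_reflect:
  assumes "sets \<mu> = sets borel_Rplus" "prob_space \<mu>"
  shows "distr (symmetric_root \<mu>) borel uminus = symmetric_root \<mu>"
proof (rule measure_eqI)
  show "sets (distr (symmetric_root \<mu>) borel uminus) = sets (symmetric_root \<mu>)" by (simp add: symmetric_root_def)
  fix A :: "real set" assume "A \<in> sets (distr (symmetric_root \<mu>) borel uminus)"
  then have [measurable]: "A \<in> sets borel" by simp
  have "emeasure (distr (symmetric_root \<mu>) borel uminus) A = (\<integral>\<^sup>+u. indicator A u \<partial>distr (symmetric_root \<mu>) borel uminus)"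
    by simp
  also have "\<dots> = (\<integral>\<^sup>+u. indicator A (- u) \<partial>symmetric_root \<mu>)"
    by (rule nn_integral_distr) (simp_all add: symmetric_root_def)
  also have "\<dots> = (\<integral>\<^sup>+u. indicator A u \<partial>symmetric_root \<mu>)"
    using assms by (simp add: nn_integral_symmetric_root add.commute)
  also have "\<dots> = emeasure (symmetric_root \<mu>) A" by (simp add: symmetric_root_def)
  finally show "emeasure (distr (symmetric_root \<mu>) borel uminus) A = emeasure (symmetric_root \<mu>) A" .
qed

text \<open>Squaring recovers the measure from its symmetrised root.\<close>

lemma symmetric_root_square:
  assumes \<mu>: "sets \<mu> = sets borel_Rplus" "prob_space \<mu>" and B: "B \<in> sets borel_Rplus"
  shows "emeasure (symmetric_root \<mu>) {u. u\<^sup>2 \<in> B} = emeasure \<mu> B"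
proof -
  have sp: "space \<mu> = {0..}" using sets_eq_imp_space_eq[OF \<mu>(1)] by (simp add: borel_Rplus_def space_restrict_space)
  have "B \<in> sets borel" using B unfolding borel_Rplus_def by (auto simp: sets_restrict_space)
  then have m: "(indicator {u. u\<^sup>2 \<in> B} :: real \<Rightarrow> ennreal) \<in> borel_measurable borel" "{u::real. u\<^sup>2 \<in> B} \<in> sets borel"
    by (auto intro!: borel_measurable_indicator measurable_sets_borel[of "\<lambda>u. u\<^sup>2" borel B, simplified vimage_def])
  have "emeasure (symmetric_root \<mu>) {u. u\<^sup>2 \<in> B} = (\<integral>\<^sup>+u. indicator {u. u\<^sup>2 \<in> B} u \<partial>symmetric_root \<mu>)"
    using m by (simp add: symmetric_root_def)
  also have "\<dots> = ((\<integral>\<^sup>+s. indicator {u. u\<^sup>2 \<in> B} (sqrt s) \<partial>\<mu>) + (\<integral>\<^sup>+s. indicator {u. u\<^sup>2 \<in> B} (- sqrt s) \<partial>\<mu>)) / 2"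
    by (rule nn_integral_symmetric_root[OF \<mu> m(1)])
  also have "(\<integral>\<^sup>+s. indicator {u. u\<^sup>2 \<in> B} (sqrt s) \<partial>\<mu>) = (\<integral>\<^sup>+s. indicator B s \<partial>\<mu>)"
    by (rule nn_integral_cong) (simp add: sp indicator_def)
  also have "(\<integral>\<^sup>+s. indicator {u. u\<^sup>2 \<in> B} (- sqrt s) \<partial>\<mu>) = (\<integral>\<^sup>+s. indicator B s \<partial>\<mu>)"
    by (rule nn_integral_cong) (simp add: sp indicator_def)
  also have "(\<integral>\<^sup>+s. indicator B s \<partial>\<mu>) = emeasure \<mu> B" using B \<mu>(1) by simp
  also have "(emeasure \<mu> B + emeasure \<mu> B) / 2 = emeasure \<mu> B"
    using ennreal_mult_divide_eq[of 2 "emeasure \<mu> B"] by (simp add: mult_2_right)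
  finally show ?thesis .
qed

lemma symmetric_root_odd_moment:
  assumes "sets \<mu> = sets borel_Rplus" "prob_space \<mu>" "odd k"
  shows "(\<integral>u. u ^ k \<partial>symmetric_root \<mu>) = 0"
proof -
  have "(\<integral>u. u ^ k \<partial>symmetric_root \<mu>) = (\<integral>u. u ^ k \<partial>distr (symmetric_root \<mu>) borel uminus)"
    by (simp add: symmetric_root_reflect assms)
  also have "\<dots> = (\<integral>u. (- u) ^ k \<partial>symmetric_root \<mu>)"
    by (rule integral_distr) (simp_all add: symmetric_root_def)
  also have "\<dots> = - (\<integral>u. u ^ k \<partial>symmetric_root \<mu>)" using assms(3) by simp
  finally show ?thesis by simp
qed

lemma symmetric_root_even_moment:
  assumes \<mu>: "sets \<mu> = sets borel_Rplus" "prob_space \<mu>"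
    and t: "(\<integral>\<^sup>+s. ennreal s ^ n \<partial>\<mu>) = ennreal t" "0 \<le> t"
  shows "integrable (symmetric_root \<mu>) (\<lambda>u. u ^ (2 * n))" "(\<integral>u. u ^ (2 * n) \<partial>symmetric_root \<mu>) = t"
proof -
  have sp: "space \<mu> = {0..}" using sets_eq_imp_space_eq[OF \<mu>(1)] by (simp add: borel_Rplus_def space_restrict_space)
  have "(\<integral>\<^sup>+s. ennreal (sqrt s ^ (2 * n)) \<partial>\<mu>) = ennreal t"
    unfolding t(1)[symmetric] by (rule nn_integral_cong) (simp add: sp power_mult ennreal_power)
  moreover have "(\<integral>\<^sup>+s. ennreal ((- sqrt s) ^ (2 * n)) \<partial>\<mu>) = ennreal t"
    unfolding t(1)[symmetric] by (rule nn_integral_cong) (simp add: sp power_mult ennreal_power)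
  moreover have "(\<integral>\<^sup>+u. ennreal (u ^ (2 * n)) \<partial>symmetric_root \<mu>)
      = ((\<integral>\<^sup>+s. ennreal (sqrt s ^ (2 * n)) \<partial>\<mu>) + (\<integral>\<^sup>+s. ennreal ((- sqrt s) ^ (2 * n)) \<partial>\<mu>)) / 2"
    by (rule nn_integral_symmetric_root[OF \<mu>]) simp
  ultimately have "(\<integral>\<^sup>+u. ennreal (u ^ (2 * n)) \<partial>symmetric_root \<mu>) = ennreal t"
    using ennreal_mult_divide_eq[of 2 "ennreal t"] by (simp add: mult_2_right)
  then have "has_bochner_integral (symmetric_root \<mu>) (\<lambda>u. u ^ (2 * n)) t"
    by (intro has_bochner_integral_nn_integral) (simp_all add: t symmetric_root_def)
  then show "integrable (symmetric_root \<mu>) (\<lambda>u. u ^ (2 * n))" "(\<integral>u. u ^ (2 * n) \<partial>symmetric_root \<mu>) = t"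
    by (simp_all add: has_bochner_integral_iff)
qed

lemma Carleman_Stieltjes_normalized:
  assumes \<mu>: "prob_space \<mu>" "stieltjes_representing \<mu> t" and \<nu>: "prob_space \<nu>" "stieltjes_representing \<nu> t"
    and t: "\<And>n. 0 < t n" and C: "0 < C"
    and div: "\<not> summable (\<lambda>n. (C / t n) powr (1 / (2 * real (n + 1))))"
  shows "\<mu> = \<nu>"
proof -
  have sets: "sets \<mu> = sets borel_Rplus" "sets \<nu> = sets borel_Rplus"
    and mom: "\<And>n. (\<integral>\<^sup>+s. ennreal s ^ n \<partial>\<mu>) = ennreal (t n)" "\<And>n. (\<integral>\<^sup>+s. ennreal s ^ n \<partial>\<nu>) = ennreal (t n)"
    using \<mu>(2) \<nu>(2) by (auto simp: stieltjes_representing_def)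
  let ?P = "symmetric_root \<mu>" and ?Q = "symmetric_root \<nu>"
  interpret P: real_distribution ?P by (rule real_distribution_symmetric_root[OF sets(1) \<mu>(1)])
  interpret Q: real_distribution ?Q by (rule real_distribution_symmetric_root[OF sets(2) \<nu>(1)])
  note evenP = symmetric_root_even_moment[OF sets(1) \<mu>(1) mom(1) less_imp_le[OF t]]
  note evenQ = symmetric_root_even_moment[OF sets(2) \<nu>(1) mom(2) less_imp_le[OF t]]
  have intP: "integrable ?P (\<lambda>u. \<bar>u\<bar> ^ k)" for k by (rule P.abs_power_integrable) (simp_all add: evenP)
  have intQ: "integrable ?Q (\<lambda>u. \<bar>u\<bar> ^ k)" for k by (rule Q.abs_power_integrable) (simp_all add: evenQ)
  define A where "A k = (\<integral>u. \<bar>u\<bar> ^ k \<partial>?P) + (\<integral>u. \<bar>u\<bar> ^ k \<partial>?Q)" for k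
  have A_even: "A (2 * n) = 2 * t n" for n
    using evenP(2)[of n] evenQ(2)[of n] by (simp add: A_def power_even_abs)
  have A_pos: "0 < A k" for k
  proof (cases "even k")
    case True
    then show ?thesis using A_even t by (auto elim!: evenE)
  next
    case False
    have nonneg: "0 \<le> (\<integral>u. \<bar>u\<bar> ^ k \<partial>?P)" "0 \<le> (\<integral>u. \<bar>u\<bar> ^ k \<partial>?Q)" by simp_all
    have "(\<integral>u. \<bar>u\<bar> ^ k \<partial>?P) \<noteq> 0"
    proof
      assume "(\<integral>u. \<bar>u\<bar> ^ k \<partial>?P) = 0"
      then have "AE u in ?P. \<bar>u\<bar> ^ k = 0" using integral_nonneg_eq_0_iff_AE[OF intP[of k]] by simp
      then have "AE u in ?P. u ^ (2 * 1) = 0" by eventually_elim simp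
      then have "(\<integral>u. u ^ (2 * 1) \<partial>?P) = 0" by (rule integral_eq_zero_AE)
      then show False using evenP(2)[of 1] t[of 1] by simp
    qed
    then show ?thesis using nonneg unfolding A_def by linarith
  qed
  have "?P = ?Q"
  proof (rule Carleman_Hamburger[OF P.real_distribution_axioms Q.real_distribution_axioms intP intQ _ A_def A_pos])
    fix k
    show "(\<integral>u. u ^ k \<partial>?P) = (\<integral>u. u ^ k \<partial>?Q)"
    proof (cases "even k")
      case True
      then show ?thesis using evenP(2) evenQ(2) by (auto elim!: evenE)
    next
      case False
      then show ?thesis using symmetric_root_odd_moment sets \<mu>(1) \<nu>(1) by simp
    qed
  next
    show "\<not> summable (\<lambda>k. A k / A (Suc k))"
    proof
      assume "summable (\<lambda>k. A k / A (Suc k))"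
      from carleman_ratio_summable[of A, OF A_pos this, of "2 * C"]
      show False using C div by (simp add: A_even)
    qed
  qed
  then show ?thesis
    using symmetric_root_square[OF sets(1) \<mu>(1)] symmetric_root_square[OF sets(2) \<nu>(1)] sets
    by (intro measure_eqI) simp_all
qed

text \<open>Carleman's criterion.  The exponent belongs to index \<open>n + 1\<close> although the moment has index \<open>n\<close>; the
criterion is insensitive to such shifts.\<close>

theorem Carleman_Stieltjes:
  assumes \<mu>: "stieltjes_representing \<mu> t" and \<nu>: "stieltjes_representing \<nu> t"
    and t: "\<And>n. 0 < t n"
    and div: "\<not> summable (\<lambda>n. t n powr (- 1 / (2 * real (n + 1))))"
  shows "\<mu> = \<nu>"
proof -
  have prob: "prob_space (scale_measure (ennreal (1 / t 0)) \<rho>)" if "stieltjes_representing \<rho> t" for \<rho>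
  proof (rule prob_spaceI)
    have "emeasure \<rho> (space \<rho>) = (\<integral>\<^sup>+s. ennreal s ^ 0 \<partial>\<rho>)" by simp
    also have "\<dots> = ennreal (t 0)" using that unfolding stieltjes_representing_def by blast
    finally show "emeasure (scale_measure (ennreal (1 / t 0)) \<rho>) (space (scale_measure (ennreal (1 / t 0)) \<rho>)) = 1"
      using t[of 0] by (simp add: space_scale_measure ennreal_mult[symmetric])
  qed
  have "scale_measure (ennreal (1 / t 0)) \<mu> = scale_measure (ennreal (1 / t 0)) \<nu>"
  proof (rule Carleman_Stieltjes_normalized[where C = "1 / t 0"])
    show "\<not> summable (\<lambda>n. (1 / t 0 / (1 / t 0 * t n)) powr (1 / (2 * real (n + 1))))"
    proof -
      have "(1 / t 0 / (1 / t 0 * t n)) powr (1 / (2 * real (n + 1))) = t n powr (- 1 / (2 * real (n + 1)))" for n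
        using t[of 0] t[of n] by (simp add: powr_divide powr_minus_divide)
      then show ?thesis using div by simp
    qed
    show "stieltjes_representing (scale_measure (ennreal (1 / t 0)) \<mu>) (\<lambda>n. 1 / t 0 * t n)"
      by (rule stieltjes_representing_scale[OF \<mu>]) (use less_imp_le[OF t] in simp_all)
    show "stieltjes_representing (scale_measure (ennreal (1 / t 0)) \<nu>) (\<lambda>n. 1 / t 0 * t n)"
      by (rule stieltjes_representing_scale[OF \<nu>]) (use less_imp_le[OF t] in simp_all)
  qed (use \<mu> \<nu> t prob in simp_all)
  then have "scale_measure (ennreal (t 0)) (scale_measure (ennreal (1 / t 0)) \<mu>)
      = scale_measure (ennreal (t 0)) (scale_measure (ennreal (1 / t 0)) \<nu>)" by simp
  then show ?thesis using t[of 0] by (simp add: ennreal_mult[symmetric] scale_scale_measure)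
qed

section \<open>Moment sequences of subnormal operators\<close>

lemma sum_sum_inner_nonneg:
  fixes y :: "nat \<Rightarrow> 'a::real_inner"
  shows "0 \<le> (\<Sum>i\<le>n. \<Sum>j\<le>n. a i * a j * inner (y i) (y j))"
proof -
  have "(\<Sum>i\<le>n. \<Sum>j\<le>n. a i * a j * inner (y i) (y j)) = inner (\<Sum>i\<le>n. a i *\<^sub>R y i) (\<Sum>j\<le>n. a j *\<^sub>R y j)"
    by (simp add: inner_sum_left inner_sum_right sum_distrib_left) (subst sum.swap, simp add: mult_ac)
  then show ?thesis by simp
qed

text \<open>The embedding carries the orbit in \<open>ell2 X\<close> to an orbit of the normal extension with the same norms.\<close>

theorem subnormal_stieltjes:
  fixes S :: "(('v \<Rightarrow> complex) \<times> ('v \<Rightarrow> complex)) set"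
  assumes S: "subnormal TYPE('k::complex_hilbert_space) X S"
    and s: "\<And>n. s n \<in> ell2 X" "\<And>n. (s n, s (Suc n)) \<in> S"
    and pos: "0 < ell2_norm X (s 0)"
  shows "stieltjes_moment_seq (\<lambda>n. (ell2_norm X (s n))\<^sup>2)"
proof -
  obtain U :: "('v \<Rightarrow> complex) \<Rightarrow> 'k" and N where U: "isometric_embedding X U" and N: "normal_op N"
    and SN: "\<forall>(f, g) \<in> S. (U f, U g) \<in> N"
    using S unfolding subnormal_def by blast
  have nrm: "norm (U (s n)) = ell2_norm X (s n)" for n
    using U s(1) unfolding isometric_embedding_def by blast
  have "(U (s n), U (s (Suc n))) \<in> N" for n using SN s(2) by blast
  then obtain y z :: "nat \<Rightarrow> 'k" where yz: "\<And>i j. inner (y i) (y j) = (norm (U (s (i + j))))\<^sup>2"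
    "\<And>i j. inner (z i) (z j) = (norm (U (s (i + j + 1))))\<^sup>2"
    by (rule normal_op_chain_Hankel[OF N, of "\<lambda>n. U (s n)"]) blast
  show ?thesis
  proof (rule stieltjes_moment_theorem)
    show "0 \<le> (\<Sum>i\<le>n. \<Sum>j\<le>n. a i * a j * (ell2_norm X (s (i + j)))\<^sup>2)" for n a
      using sum_sum_inner_nonneg[where n = n and a = a and y = y] by (simp add: yz nrm)
    show "0 \<le> (\<Sum>i\<le>n. \<Sum>j\<le>n. a i * a j * (ell2_norm X (s (i + j + 1)))\<^sup>2)" for n a
      using sum_sum_inner_nonneg[where n = n and a = a and y = z] by (simp add: yz nrm)
  qed (use pos in simp)
qed

section \<open>Powers of the weighted shift\<close>

lemma ell2_norm_sq: "(ell2_norm X f)\<^sup>2 = (\<Sum>\<^sub>\<infinity>v\<in>X. (cmod (f v))\<^sup>2)"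
  unfolding ell2_norm_def by (simp add: infsum_nonneg)

lemma ell2_scale: "f \<in> ell2 X \<Longrightarrow> (\<lambda>v. c * f v) \<in> ell2 X"
  unfolding ell2_def by (auto simp: norm_mult power_mult_distrib intro: summable_on_cmult_right)

lemma ell2_norm_scale: "(ell2_norm X (\<lambda>v. c * f v))\<^sup>2 = (cmod c)\<^sup>2 * (ell2_norm X f)\<^sup>2"
  unfolding ell2_norm_sq by (simp add: norm_mult power_mult_distrib infsum_cmult_right')

lemma basis_fun_has_sum: "u \<in> X \<Longrightarrow> ((\<lambda>v. (cmod (basis_fun u v))\<^sup>2) has_sum 1) X"
  by (rule has_sum_finite_neutralI[of "{u}"]) (auto simp: basis_fun_def)

lemma basis_fun_ell2: "u \<in> X \<Longrightarrow> basis_fun u \<in> ell2 X"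
  unfolding ell2_def using has_sum_imp_summable[OF basis_fun_has_sum] by (auto simp: basis_fun_def)

lemma ell2_norm_basis_fun: "u \<in> X \<Longrightarrow> (ell2_norm X (basis_fun u))\<^sup>2 = 1"
  unfolding ell2_norm_sq by (rule infsumI[OF basis_fun_has_sum])

lemma Trunk_nonroot_iff: "Trunk k \<in> verts_nonroot \<eta> \<kappa> \<longleftrightarrow> Suc k \<in> J \<kappa>"
  by (cases \<kappa>) (auto simp: verts_nonroot_def verts_def J_def zero_enat_def[symmetric] less_eq_Suc_le)

lemma Branch_nonroot_iff: "Branch i j \<in> verts_nonroot \<eta> \<kappa> \<longleftrightarrow> i \<in> J \<eta> \<and> 1 \<le> j"
  by (cases \<kappa>) (auto simp: verts_nonroot_def verts_def)

lemma par_Trunk: "Suc k \<in> J \<kappa> \<Longrightarrow> par \<eta> \<kappa> (Trunk k) = Trunk (Suc k)"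
  unfolding par_def by (rule the_equality) (auto simp: edges_def J_def)

lemma par_Branch: "i \<in> J \<eta> \<Longrightarrow> 1 \<le> j \<Longrightarrow> par \<eta> \<kappa> (Branch i j) = (if j = 1 then Trunk 0 else Branch i (j - 1))"
  unfolding par_def by (rule the_equality) (auto simp: edges_def split: if_splits intro: exI[of _ "j - 1"])

lemma shift_map_Trunk:
  "shift_map \<eta> \<kappa> w f (Trunk k) = (if Suc k \<in> J \<kappa> then w (Trunk k) * f (Trunk (Suc k)) else 0)"
  by (simp add: shift_map_def Trunk_nonroot_iff par_Trunk)

text \<open>Together with \<open>shift_map_Trunk\<close> this makes the parent function explicit.\<close>

lemma shift_map_Branch:
  "shift_map \<eta> \<kappa> w f (Branch i j) =
    (if i \<in> J \<eta> \<and> 1 \<le> j then w (Branch i j) * f (if j = 1 then Trunk 0 else Branch i (j - 1)) else 0)"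
  by (simp add: shift_map_def Branch_nonroot_iff par_Branch)

lemma shift_map_scale: "shift_map \<eta> \<kappa> w (\<lambda>v. c * f v) = (\<lambda>v. c * shift_map \<eta> \<kappa> w f v)"
  by (simp add: shift_map_def fun_eq_iff)

lemma shift_map_iter_scale:
  "(shift_map \<eta> \<kappa> w ^^ n) (\<lambda>v. c * f v) = (\<lambda>v. c * (shift_map \<eta> \<kappa> w ^^ n) f v)"
  by (induction n) (simp_all add: shift_map_scale)

text \<open>A vector of \<open>smooth_domain\<close> has its whole orbit in \<open>ell2\<close>.  In this form the property passes from
\<open>e\<^sub>0\<close> to the other basis vectors by computing their orbits.\<close>

definition smooth_vector where
  "smooth_vector \<eta> \<kappa> w f \<longleftrightarrow> (\<forall>n. (shift_map \<eta> \<kappa> w ^^ n) f \<in> ell2 (verts \<eta> \<kappa>))"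

lemma smooth_domain_imp_smooth_vector:
  assumes "f \<in> smooth_domain (weighted_shift \<eta> \<kappa> w)"
  shows "smooth_vector \<eta> \<kappa> w f"
  unfolding smooth_vector_def
proof
  fix n
  have iter: "(f, g) \<in> weighted_shift \<eta> \<kappa> w ^^ m \<Longrightarrow> g = (shift_map \<eta> \<kappa> w ^^ m) f" for m g
    by (induction m arbitrary: g) (auto simp: weighted_shift_def)
  obtain g where "(f, g) \<in> weighted_shift \<eta> \<kappa> w ^^ Suc n"
    using assms unfolding smooth_domain_def by blast
  then obtain h where h: "(f, h) \<in> weighted_shift \<eta> \<kappa> w ^^ n" "(h, g) \<in> weighted_shift \<eta> \<kappa> w" by auto
  then have "h \<in> ell2 (verts \<eta> \<kappa>)" by (auto simp: weighted_shift_def)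
  then show "(shift_map \<eta> \<kappa> w ^^ n) f \<in> ell2 (verts \<eta> \<kappa>)" using iter[OF h(1)] by simp
qed

lemma subnormal_shift_stieltjes:
  assumes "subnormal TYPE('k::complex_hilbert_space) (verts \<eta> \<kappa>) (weighted_shift \<eta> \<kappa> w)"
    and f: "smooth_vector \<eta> \<kappa> w f" and "0 < (ell2_norm (verts \<eta> \<kappa>) f)\<^sup>2"
  shows "stieltjes_moment_seq (\<lambda>n. (ell2_norm (verts \<eta> \<kappa>) ((shift_map \<eta> \<kappa> w ^^ n) f))\<^sup>2)"
proof (rule subnormal_stieltjes[OF assms(1)])
  have "0 \<le> ell2_norm (verts \<eta> \<kappa>) f" by (simp add: ell2_norm_def infsum_nonneg)
  then show "0 < ell2_norm (verts \<eta> \<kappa>) ((shift_map \<eta> \<kappa> w ^^ 0) f)" using assms(3) by (simp add: less_le)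
  show "((shift_map \<eta> \<kappa> w ^^ n) f, (shift_map \<eta> \<kappa> w ^^ Suc n) f) \<in> weighted_shift \<eta> \<kappa> w" for n
    using f[unfolded smooth_vector_def, rule_format, of n] f[unfolded smooth_vector_def, rule_format, of "Suc n"]
    by (auto simp: weighted_shift_def)
qed (use f in \<open>simp add: smooth_vector_def\<close>)

lemma shift_iter_Branch:
  assumes "i \<in> J \<eta>"
  shows "(shift_map \<eta> \<kappa> w ^^ n) (basis_fun (Branch i 1))
    = (\<lambda>v. (\<Prod>j=2..n+1. w (Branch i j)) * basis_fun (Branch i (n + 1)) v)"
proof (induction n)
  case 0
  then show ?case by simp
next
  case (Suc n)
  have "shift_map \<eta> \<kappa> w (basis_fun (Branch i (n + 1))) v = w (Branch i (n + 2)) * basis_fun (Branch i (n + 2)) v" for v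
    by (cases v) (use assms in \<open>auto simp: shift_map_Trunk shift_map_Branch basis_fun_def\<close>)
  then show ?case unfolding funpow.simps(2) comp_apply Suc shift_map_scale by (simp add: fun_eq_iff mult_ac)
qed

lemma shift_Trunk:
  assumes "Suc k \<in> J \<kappa>"
  shows "shift_map \<eta> \<kappa> w (basis_fun (Trunk (Suc k))) = (\<lambda>v. w (Trunk k) * basis_fun (Trunk k) v)"
proof
  fix v
  show "shift_map \<eta> \<kappa> w (basis_fun (Trunk (Suc k))) v = w (Trunk k) * basis_fun (Trunk k) v"
    by (cases v) (use assms in \<open>auto simp: shift_map_Trunk shift_map_Branch basis_fun_def\<close>)
qed

lemma shift_iter_Trunk:
  assumes "k = 0 \<or> k \<in> J \<kappa>" "n \<le> k"
  shows "(shift_map \<eta> \<kappa> w ^^ n) (basis_fun (Trunk k))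
    = (\<lambda>v. (\<Prod>j\<in>{k - n..<k}. w (Trunk j)) * basis_fun (Trunk (k - n)) v)"
  using assms(2)
proof (induction n)
  case (Suc n)
  define m where "m = k - Suc n"
  have m: "k - n = Suc m" "Suc m \<le> k" using Suc.prems by (auto simp: m_def)
  then have "Suc m \<in> J \<kappa>" using assms(1) by (auto simp: J_def elim: order_trans[rotated])
  moreover have "(\<Prod>j\<in>{m..<k}. w (Trunk j)) = w (Trunk m) * (\<Prod>j\<in>{Suc m..<k}. w (Trunk j))"
    using m(2) by (intro prod.atLeast_Suc_lessThan) simp
  moreover have "(shift_map \<eta> \<kappa> w ^^ n) (basis_fun (Trunk k))
      = (\<lambda>v. (\<Prod>j\<in>{Suc m..<k}. w (Trunk j)) * basis_fun (Trunk (Suc m)) v)"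
    using Suc m(1) by simp
  ultimately show ?case
    unfolding funpow.simps(2) comp_apply m_def[symmetric] by (simp only: shift_map_scale shift_Trunk) (simp add: mult_ac)
qed simp

lemma shift_iter_branching_vertex:
  "(shift_map \<eta> \<kappa> w ^^ Suc n) (basis_fun (Trunk 0))
    = (\<lambda>v. case v of Trunk k \<Rightarrow> 0 | Branch i j \<Rightarrow> if i \<in> J \<eta> \<and> j = Suc n then \<Prod>j=1..Suc n. w (Branch i j) else 0)"
proof (induction n)
  case 0
  show ?case
  proof
    fix v show "(shift_map \<eta> \<kappa> w ^^ Suc 0) (basis_fun (Trunk 0)) v = (case v of Trunk k \<Rightarrow> 0
      | Branch i j \<Rightarrow> if i \<in> J \<eta> \<and> j = Suc 0 then \<Prod>j=1..Suc 0. w (Branch i j) else 0)"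
      by (cases v) (auto simp: shift_map_Trunk shift_map_Branch basis_fun_def)
  qed
next
  case (Suc n)
  show ?case
    unfolding funpow.simps(2)[of "Suc n"] comp_apply Suc
    by (rule ext, split vertex.split) (auto simp: shift_map_Trunk shift_map_Branch prod.cl_ivl_Suc)
qed

text \<open>The functions \<open>S\<^sup>n e\<^sub>0\<close> with \<open>n \<ge> 1\<close> live on the vertices \<open>(i, n)\<close>, so that their norms are sums
over \<open>i\<close>.\<close>

lemma ell2_front:
  assumes "(\<lambda>v. case v of Trunk k \<Rightarrow> 0 | Branch i j \<Rightarrow> if i \<in> J \<eta> \<and> j = Suc n then c i else 0) \<in> ell2 (verts \<eta> \<kappa>)"
    (is "?f \<in> _")
  shows "(\<lambda>i. (cmod (c i))\<^sup>2) summable_on J \<eta>"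
    and "(ell2_norm (verts \<eta> \<kappa>) ?f)\<^sup>2 = (\<Sum>\<^sub>\<infinity>i\<in>J \<eta>. (cmod (c i))\<^sup>2)"
proof -
  let ?B = "(\<lambda>i. Branch i (Suc n)) ` J \<eta>"
  have inj: "inj_on (\<lambda>i. Branch i (Suc n)) (J \<eta>)" by (auto simp: inj_on_def)
  have sub: "?B \<subseteq> verts \<eta> \<kappa>" by (auto simp: verts_def)
  have out: "(cmod (?f v))\<^sup>2 = 0" if "v \<notin> ?B" for v using that by (cases v) auto
  have comp: "((\<lambda>v. (cmod (?f v))\<^sup>2) \<circ> (\<lambda>i. Branch i (Suc n))) i = (cmod (c i))\<^sup>2" if "i \<in> J \<eta>" for i using that by simp
  have "(\<lambda>v. (cmod (?f v))\<^sup>2) summable_on verts \<eta> \<kappa>" using assms by (simp add: ell2_def)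
  then have "(\<lambda>v. (cmod (?f v))\<^sup>2) summable_on ?B" using sub by (rule summable_on_subset_banach)
  then show "(\<lambda>i. (cmod (c i))\<^sup>2) summable_on J \<eta>"
    unfolding summable_on_reindex[OF inj] by (rule summable_on_cong[THEN iffD1, rotated]) (rule comp)
  have "(ell2_norm (verts \<eta> \<kappa>) ?f)\<^sup>2 = (\<Sum>\<^sub>\<infinity>v\<in>?B. (cmod (?f v))\<^sup>2)"
    unfolding ell2_norm_sq by (rule infsum_cong_neutral) (use sub out in auto)
  also have "\<dots> = (\<Sum>\<^sub>\<infinity>i\<in>J \<eta>. (cmod (c i))\<^sup>2)"
    unfolding infsum_reindex[OF inj] by (rule infsum_cong) (rule comp)
  finally show "(ell2_norm (verts \<eta> \<kappa>) ?f)\<^sup>2 = (\<Sum>\<^sub>\<infinity>i\<in>J \<eta>. (cmod (c i))\<^sup>2)" .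
qed

lemma smooth_branching_vertex:
  assumes "smooth_vector \<eta> \<kappa> w (basis_fun (Trunk 0))"
  shows "(\<lambda>i. (cmod (\<Prod>j=1..Suc n. w (Branch i j)))\<^sup>2) summable_on J \<eta>"
    and "(ell2_norm (verts \<eta> \<kappa>) ((shift_map \<eta> \<kappa> w ^^ Suc n) (basis_fun (Trunk 0))))\<^sup>2 = branch_sum \<eta> w (Suc n)"
proof -
  have "(shift_map \<eta> \<kappa> w ^^ Suc n) (basis_fun (Trunk 0)) \<in> ell2 (verts \<eta> \<kappa>)"
    using assms unfolding smooth_vector_def by blast
  note e = this[unfolded shift_iter_branching_vertex]
  show "(\<lambda>i. (cmod (\<Prod>j=1..Suc n. w (Branch i j)))\<^sup>2) summable_on J \<eta>" by (rule ell2_front(1)[OF e])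
  show "(ell2_norm (verts \<eta> \<kappa>) ((shift_map \<eta> \<kappa> w ^^ Suc n) (basis_fun (Trunk 0))))\<^sup>2 = branch_sum \<eta> w (Suc n)"
    unfolding shift_iter_branching_vertex branch_sum_def by (rule ell2_front(2)[OF e])
qed

lemma smooth_Branch:
  assumes "i \<in> J \<eta>"
  shows "smooth_vector \<eta> \<kappa> w (basis_fun (Branch i 1))"
  unfolding smooth_vector_def shift_iter_Branch[OF assms]
  by (intro allI ell2_scale basis_fun_ell2) (use assms in \<open>auto simp: verts_def\<close>)

text \<open>A vertex \<open>-k\<close> reaches 0 after \<open>k\<close> steps, so its orbit inherits square summability from that of \<open>e\<^sub>0\<close>.\<close>

lemma smooth_Trunk:
  assumes "smooth_vector \<eta> \<kappa> w (basis_fun (Trunk 0))" "k = 0 \<or> k \<in> J \<kappa>"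
  shows "smooth_vector \<eta> \<kappa> w (basis_fun (Trunk k))"
  using assms(2)
proof (induction k)
  case (Suc k)
  then have Jk: "Suc k \<in> J \<kappa>" by simp
  then have "k = 0 \<or> k \<in> J \<kappa>" by (cases \<kappa>) (auto simp: J_def)
  then have IH: "smooth_vector \<eta> \<kappa> w (basis_fun (Trunk k))" by (rule Suc.IH)
  show ?case
    unfolding smooth_vector_def
  proof
    fix n
    show "(shift_map \<eta> \<kappa> w ^^ n) (basis_fun (Trunk (Suc k))) \<in> ell2 (verts \<eta> \<kappa>)"
    proof (cases n)
      case 0
      then show ?thesis using Jk by (auto simp: verts_def intro!: basis_fun_ell2)
    next
      case (Suc m)
      then show ?thesis using IH Jk
        by (auto simp: funpow_Suc_right shift_Trunk shift_map_iter_scale smooth_vector_def simp del: funpow.simps intro!: ell2_scale)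
    qed
  qed
qed (use assms(1) in simp)

definition trunk_moment where
  "trunk_moment \<eta> \<kappa> w k n = (ell2_norm (verts \<eta> \<kappa>) ((shift_map \<eta> \<kappa> w ^^ n) (basis_fun (Trunk k))))\<^sup>2"

lemma trunk_moment_initial:
  assumes "k = 0 \<or> k \<in> J \<kappa>" "n \<le> k"
  shows "trunk_moment \<eta> \<kappa> w k n = (cmod (\<Prod>j\<in>{k - n..<k}. w (Trunk j)))\<^sup>2"
proof -
  have "k - n = 0 \<or> k - n \<in> J \<kappa>" using assms by (cases \<kappa>) (auto simp: J_def)
  then have "Trunk (k - n) \<in> verts \<eta> \<kappa>" by (auto simp: verts_def)
  then show ?thesis
    unfolding trunk_moment_def shift_iter_Trunk[OF assms] ell2_norm_scale by (simp add: ell2_norm_basis_fun)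
qed

lemma trunk_moment_Suc:
  assumes "Suc k \<in> J \<kappa>"
  shows "trunk_moment \<eta> \<kappa> w (Suc k) (Suc n) = (cmod (w (Trunk k)))\<^sup>2 * trunk_moment \<eta> \<kappa> w k n"
  using assms by (simp add: trunk_moment_def funpow_Suc_right shift_Trunk shift_map_iter_scale ell2_norm_scale del: funpow.simps)

lemma trunk_moment_tail:
  assumes "smooth_vector \<eta> \<kappa> w (basis_fun (Trunk 0))" "k = 0 \<or> k \<in> J \<kappa>"
  shows "trunk_moment \<eta> \<kappa> w k (n + (k + 1)) = (cmod (\<Prod>j<k. w (Trunk j)))\<^sup>2 * branch_sum \<eta> w (n + 1)"
  using assms(2)
proof (induction k)
  case 0
  then show ?case using smooth_branching_vertex(2)[OF assms(1)] by (simp add: trunk_moment_def del: funpow.simps)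
next
  case (Suc k)
  then have Jk: "Suc k \<in> J \<kappa>" by simp
  then have "k = 0 \<or> k \<in> J \<kappa>" by (cases \<kappa>) (auto simp: J_def)
  from Suc.IH[OF this] show ?case
    by (simp add: trunk_moment_Suc[OF Jk] norm_mult power_mult_distrib mult_ac)
qed

section \<open>Mixtures of measures and power weights\<close>

lemma infsum_nat_eq_nn_integral:
  fixes f :: "nat \<Rightarrow> ennreal"
  shows "(\<Sum>\<^sub>\<infinity>i\<in>A. f i) = (\<integral>\<^sup>+i. f i \<partial>count_space A)"
proof -
  define g where "g i = f i * indicator A i" for i
  have "(\<Sum>\<^sub>\<infinity>i\<in>A. f i) = (\<Sum>\<^sub>\<infinity>i\<in>UNIV. g i)"
    by (rule infsum_cong_neutral) (auto simp: g_def)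
  also have "\<dots> = (\<Sum>i. g i)"
  proof (rule antisym)
    show "(\<Sum>\<^sub>\<infinity>i\<in>UNIV. g i) \<le> (\<Sum>i. g i)"
      unfolding nonneg_infsum_complete[OF zero_le] by (rule SUP_least) (auto intro!: sum_le_suminf)
    show "(\<Sum>i. g i) \<le> (\<Sum>\<^sub>\<infinity>i\<in>UNIV. g i)"
      unfolding nonneg_infsum_complete[OF zero_le] suminf_eq_SUP by (rule SUP_mono) auto
  qed
  also have "\<dots> = (\<integral>\<^sup>+i. g i \<partial>count_space UNIV)" by (simp add: nn_integral_count_space_nat)
  also have "\<dots> = (\<integral>\<^sup>+i. f i \<partial>count_space A)"
    by (simp add: g_def nn_integral_count_space_indicator[symmetric])
  finally show ?thesis .
qed

lemma ennreal_infsum: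
  assumes "\<And>i. i \<in> A \<Longrightarrow> 0 \<le> f i" "f summable_on A"
  shows "(\<Sum>\<^sub>\<infinity>i\<in>A. ennreal (f i)) = ennreal (\<Sum>\<^sub>\<infinity>i\<in>A. f i)"
proof -
  have "(\<Sum>\<^sub>\<infinity>i\<in>A. ennreal (f i)) = (SUP F\<in>{F. finite F \<and> F \<subseteq> A}. \<Sum>i\<in>F. ennreal (f i))"
    by (rule nonneg_infsum_complete) simp
  also have "\<dots> = (SUP F\<in>{F. finite F \<and> F \<subseteq> A}. ennreal (sum f F))"
    by (rule SUP_cong[OF refl]) (use assms(1) in \<open>auto intro!: sum_ennreal\<close>)
  also have "\<dots> = ennreal (\<Sum>\<^sub>\<infinity>i\<in>A. f i)"
    by (rule infsum_nonneg_is_SUPREMUM_ennreal[OF assms(2,1), symmetric])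
  finally show ?thesis .
qed

text \<open>The measure \<open>\<Sum>\<^sub>i\<^sub>\<in>\<^sub>A c\<^sub>i \<mu>\<^sub>i\<close>, written as a composition of kernels in order to have its integrals and
countable additivity at hand.  Indices outside \<open>A\<close> carry weight 0; the Dirac measure merely makes the
kernel one of probability measures everywhere.\<close>

definition mixture :: "nat set \<Rightarrow> (nat \<Rightarrow> real) \<Rightarrow> (nat \<Rightarrow> real measure) \<Rightarrow> real measure" where
  "mixture A c \<mu> = density (count_space UNIV) (\<lambda>i. ennreal (c i) * indicator A i)
     \<bind> (\<lambda>i. if i \<in> A then \<mu> i else return borel_Rplus 0)"

lemma
  assumes "\<And>i. i \<in> A \<Longrightarrow> prob_Rplus (\<mu> i)"
  shows sets_mixture: "sets (mixture A c \<mu>) = sets borel_Rplus"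
    and nn_integral_mixture: "f \<in> borel_measurable borel_Rplus \<Longrightarrow>
      (\<integral>\<^sup>+s. f s \<partial>mixture A c \<mu>) = (\<Sum>\<^sub>\<infinity>i\<in>A. ennreal (c i) * (\<integral>\<^sup>+s. f s \<partial>\<mu> i))"
proof -
  let ?M = "density (count_space UNIV) (\<lambda>i. ennreal (c i) * indicator A i)"
  let ?K = "\<lambda>i. if i \<in> A then \<mu> i else return borel_Rplus 0"
  have K: "?K i \<in> space (subprob_algebra borel_Rplus)" for i
    using assms[of i] prob_space_return[of 0 borel_Rplus]
    by (auto simp: space_subprob_algebra prob_Rplus_def prob_space_imp_subprob_space space_borel_Rplus)
  then have Km: "?K \<in> measurable ?M (subprob_algebra borel_Rplus)" by simp
  show "sets (mixture A c \<mu>) = sets borel_Rplus"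
    unfolding mixture_def using K by (intro sets_bind) (auto simp: space_subprob_algebra)
  assume f: "f \<in> borel_measurable borel_Rplus"
  have "(\<integral>\<^sup>+s. f s \<partial>mixture A c \<mu>) = (\<integral>\<^sup>+i. \<integral>\<^sup>+s. f s \<partial>?K i \<partial>?M)"
    unfolding mixture_def by (rule nn_integral_bind[OF f Km])
  also have "\<dots> = (\<integral>\<^sup>+i. ennreal (c i) * indicator A i * (\<integral>\<^sup>+s. f s \<partial>?K i) \<partial>count_space UNIV)"
    by (rule nn_integral_density) simp_all
  also have "\<dots> = (\<integral>\<^sup>+i. ennreal (c i) * (\<integral>\<^sup>+s. f s \<partial>\<mu> i) * indicator A i \<partial>count_space UNIV)"
    by (rule nn_integral_cong) (simp add: indicator_def)
  also have "\<dots> = (\<Sum>\<^sub>\<infinity>i\<in>A. ennreal (c i) * (\<integral>\<^sup>+s. f s \<partial>\<mu> i))"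
    by (simp add: infsum_nat_eq_nn_integral nn_integral_count_space_indicator[symmetric])
  finally show "(\<integral>\<^sup>+s. f s \<partial>mixture A c \<mu>) = (\<Sum>\<^sub>\<infinity>i\<in>A. ennreal (c i) * (\<integral>\<^sup>+s. f s \<partial>\<mu> i))" .
qed

lemma stieltjes_representing_density:
  assumes \<rho>: "stieltjes_representing \<rho> t" and c: "0 < c" and shift: "\<And>n. t (n + m) = c * t' n" and t': "\<And>n. 0 \<le> t' n"
  shows "stieltjes_representing (density \<rho> (\<lambda>s. ennreal (1 / c) * ennreal s ^ m)) t'"
  unfolding stieltjes_representing_def
proof (intro conjI allI)
  have sets: "sets \<rho> = sets borel_Rplus" using \<rho> by (simp add: stieltjes_representing_def)
  then show "sets (density \<rho> (\<lambda>s. ennreal (1 / c) * ennreal s ^ m)) = sets borel_Rplus" by simp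
  have pm: "(\<lambda>s. ennreal s ^ k) \<in> borel_measurable \<rho>" for k
    by (intro measurable_borel_Rplus_sets[OF sets] borel_Rplus_measurableI) measurable
  fix n
  have "(\<integral>\<^sup>+s. ennreal s ^ n \<partial>density \<rho> (\<lambda>s. ennreal (1 / c) * ennreal s ^ m))
      = (\<integral>\<^sup>+s. ennreal (1 / c) * ennreal s ^ (n + m) \<partial>\<rho>)"
    using pm by (subst nn_integral_density) (simp_all add: power_add mult_ac borel_measurable_times)
  also have "\<dots> = ennreal (1 / c) * ennreal (t (n + m))"
    using pm[of "n + m"] \<rho> by (simp add: nn_integral_cmult stieltjes_representing_def)
  also have "\<dots> = ennreal (t' n)" using c t' by (simp add: shift ennreal_mult[symmetric])
  finally show "(\<integral>\<^sup>+s. ennreal s ^ n \<partial>density \<rho> (\<lambda>s. ennreal (1 / c) * ennreal s ^ m)) = ennreal (t' n)" .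
qed

lemma stieltjes_representing_prob:
  assumes "stieltjes_representing \<mu> t" "t 0 = 1"
  shows "prob_Rplus \<mu>"
proof -
  have "emeasure \<mu> (space \<mu>) = (\<integral>\<^sup>+s. ennreal s ^ 0 \<partial>\<mu>)" by simp
  also have "\<dots> = ennreal (t 0)" using assms(1) unfolding stieltjes_representing_def by blast
  finally show ?thesis using assms by (auto simp: prob_Rplus_def stieltjes_representing_def intro!: prob_spaceI)
qed

text \<open>If the mixture is \<open>s\<^sup>m d\<rho>(s) / c\<close>, its integrals are integrals with respect to \<open>\<rho>\<close>.\<close>

lemma nn_integral_inverse_power_transfer:
  assumes mix: "density \<rho> (\<lambda>s. ennreal (1 / c) * ennreal s ^ m) = mixture A d \<mu>"
    and sets: "sets \<rho> = sets borel_Rplus" and \<mu>: "\<And>i. i \<in> A \<Longrightarrow> prob_Rplus (\<mu> i)" and c: "0 < c"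
    and f: "f \<in> borel_measurable borel_Rplus"
  shows "ennreal c * (\<Sum>\<^sub>\<infinity>i\<in>A. ennreal (d i) * (\<integral>\<^sup>+s. f s \<partial>\<mu> i)) = (\<integral>\<^sup>+s. f s * ennreal s ^ m \<partial>\<rho>)"
proof -
  have [measurable]: "f \<in> borel_measurable \<rho>" "(\<lambda>s. ennreal s ^ m) \<in> borel_measurable \<rho>"
    by (rule measurable_borel_Rplus_sets[OF sets f])
      (intro measurable_borel_Rplus_sets[OF sets] borel_Rplus_measurableI, measurable)
  have "(\<Sum>\<^sub>\<infinity>i\<in>A. ennreal (d i) * (\<integral>\<^sup>+s. f s \<partial>\<mu> i)) = (\<integral>\<^sup>+s. f s \<partial>density \<rho> (\<lambda>s. ennreal (1 / c) * ennreal s ^ m))"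
    unfolding mix using \<mu> f by (simp add: nn_integral_mixture)
  also have "\<dots> = (\<integral>\<^sup>+s. ennreal (1 / c) * (f s * ennreal s ^ m) \<partial>\<rho>)"
    by (subst nn_integral_density) (simp_all add: mult_ac)
  also have "\<dots> = ennreal (1 / c) * (\<integral>\<^sup>+s. f s * ennreal s ^ m \<partial>\<rho>)"
    by (rule nn_integral_cmult) measurable
  finally show ?thesis using c by (simp add: mult.assoc[symmetric] ennreal_mult[symmetric])
qed

lemma ennreal_inverse_times:
  assumes "0 < x"
  shows "1 / ennreal x * ennreal x = 1"
proof -
  have "1 / ennreal x * ennreal x = ennreal (1 / x) * ennreal x"
    using divide_ennreal[of 1 x] assms unfolding ennreal_1 by simp
  also have "\<dots> = ennreal (1 / x * x)" by (rule ennreal_mult''[symmetric]) (use assms in simp)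
  also have "\<dots> = 1" using assms by simp
  finally show ?thesis .
qed

lemma ennreal_inverse_power_times_power:
  assumes "0 \<le> s"
  shows "1 / ennreal s ^ Suc m * ennreal s ^ Suc m = indicator {0<..} s"
proof (cases "s = 0")
  case False
  then have "0 < s ^ Suc m" using assms by simp
  then have "1 / ennreal (s ^ Suc m) * ennreal (s ^ Suc m) = 1" by (rule ennreal_inverse_times)
  then show ?thesis unfolding ennreal_power[OF assms] using False assms by (simp only:) simp
next
  case True
  then show ?thesis by simp
qed

text \<open>At \<open>s = 0\<close> the conventions \<open>1 / 0 = \<infinity>\<close> and \<open>\<infinity> * 0 = 0\<close> agree with \<open>0\<^sup>m = 0\<close>, which is where \<open>m > 0\<close> enters.\<close>

lemma ennreal_inverse_times_power:
  assumes "0 \<le> s" "0 < m"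
  shows "1 / ennreal s * ennreal s ^ Suc m = ennreal s ^ m"
proof (cases "s = 0")
  case False
  have "1 / ennreal s * ennreal s ^ Suc m = (1 / ennreal s * ennreal s) * ennreal s ^ m"
    unfolding power_Suc by (rule mult.assoc[symmetric])
  also have "1 / ennreal s * ennreal s = 1" by (rule ennreal_inverse_times) (use False assms(1) in simp)
  finally show ?thesis by simp
next
  case True
  then show ?thesis using assms(2) by simp
qed

text \<open>The common source of conditions (B) to (E): the weighted sum of negative moments measures how much of
\<open>\<rho>\<close> lies off the origin.\<close>

lemma inverse_power_mixture:
  assumes \<rho>: "stieltjes_representing \<rho> t" and mix: "density \<rho> (\<lambda>s. ennreal (1 / c) * ennreal s ^ Suc m) = mixture A d \<mu>"
    and \<mu>: "\<And>i. i \<in> A \<Longrightarrow> prob_Rplus (\<mu> i)" and c: "0 < c"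
  shows "ennreal c * (\<Sum>\<^sub>\<infinity>i\<in>A. ennreal (d i) * (\<integral>\<^sup>+s. 1 / ennreal s ^ Suc m \<partial>\<mu> i)) = emeasure \<rho> {0<..}"
proof -
  have sets: "sets \<rho> = sets borel_Rplus" using \<rho> by (simp add: stieltjes_representing_def)
  then have sp: "space \<rho> = {0..}" using sets_eq_imp_space_eq space_borel_Rplus by metis
  have "{0<..} \<in> sets borel_Rplus"
    by (auto simp: borel_Rplus_def sets_restrict_space image_iff intro!: bexI[of _ "{0<..}"])
  then have pos: "{0<..} \<in> sets \<rho>" by (simp add: sets)
  have "ennreal c * (\<Sum>\<^sub>\<infinity>i\<in>A. ennreal (d i) * (\<integral>\<^sup>+s. 1 / ennreal s ^ Suc m \<partial>\<mu> i))
      = (\<integral>\<^sup>+s. 1 / ennreal s ^ Suc m * ennreal s ^ Suc m \<partial>\<rho>)"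
    by (rule nn_integral_inverse_power_transfer[OF mix sets \<mu> c]) (auto intro!: borel_Rplus_measurableI)
  also have "\<dots> = (\<integral>\<^sup>+s. indicator {0<..} s \<partial>\<rho>)"
    by (rule nn_integral_cong) (rule ennreal_inverse_power_times_power, simp add: sp)
  also have "\<dots> = emeasure \<rho> {0<..}" using pos by (rule nn_integral_indicator)
  finally show ?thesis .
qed

section \<open>Consistency conditions for the representing measures\<close>

theorem theorem4p3:
  fixes \<eta> \<kappa> :: enat and w :: "vertex \<Rightarrow> complex"
  assumes "\<eta> \<ge> 2"
    and "\<forall>v\<in>verts_nonroot \<eta> \<kappa>. w v \<noteq> 0"
    and "subnormal TYPE('k::complex_hilbert_space) (verts \<eta> \<kappa>) (weighted_shift \<eta> \<kappa> w)"
    and "basis_fun (Trunk 0) \<in> smooth_domain (weighted_shift \<eta> \<kappa> w)"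
  shows "(determinate_stieltjes_moment_seq (\<lambda>n. branch_sum \<eta> w (n + 1)) \<longrightarrow>
      (\<kappa> = 0 \<longrightarrow>
        (\<exists>\<mu>. (\<forall>i\<in>J \<eta>. prob_Rplus (\<mu> i)) \<and> cond_A \<eta> w \<mu> \<and> cond_B \<eta> w \<mu>)) \<and>
      (\<forall>k. \<kappa> = enat k \<and> 0 < k \<longrightarrow>
        (\<exists>\<mu>. (\<forall>i\<in>J \<eta>. prob_Rplus (\<mu> i)) \<and>
             cond_A \<eta> w \<mu> \<and> cond_C \<eta> w \<mu> \<and> cond_D \<eta> \<kappa> w \<mu> \<and> cond_E \<eta> k w \<mu>)) \<and>
      (\<forall>k. \<kappa> = enat k \<and> 0 < k \<longrightarrow>
        (\<exists>\<mu> \<nu>. (\<forall>i\<in>J \<eta>. prob_Rplus (\<mu> i)) \<and> prob_Rplus \<nu> \<and>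
             cond_A \<eta> w \<mu> \<and> cond_F k w \<nu> \<and> cond_G \<eta> k w \<mu> \<nu>)) \<and>
      (\<kappa> = \<infinity> \<longrightarrow>
        (\<exists>\<mu>. (\<forall>i\<in>J \<eta>. prob_Rplus (\<mu> i)) \<and>
             cond_A \<eta> w \<mu> \<and> cond_C \<eta> w \<mu> \<and> cond_D \<eta> \<kappa> w \<mu>))) \<and>
    ((\<Sum>n. ennreal (branch_sum \<eta> w (Suc n) powr (- 1 / (2 * real (Suc n))))) = \<infinity> \<longrightarrow>
      determinate_stieltjes_moment_seq (\<lambda>n. branch_sum \<eta> w (n + 1)))"
proof -
  let ?X = "verts \<eta> \<kappa>" and ?L = "shift_map \<eta> \<kappa> w"
  have e0: "smooth_vector \<eta> \<kappa> w (basis_fun (Trunk 0))"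
    by (rule smooth_domain_imp_smooth_vector[OF assms(4)])
  have wB: "w (Branch i j) \<noteq> 0" if "i \<in> J \<eta>" "1 \<le> j" for i j
    using assms(2) that by (simp add: Branch_nonroot_iff)
  have wT: "w (Trunk k) \<noteq> 0" if "Suc k \<in> J \<kappa>" for k
    using assms(2) that by (simp add: Trunk_nonroot_iff)
  have J_Suc: "k = 0 \<or> k \<in> J \<kappa>" if "Suc k \<in> J \<kappa>" for k
    using that by (cases \<kappa>) (auto simp: J_def)
  have prodT: "0 < (cmod (\<Prod>j<k. w (Trunk j)))\<^sup>2" if "k = 0 \<or> k \<in> J \<kappa>" for k
  proof -
    have "Suc j \<in> J \<kappa>" if "j < k" for j
      using that \<open>k = 0 \<or> k \<in> J \<kappa>\<close> by (cases \<kappa>) (auto simp: J_def)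
    then show ?thesis using wT by (simp add: prod_norm[symmetric] prod_pos)
  qed
  have J1: "1 \<in> J \<eta>"
    using assms(1) by (cases \<eta>) (auto simp: J_def one_enat_def[symmetric] numeral_eq_enat)
  have branch_pos: "0 < branch_sum \<eta> w (Suc n)" for n
  proof -
    have "0 < (cmod (\<Prod>j=1..Suc n. w (Branch 1 j)))\<^sup>2"
      using wB[OF J1] by simp
    also have "\<dots> = (\<Sum>i\<in>{1}. (cmod (\<Prod>j=1..Suc n. w (Branch i j)))\<^sup>2)" by simp
    also have "\<dots> \<le> branch_sum \<eta> w (Suc n)"
      unfolding branch_sum_def
      by (rule finite_sum_le_infsum[OF smooth_branching_vertex(1)[OF e0]]) (use J1 in auto)
    finally show ?thesis .
  qed
  \<comment> \<open>The sequence belongs to the vector \<open>S e\<^sub>0\<close>, whose norm is positive because the weights do not vanish.\<close>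
  have branch_moment: "stieltjes_moment_seq (\<lambda>n. branch_sum \<eta> w (n + 1))"
  proof -
    have iter: "(?L ^^ n) ((?L ^^ 1) (basis_fun (Trunk 0))) = (?L ^^ Suc n) (basis_fun (Trunk 0))" for n
      by (simp add: funpow_swap1)
    have nrm: "(ell2_norm ?X ((?L ^^ n) ((?L ^^ 1) (basis_fun (Trunk 0)))))\<^sup>2 = branch_sum \<eta> w (n + 1)" for n
      unfolding iter smooth_branching_vertex(2)[OF e0] by simp
    have "smooth_vector \<eta> \<kappa> w ((?L ^^ 1) (basis_fun (Trunk 0)))"
      using e0 unfolding smooth_vector_def iter by blast
    moreover have "0 < (ell2_norm ?X ((?L ^^ 1) (basis_fun (Trunk 0))))\<^sup>2"
      using nrm[of 0] branch_pos[of 0] by simp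
    ultimately have "stieltjes_moment_seq (\<lambda>n. (ell2_norm ?X ((?L ^^ n) ((?L ^^ 1) (basis_fun (Trunk 0)))))\<^sup>2)"
      by (rule subnormal_shift_stieltjes[OF assms(3)])
    then show ?thesis unfolding nrm .
  qed
  have Carleman: "determinate_stieltjes_moment_seq (\<lambda>n. branch_sum \<eta> w (n + 1))"
    if "(\<Sum>n. ennreal (branch_sum \<eta> w (Suc n) powr (- 1 / (2 * real (Suc n))))) = \<infinity>"
  proof -
    have "\<not> summable (\<lambda>n. branch_sum \<eta> w (n + 1) powr (- 1 / (2 * real (n + 1))))"
    proof
      assume "summable (\<lambda>n. branch_sum \<eta> w (n + 1) powr (- 1 / (2 * real (n + 1))))"
      then have "(\<Sum>n. ennreal (branch_sum \<eta> w (n + 1) powr (- 1 / (2 * real (n + 1))))) \<noteq> \<infinity>"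
        unfolding infinity_ennreal_def by (intro ennreal_suminf_neq_top) simp_all
      then show False using that by simp
    qed
    then show ?thesis
      unfolding determinate_stieltjes_moment_seq_def
      using branch_moment Carleman_Stieltjes[where t = "\<lambda>n. branch_sum \<eta> w (n + 1)"] branch_pos by simp
  qed
  have trunk_rep: "\<exists>\<rho>. stieltjes_representing \<rho> (trunk_moment \<eta> \<kappa> w k)" if k: "k = 0 \<or> k \<in> J \<kappa>" for k
  proof -
    have "Trunk k \<in> ?X" using k by (auto simp: verts_def)
    then have "0 < (ell2_norm ?X (basis_fun (Trunk k)))\<^sup>2" by (simp add: ell2_norm_basis_fun)
    then have "stieltjes_moment_seq (\<lambda>n. (ell2_norm ?X ((?L ^^ n) (basis_fun (Trunk k))))\<^sup>2)"
      by (rule subnormal_shift_stieltjes[OF assms(3) smooth_Trunk[OF e0 k]])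
    then show ?thesis unfolding stieltjes_moment_seq_def trunk_moment_def[abs_def] by blast
  qed
  define u where "u i n = (cmod (\<Prod>j=2..n+1. w (Branch i j)))\<^sup>2" for i n
  have "\<exists>\<mu>. stieltjes_representing \<mu> (u i)" if i: "i \<in> J \<eta>" for i
  proof -
    have X: "Branch i (n + 1) \<in> ?X" for n using i by (auto simp: verts_def)
    have nrm: "(ell2_norm ?X ((?L ^^ n) (basis_fun (Branch i 1))))\<^sup>2 = u i n" for n
      unfolding shift_iter_Branch[OF i] ell2_norm_scale ell2_norm_basis_fun[OF X] u_def by simp
    have "0 < (ell2_norm ?X (basis_fun (Branch i 1)))\<^sup>2" using nrm[of 0] by (simp add: u_def)
    then have "stieltjes_moment_seq (\<lambda>n. (ell2_norm ?X ((?L ^^ n) (basis_fun (Branch i 1))))\<^sup>2)"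
      by (rule subnormal_shift_stieltjes[OF assms(3) smooth_Branch[OF i]])
    then show ?thesis unfolding nrm stieltjes_moment_seq_def by blast
  qed
  then obtain \<mu> where \<mu>: "\<And>i. i \<in> J \<eta> \<Longrightarrow> stieltjes_representing (\<mu> i) (u i)" by metis
  have \<mu>_prob: "prob_Rplus (\<mu> i)" if "i \<in> J \<eta>" for i
    by (rule stieltjes_representing_prob[OF \<mu>[OF that]]) (simp add: u_def)
  have A: "cond_A \<eta> w \<mu>"
    using \<mu> unfolding cond_A_def stieltjes_representing_def u_def by blast
  define d where "d i = (cmod (w (Branch i 1)))\<^sup>2" for i
  have mix: "stieltjes_representing (mixture (J \<eta>) d \<mu>) (\<lambda>n. branch_sum \<eta> w (n + 1))"
    unfolding stieltjes_representing_def
  proof (intro conjI allI)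
    show "sets (mixture (J \<eta>) d \<mu>) = sets borel_Rplus" by (rule sets_mixture[OF \<mu>_prob])
    fix n
    have "(\<integral>\<^sup>+s. ennreal s ^ n \<partial>mixture (J \<eta>) d \<mu>)
        = (\<Sum>\<^sub>\<infinity>i\<in>J \<eta>. ennreal (d i) * (\<integral>\<^sup>+s. ennreal s ^ n \<partial>\<mu> i))"
      by (rule nn_integral_mixture[OF \<mu>_prob]) (auto intro!: borel_Rplus_measurableI)
    also have "\<dots> = (\<Sum>\<^sub>\<infinity>i\<in>J \<eta>. ennreal ((cmod (\<Prod>j=1..Suc n. w (Branch i j)))\<^sup>2))"
    proof (rule infsum_cong)
      fix i assume "i \<in> J \<eta>"
      then have "(\<integral>\<^sup>+s. ennreal s ^ n \<partial>\<mu> i) = ennreal (u i n)"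
        using \<mu> unfolding stieltjes_representing_def by blast
      moreover have "(\<Prod>j=1..Suc n. w (Branch i j)) = w (Branch i 1) * (\<Prod>j=2..n+1. w (Branch i j))"
        by (subst prod.atLeast_Suc_atMost) (simp_all add: numeral_2_eq_2)
      ultimately show "ennreal (d i) * (\<integral>\<^sup>+s. ennreal s ^ n \<partial>\<mu> i)
          = ennreal ((cmod (\<Prod>j=1..Suc n. w (Branch i j)))\<^sup>2)"
        by (simp only: u_def d_def ennreal_mult[symmetric] zero_le_power2 norm_mult power_mult_distrib)
    qed
    also have "\<dots> = ennreal (branch_sum \<eta> w (n + 1))"
      unfolding branch_sum_def Suc_eq_plus1[symmetric]
      by (rule ennreal_infsum[OF _ smooth_branching_vertex(1)[OF e0]]) simp
    finally show "(\<integral>\<^sup>+s. ennreal s ^ n \<partial>mixture (J \<eta>) d \<mu>) = ennreal (branch_sum \<eta> w (n + 1))" .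
  qed
  have main: "(\<kappa> = 0 \<longrightarrow> cond_B \<eta> w \<mu>) \<and>
      (\<forall>k. \<kappa> = enat k \<and> 0 < k \<longrightarrow> cond_C \<eta> w \<mu> \<and> cond_D \<eta> \<kappa> w \<mu> \<and> cond_E \<eta> k w \<mu>) \<and>
      (\<forall>k. \<kappa> = enat k \<and> 0 < k \<longrightarrow> (\<exists>\<nu>. prob_Rplus \<nu> \<and> cond_F k w \<nu> \<and> cond_G \<eta> k w \<mu> \<nu>)) \<and>
      (\<kappa> = \<infinity> \<longrightarrow> cond_C \<eta> w \<mu> \<and> cond_D \<eta> \<kappa> w \<mu>)"
    if det: "determinate_stieltjes_moment_seq (\<lambda>n. branch_sum \<eta> w (n + 1))"
  proof -
    let ?c = "\<lambda>k. (cmod (\<Prod>j<k. w (Trunk j)))\<^sup>2"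
    let ?I = "\<lambda>k. \<Sum>\<^sub>\<infinity>i\<in>J \<eta>. ennreal ((cmod (w (Branch i 1)))\<^sup>2) * (\<integral>\<^sup>+s. 1 / ennreal s ^ (k + 1) \<partial>\<mu> i)"
    have trunk0: "trunk_moment \<eta> \<kappa> w k 0 = 1" if "k = 0 \<or> k \<in> J \<kappa>" for k
      using trunk_moment_initial[OF that, of 0] by simp
    \<comment> \<open>Both measures represent the same sequence, so determinacy identifies them.\<close>
    have dens: "density \<rho> (\<lambda>s. ennreal (1 / ?c k) * ennreal s ^ Suc k) = mixture (J \<eta>) d \<mu>"
      if "k = 0 \<or> k \<in> J \<kappa>" "stieltjes_representing \<rho> (trunk_moment \<eta> \<kappa> w k)" for k \<rho>
    proof -
      have "stieltjes_representing (density \<rho> (\<lambda>s. ennreal (1 / ?c k) * ennreal s ^ Suc k)) (\<lambda>n. branch_sum \<eta> w (n + 1))"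
      proof (rule stieltjes_representing_density[OF that(2) prodT[OF that(1)]])
        show "trunk_moment \<eta> \<kappa> w k (n + Suc k) = ?c k * branch_sum \<eta> w (n + 1)" for n
          using trunk_moment_tail[OF e0 that(1), of n] by simp
        show "0 \<le> branch_sum \<eta> w (n + 1)" for n using branch_pos[of n] by simp
      qed
      then show ?thesis using mix det unfolding determinate_stieltjes_moment_seq_def by blast
    qed
    \<comment> \<open>All of (B) to (E) are statements about the numbers \<open>?c k * ?I k\<close>.\<close>
    have I: "ennreal (?c k) * ?I k = emeasure \<rho> {0<..}"
      if "k = 0 \<or> k \<in> J \<kappa>" "stieltjes_representing \<rho> (trunk_moment \<eta> \<kappa> w k)" for k \<rho>
      using inverse_power_mixture[OF that(2) dens[OF that] \<mu>_prob prodT[OF that(1)]] by (simp add: d_def del: power_Suc)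
    have I_le: "ennreal (?c k) * ?I k \<le> 1" if k: "k = 0 \<or> k \<in> J \<kappa>" for k
    proof -
      obtain \<rho> where \<rho>: "stieltjes_representing \<rho> (trunk_moment \<eta> \<kappa> w k)" using trunk_rep[OF k] by blast
      then interpret prob_space \<rho>
        using stieltjes_representing_prob[where t = "trunk_moment \<eta> \<kappa> w k", OF \<rho> trunk0[OF k]]
        by (simp add: prob_Rplus_def)
      show ?thesis unfolding I[OF k \<rho>] by (rule emeasure_le_1)
    qed
    have I_eq: "ennreal (?c k) * ?I k = 1" if Sk: "Suc k \<in> J \<kappa>" for k
    proof -
      have k: "k = 0 \<or> k \<in> J \<kappa>" by (rule J_Suc[OF Sk])
      obtain \<rho>' where \<rho>': "stieltjes_representing \<rho>' (trunk_moment \<eta> \<kappa> w (Suc k))"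
        using trunk_rep[of "Suc k"] Sk by blast
      \<comment> \<open>This representing measure of the sequence at \<open>-k\<close> has no atom at 0.\<close>
      define \<rho> where "\<rho> = density \<rho>' (\<lambda>s. ennreal (1 / (cmod (w (Trunk k)))\<^sup>2) * ennreal s ^ 1)"
      have \<rho>: "stieltjes_representing \<rho> (trunk_moment \<eta> \<kappa> w k)"
        unfolding \<rho>_def
        by (rule stieltjes_representing_density[OF \<rho>'])
          (use wT[OF Sk] in \<open>simp_all add: trunk_moment_Suc[OF Sk], simp add: trunk_moment_def\<close>)
      have pr: "prob_Rplus \<rho>" by (rule stieltjes_representing_prob[where t = "trunk_moment \<eta> \<kappa> w k", OF \<rho> trunk0[OF k]])
      then interpret prob_space \<rho> by (simp add: prob_Rplus_def)
      have sets': "sets \<rho>' = sets borel_Rplus" using \<rho>' by (simp add: stieltjes_representing_def)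
      have sp: "space \<rho> = {0..}" using pr sets_eq_imp_space_eq space_borel_Rplus unfolding prob_Rplus_def by metis
      have "(\<lambda>s. ennreal (1 / (cmod (w (Trunk k)))\<^sup>2) * ennreal s ^ 1) \<in> borel_measurable \<rho>'"
        by (intro measurable_borel_Rplus_sets[OF sets'] borel_Rplus_measurableI) measurable
      then have "AE s in \<rho>. s \<noteq> 0" unfolding \<rho>_def by (subst AE_density) auto
      then have "AE s in \<rho>. s \<in> {0<..}" using AE_space by eventually_elim (simp add: sp)
      moreover have "{0<..} \<in> events"
        using pr by (auto simp: prob_Rplus_def borel_Rplus_def sets_restrict_space image_iff intro!: bexI[of _ "{0<..}"])
      ultimately have "emeasure \<rho> {0<..} = 1" by (rule emeasure_eq_1_AE[rotated])
      then show ?thesis using I[OF k \<rho>] by simp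
    qed
    have C: "cond_C \<eta> w \<mu>" if "1 \<in> J \<kappa>" using I_eq[of 0] that by (simp add: cond_C_def)
    have D: "cond_D \<eta> \<kappa> w \<mu>"
      unfolding cond_D_def
    proof
      fix l assume "l \<in> J (\<kappa> - 1)"
      then have "Suc l \<in> J \<kappa>" by (cases \<kappa>) (auto simp: J_def one_enat_def)
      then show "ennreal (?c l) * ?I l = 1" by (rule I_eq)
    qed
    have B: "cond_B \<eta> w \<mu>" using I_le[of 0] by (simp add: cond_B_def)
    have E: "cond_E \<eta> k w \<mu>" if "k \<in> J \<kappa>" for k using I_le[of k] that unfolding cond_E_def by blast
    have FG: "\<exists>\<nu>. prob_Rplus \<nu> \<and> cond_F k w \<nu> \<and> cond_G \<eta> k w \<mu> \<nu>" if k: "k \<in> J \<kappa>" for k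
    proof -
      have k': "k = 0 \<or> k \<in> J \<kappa>" and k0: "0 < k" using k by (auto simp: J_def)
      obtain \<nu> where \<nu>: "stieltjes_representing \<nu> (trunk_moment \<eta> \<kappa> w k)" using trunk_rep[OF k'] by blast
      have sets: "sets \<nu> = sets borel_Rplus" using \<nu> by (simp add: stieltjes_representing_def)
      have sp: "space \<nu> = {0..}" using sets sets_eq_imp_space_eq space_borel_Rplus by metis
      have "cond_F k w \<nu>"
        unfolding cond_F_def
      proof
        fix n assume "n \<in> J (enat k)"
        then have "trunk_moment \<eta> \<kappa> w k n = (cmod (\<Prod>j\<in>{k - n..<k}. w (Trunk j)))\<^sup>2"
          by (intro trunk_moment_initial[OF k']) (simp add: J_def)
        then show "(\<integral>\<^sup>+s. ennreal s ^ n \<partial>\<nu>) = ennreal ((cmod (\<Prod>j\<in>{k - n..<k}. w (Trunk j)))\<^sup>2)"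
          using \<nu> by (simp add: stieltjes_representing_def)
      qed
      moreover have "cond_G \<eta> k w \<mu> \<nu>"
        unfolding cond_G_def
      proof
        fix \<sigma> assume \<sigma>: "\<sigma> \<in> sets borel_Rplus"
        have f: "(\<lambda>s. 1 / ennreal s * indicator \<sigma> s) \<in> borel_measurable borel_Rplus"
        proof -
          have [measurable]: "(\<lambda>s. 1 / ennreal s) \<in> borel_measurable borel_Rplus"
            by (rule borel_Rplus_measurableI) measurable
          have [measurable]: "\<sigma> \<in> sets borel_Rplus" by (rule \<sigma>)
          show ?thesis by measurable
        qed
        have "ennreal (?c k) * (\<Sum>\<^sub>\<infinity>i\<in>J \<eta>. ennreal (d i) * (\<integral>\<^sup>+s. 1 / ennreal s * indicator \<sigma> s \<partial>\<mu> i))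
            = (\<integral>\<^sup>+s. 1 / ennreal s * indicator \<sigma> s * ennreal s ^ Suc k \<partial>\<nu>)"
          by (rule nn_integral_inverse_power_transfer[OF dens[OF k' \<nu>] sets \<mu>_prob prodT[OF k'] f])
        also have "\<dots> = (\<integral>\<^sup>+s. ennreal s ^ k * indicator \<sigma> s \<partial>\<nu>)"
        proof (rule nn_integral_cong)
          fix s assume "s \<in> space \<nu>"
          then have "1 / ennreal s * ennreal s ^ Suc k = ennreal s ^ k"
            by (intro ennreal_inverse_times_power k0) (simp add: sp)
          then show "1 / ennreal s * indicator \<sigma> s * ennreal s ^ Suc k = ennreal s ^ k * indicator \<sigma> s"
            by (simp only: mult.assoc mult.left_commute mult.commute)
        qed
        finally show "(\<integral>\<^sup>+s\<in>\<sigma>. ennreal s ^ k \<partial>\<nu>) = ennreal (?c k) * (\<Sum>\<^sub>\<infinity>i\<in>J \<eta>.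
            ennreal ((cmod (w (Branch i 1)))\<^sup>2) * (\<integral>\<^sup>+s\<in>\<sigma>. 1 / ennreal s \<partial>\<mu> i))"
          by (simp add: d_def)
      qed
      ultimately show ?thesis using stieltjes_representing_prob[where t = "trunk_moment \<eta> \<kappa> w k", OF \<nu> trunk0[OF k']] by blast
    qed
    have fin: "k \<in> J \<kappa> \<and> 1 \<in> J \<kappa>" if "\<kappa> = enat k \<and> 0 < k" for k
      using that by (auto simp: J_def one_enat_def)
    have inf: "1 \<in> J \<kappa>" if "\<kappa> = \<infinity>" using that by (simp add: J_def)
    show ?thesis using B C D E FG fin inf by blast
  qed
  show ?thesis using main Carleman A \<mu>_prob by blast
qed

end
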